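(* Let $\mathbf{C}$ be a locally small 2-cocomplete strict $(2,1)$-category. Let $I\subset Arr(\mathbf{C})$ be a set of 1-cells, and assume that the domains of the members of $I$ are small relative to $I$-cell. Then for any 1-cell $f:\mathcal{X}\to\mathcal{Y}$ of $\mathbf{C}$ there are 1-cells $\mathcal{X}\xrightarrow{f'}\mathcal{Z}\xrightarrow{f''}\mathcal{Y}$ such that $f'\in I$-cell, $f''\in I$-inj and $f''\circ f'$ is isomorphic to $f$.
   Context: A strict $(2,1)$-category is a strict 2-category all of whose 2-cells are invertible. Homotopy (2-)colimits in it are colimits in the $(\infty,1)$-categorical sense: a homotopy cocone under a small 2-diagram (objects $d_i$, 1-cells $f:d_i\to d_j$, 2-cells $\sigma:gf\Rightarrow h$) consists of an object $d$, 1-cells $p_i:d_i\to d$ and invertible 2-cells $p_j f\Rightarrow p_i$ compatible with the 2-cells of the diagram; it is a homotopy colimit if every other homotopy cocone factors through it via a 1-cell and compatible invertible 2-cells, uniquely up to unique compatible 2-cell. $\mathbf{C}$ is 2-cocomplete if all small 2-diagrams have homotopy colimits; 2-pushouts are homotopy pushouts. Transfinite composition: given an ordinal $\lambda$ and a 2-colimit preserving diagram $\mathcal{X}_0\xrightarrow{f_0}\mathcal{X}_1\xrightarrow{f_1}\dots$ indexed by $\lambda$ with homotopy colimit $\mathcal{X}$, the coprojection $\mathcal{X}_0\to\mathcal{X}$ is the transfinite composition of the $\lambda$-sequence $(f_i)_{i<\lambda}$. $I$-cell is the class of 1-cells that can be written as a transfinite composition of 2-pushouts of members of $I$. $I$-inj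 is the class of 1-cells $f:\mathcal{X}\to\mathcal{Y}$ with the following right lifting property: for every $g:\mathcal{C}\to\mathcal{D}$ in $I$, all 1-cells $h:\mathcal{C}\to\mathcal{X}$, $h':\mathcal{D}\to\mathcal{Y}$ and every 2-cell $\eta:h'g\Rightarrow fh$, there are a 1-cell $k:\mathcal{D}\to\mathcal{X}$ and 2-cells $\nu_1:kg\Rightarrow h$, $\nu_2:h'\Rightarrow fk$ with $\eta=(f\nu_1)\circ(\nu_2 g)$. An object $\mathcal{X}$ is $\lambda$-small with respect to (relative to) a subcategory $J$ if $\mathbf{C}(\mathcal{X},-)$ commutes with $\lambda$-filtered sequential 2-colimits formed in $J$ (i.e. 2-colimits of colimit-preserving sequences indexed by an ordinal in which every subset of cardinality $<\lambda$ has an upper bound, with 1-cells in $J$). $\mathcal{X}$ is small relative to $J$ if it is $\lambda$-small relative to $J$ for some cardinal $\lambda$. *)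

theory Defs
  imports Main "HOL-Library.FuncSet"
begin

unbundle cardinal_syntax

section \<open>Smallness\<close>

text \<open>
  ``Small'' means: of cardinality less than a fixed inaccessible cardinal \<open>\<kappa>\<close>, which plays the
  role of the class of all cardinals (equivalently, small sets are the sets equinumerous to a
  member of a Grothendieck universe). Ordinals, cardinals and the shapes of small diagrams can be
  taken on the carrier type \<open>'k\<close> of \<open>\<kappa>\<close>, because every small set is equinumerous to a subset of it.
\<close>

definition inaccessible :: "'k rel \<Rightarrow> bool" where
  "inaccessible \<kappa> \<longleftrightarrow>
     Card_order \<kappa> \<and> natLeq <o \<kappa> \<and> regularCard \<kappa> \<and>
     (\<forall>A :: 'k set. |A| <o \<kappa> \<longrightarrow> |Pow A| <o \<kappa>)"

definition small :: "'k rel \<Rightarrow> 'a set \<Rightarrow> bool" where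
  "small \<kappa> A \<longleftrightarrow> |A| <o \<kappa>"


section \<open>Strict (2,1)-categories\<close>

record ('o, 'm, 'c) two_cat =
  Obj :: "'o set"
  Arr :: "'m set"
  Src :: "'m \<Rightarrow> 'o"
  Tgt :: "'m \<Rightarrow> 'o"
  Id1 :: "'o \<Rightarrow> 'm"
  Comp :: "'m \<Rightarrow> 'm \<Rightarrow> 'm" (infixl "\<cdot>\<index>" 75)
  Cell :: "'c set"
  Dom :: "'c \<Rightarrow> 'm"
  Cod :: "'c \<Rightarrow> 'm"
  Id2 :: "'m \<Rightarrow> 'c"
  VComp :: "'c \<Rightarrow> 'c \<Rightarrow> 'c" (infixl "\<odot>\<index>" 65)
  HComp :: "'c \<Rightarrow> 'c \<Rightarrow> 'c" (infixl "\<star>\<index>" 70)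

definition hom1 :: "('o, 'm, 'c) two_cat \<Rightarrow> 'o \<Rightarrow> 'o \<Rightarrow> 'm set" where
  "hom1 C x y = {f \<in> Arr C. Src C f = x \<and> Tgt C f = y}"

definition hom2 :: "('o, 'm, 'c) two_cat \<Rightarrow> 'm \<Rightarrow> 'm \<Rightarrow> 'c set" where
  "hom2 C f g = {\<alpha> \<in> Cell C. Dom C \<alpha> = f \<and> Cod C \<alpha> = g}"

text \<open>All three compositions are written in applicative order: \<open>g \<cdot> f\<close>, \<open>\<beta> \<odot> \<alpha>\<close> and \<open>\<beta> \<star> \<alpha>\<close>
  mean ``first \<open>f\<close> (respectively \<open>\<alpha>\<close>)''.\<close>

locale strict_21_category =
  fixes C :: "('o, 'm, 'c) two_cat" (structure)
  assumes src_tgt: "f \<in> Arr C \<Longrightarrow> Src C f \<in> Obj C \<and> Tgt C f \<in> Obj C"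
    and id1_in: "x \<in> Obj C \<Longrightarrow> Id1 C x \<in> hom1 C x x"
    and comp_in: "f \<in> hom1 C x y \<Longrightarrow> g \<in> hom1 C y z \<Longrightarrow> g \<cdot> f \<in> hom1 C x z"
    and comp_id: "f \<in> hom1 C x y \<Longrightarrow> f \<cdot> Id1 C x = f \<and> Id1 C y \<cdot> f = f"
    and comp_assoc: "f \<in> hom1 C w x \<Longrightarrow> g \<in> hom1 C x y \<Longrightarrow> h \<in> hom1 C y z \<Longrightarrow>
                       h \<cdot> (g \<cdot> f) = (h \<cdot> g) \<cdot> f"
    and cell_parallel: "\<alpha> \<in> Cell C \<Longrightarrow>
          Dom C \<alpha> \<in> Arr C \<and> Cod C \<alpha> \<in> Arr C \<and>
          Src C (Dom C \<alpha>) = Src C (Cod C \<alpha>) \<and> Tgt C (Dom C \<alpha>) = Tgt C (Cod C \<alpha>)"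
    and id2_in: "f \<in> Arr C \<Longrightarrow> Id2 C f \<in> hom2 C f f"
    and vcomp_in: "\<alpha> \<in> hom2 C f g \<Longrightarrow> \<beta> \<in> hom2 C g h \<Longrightarrow> \<beta> \<odot> \<alpha> \<in> hom2 C f h"
    and vcomp_id: "\<alpha> \<in> hom2 C f g \<Longrightarrow> \<alpha> \<odot> Id2 C f = \<alpha> \<and> Id2 C g \<odot> \<alpha> = \<alpha>"
    and vcomp_assoc: "\<alpha> \<in> hom2 C e f \<Longrightarrow> \<beta> \<in> hom2 C f g \<Longrightarrow> \<gamma> \<in> hom2 C g h \<Longrightarrow>
                        \<gamma> \<odot> (\<beta> \<odot> \<alpha>) = (\<gamma> \<odot> \<beta>) \<odot> \<alpha>"
    and vcomp_inverse: "\<alpha> \<in> hom2 C f g \<Longrightarrow>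
          \<exists>\<beta> \<in> hom2 C g f. \<beta> \<odot> \<alpha> = Id2 C f \<and> \<alpha> \<odot> \<beta> = Id2 C g"
    and hcomp_in: "\<alpha> \<in> hom2 C f f' \<Longrightarrow> \<beta> \<in> hom2 C g g' \<Longrightarrow> Tgt C f = Src C g \<Longrightarrow>
                     \<beta> \<star> \<alpha> \<in> hom2 C (g \<cdot> f) (g' \<cdot> f')"
    and hcomp_id2: "f \<in> hom1 C x y \<Longrightarrow> g \<in> hom1 C y z \<Longrightarrow> Id2 C g \<star> Id2 C f = Id2 C (g \<cdot> f)"
    and interchange: "\<alpha> \<in> hom2 C f f' \<Longrightarrow> \<alpha>' \<in> hom2 C f' f'' \<Longrightarrow>
                      \<beta> \<in> hom2 C g g' \<Longrightarrow> \<beta>' \<in> hom2 C g' g'' \<Longrightarrow> Tgt C f = Src C g \<Longrightarrow>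
                      (\<beta>' \<odot> \<beta>) \<star> (\<alpha>' \<odot> \<alpha>) = (\<beta>' \<star> \<alpha>') \<odot> (\<beta> \<star> \<alpha>)"
    and hcomp_unit: "\<alpha> \<in> hom2 C f f' \<Longrightarrow>
          \<alpha> \<star> Id2 C (Id1 C (Src C f)) = \<alpha> \<and> Id2 C (Id1 C (Tgt C f)) \<star> \<alpha> = \<alpha>"
    and hcomp_assoc: "\<alpha> \<in> hom2 C f f' \<Longrightarrow> \<beta> \<in> hom2 C g g' \<Longrightarrow> \<gamma> \<in> hom2 C h h' \<Longrightarrow>
                      Tgt C f = Src C g \<Longrightarrow> Tgt C g = Src C h \<Longrightarrow>
                      \<gamma> \<star> (\<beta> \<star> \<alpha>) = (\<gamma> \<star> \<beta>) \<star> \<alpha>"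

definition lwhisker :: "('o, 'm, 'c) two_cat \<Rightarrow> 'm \<Rightarrow> 'c \<Rightarrow> 'c" where
  "lwhisker C g \<alpha> = Id2 C g \<star>\<^bsub>C\<^esub> \<alpha>"

definition rwhisker :: "('o, 'm, 'c) two_cat \<Rightarrow> 'c \<Rightarrow> 'm \<Rightarrow> 'c" where
  "rwhisker C \<alpha> f = \<alpha> \<star>\<^bsub>C\<^esub> Id2 C f"

definition isomorphic1 :: "('o, 'm, 'c) two_cat \<Rightarrow> 'm \<Rightarrow> 'm \<Rightarrow> bool" where
  "isomorphic1 C f g \<longleftrightarrow>
     (\<exists>\<alpha> \<in> hom2 C f g. \<exists>\<beta> \<in> hom2 C g f. \<beta> \<odot>\<^bsub>C\<^esub> \<alpha> = Id2 C f \<and> \<alpha> \<odot>\<^bsub>C\<^esub> \<beta> = Id2 C g)"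

definition locally_small :: "'k rel \<Rightarrow> ('o, 'm, 'c) two_cat \<Rightarrow> bool" where
  "locally_small \<kappa> C \<longleftrightarrow>
     (\<forall>x \<in> Obj C. \<forall>y \<in> Obj C. small \<kappa> (hom1 C x y) \<and>
        (\<forall>f \<in> hom1 C x y. \<forall>g \<in> hom1 C x y. small \<kappa> (hom2 C f g)))"


section \<open>Homotopy colimits\<close>

text \<open>
  A 2-diagram consists of objects \<open>dob i\<close>, 1-cells \<open>dar e : dob i \<rightarrow> dob j\<close> and, for each triangle
  \<open>t\<close> with edges \<open>f = tri1 t : i \<rightarrow> j\<close>, \<open>g = tri2 t : j \<rightarrow> k\<close>, \<open>h = tri3 t : i \<rightarrow> k\<close>, a 2-cell
  \<open>dcell t : g f \<Rightarrow> h\<close>. Identity edges and coherence relations between the 2-cells need not be part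
  of the shape: cocones do not see the latter, and an edge \<open>e\<close> carrying an identity 1-cell with the
  triangle \<open>e e \<Rightarrow> e\<close> carrying the identity 2-cell forces its cocone 2-cell to be an identity.
  So colimits of pseudofunctors on small (2,1)-categories are a special case.
\<close>

record ('v, 'e, 't, 'o, 'm, 'c) diagram =
  verts :: "'v set"
  edges :: "'e set"
  tris :: "'t set"
  esrc :: "'e \<Rightarrow> 'v"
  etgt :: "'e \<Rightarrow> 'v"
  tri1 :: "'t \<Rightarrow> 'e"
  tri2 :: "'t \<Rightarrow> 'e"
  tri3 :: "'t \<Rightarrow> 'e"
  dob :: "'v \<Rightarrow> 'o"
  dar :: "'e \<Rightarrow> 'm"
  dcell :: "'t \<Rightarrow> 'c"

definition is_diagram ::
  "('o, 'm, 'c) two_cat \<Rightarrow> ('v, 'e, 't, 'o, 'm, 'c) diagram \<Rightarrow> bool" where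
  "is_diagram C D \<longleftrightarrow>
     (\<forall>v \<in> verts D. dob D v \<in> Obj C) \<and>
     (\<forall>e \<in> edges D. esrc D e \<in> verts D \<and> etgt D e \<in> verts D \<and>
        dar D e \<in> hom1 C (dob D (esrc D e)) (dob D (etgt D e))) \<and>
     (\<forall>t \<in> tris D. tri1 D t \<in> edges D \<and> tri2 D t \<in> edges D \<and> tri3 D t \<in> edges D \<and>
        etgt D (tri1 D t) = esrc D (tri2 D t) \<and>
        esrc D (tri3 D t) = esrc D (tri1 D t) \<and>
        etgt D (tri3 D t) = etgt D (tri2 D t) \<and>
        dcell D t \<in> hom2 C (dar D (tri2 D t) \<cdot>\<^bsub>C\<^esub> dar D (tri1 D t)) (dar D (tri3 D t)))"

text \<open>The 2-cell of a cocone at an edge \<open>f : i \<rightarrow> j\<close> goes from \<open>p\<^sub>j f\<close> to \<open>p\<^sub>i\<close>. Here and below,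
  invertibility of 2-cells is automatic, as it holds for all 2-cells of a (2,1)-category.\<close>

record ('v, 'e, 'o, 'm, 'c) cocone =
  apex :: 'o
  leg :: "'v \<Rightarrow> 'm"
  legcell :: "'e \<Rightarrow> 'c"

definition is_cocone ::
  "('o, 'm, 'c) two_cat \<Rightarrow> ('v, 'e, 't, 'o, 'm, 'c) diagram \<Rightarrow>
   ('v, 'e, 'o, 'm, 'c) cocone \<Rightarrow> bool" where
  "is_cocone C D K \<longleftrightarrow>
     apex K \<in> Obj C \<and>
     (\<forall>v \<in> verts D. leg K v \<in> hom1 C (dob D v) (apex K)) \<and>
     (\<forall>e \<in> edges D. legcell K e \<in>
        hom2 C (leg K (etgt D e) \<cdot>\<^bsub>C\<^esub> dar D e) (leg K (esrc D e))) \<and>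
     (\<forall>t \<in> tris D.
        legcell K (tri3 D t) \<odot>\<^bsub>C\<^esub> lwhisker C (leg K (etgt D (tri2 D t))) (dcell D t) =
        legcell K (tri1 D t) \<odot>\<^bsub>C\<^esub> rwhisker C (legcell K (tri2 D t)) (dar D (tri1 D t)))"

definition is_factorization ::
  "('o, 'm, 'c) two_cat \<Rightarrow> ('v, 'e, 't, 'o, 'm, 'c) diagram \<Rightarrow>
   ('v, 'e, 'o, 'm, 'c) cocone \<Rightarrow> ('v, 'e, 'o, 'm, 'c) cocone \<Rightarrow>
   'm \<Rightarrow> ('v \<Rightarrow> 'c) \<Rightarrow> bool" where
  "is_factorization C D K K' u \<psi> \<longleftrightarrow>
     u \<in> hom1 C (apex K) (apex K') \<and>
     (\<forall>v \<in> verts D. \<psi> v \<in> hom2 C (u \<cdot>\<^bsub>C\<^esub> leg K v) (leg K' v)) \<and>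
     (\<forall>e \<in> edges D.
        \<psi> (esrc D e) \<odot>\<^bsub>C\<^esub> lwhisker C u (legcell K e) =
        legcell K' e \<odot>\<^bsub>C\<^esub> rwhisker C (\<psi> (etgt D e)) (dar D e))"

definition is_hocolim ::
  "('o, 'm, 'c) two_cat \<Rightarrow> ('v, 'e, 't, 'o, 'm, 'c) diagram \<Rightarrow>
   ('v, 'e, 'o, 'm, 'c) cocone \<Rightarrow> bool" where
  "is_hocolim C D K \<longleftrightarrow>
     is_diagram C D \<and> is_cocone C D K \<and>
     (\<forall>K'. is_cocone C D K' \<longrightarrow>
        (\<exists>u \<psi>. is_factorization C D K K' u \<psi>) \<and>
        (\<forall>u \<psi> u' \<psi>'. is_factorization C D K K' u \<psi> \<and> is_factorization C D K K' u' \<psi>' \<longrightarrow>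
           (\<exists>!\<theta>. \<theta> \<in> hom2 C u u' \<and>
              (\<forall>v \<in> verts D. \<psi>' v \<odot>\<^bsub>C\<^esub> rwhisker C \<theta> (leg K v) = \<psi> v))))"

definition two_cocomplete :: "'k rel \<Rightarrow> ('o, 'm, 'c) two_cat \<Rightarrow> bool" where
  "two_cocomplete \<kappa> C \<longleftrightarrow>
     (\<forall>D :: ('k, 'k, 'k, 'o, 'm, 'c) diagram.
        is_diagram C D \<and> small \<kappa> (verts D) \<and> small \<kappa> (edges D) \<and> small \<kappa> (tris D) \<longrightarrow>
        (\<exists>K. is_hocolim C D K))"


section \<open>2-pushouts\<close>

datatype span_vertex = Peak | Foot1 | Foot2
datatype span_edge = Leg1 | Leg2

definition span_diagram ::
  "('o, 'm, 'c) two_cat \<Rightarrow> 'm \<Rightarrow> 'm \<Rightarrow>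
   (span_vertex, span_edge, unit, 'o, 'm, 'c) diagram" where
  "span_diagram C g h =
     \<lparr> verts = UNIV, edges = UNIV, tris = {},
       esrc = (\<lambda>_. Peak), etgt = case_span_edge Foot1 Foot2,
       tri1 = undefined, tri2 = undefined, tri3 = undefined,
       dob = case_span_vertex (Src C g) (Tgt C g) (Tgt C h),
       dar = case_span_edge g h,
       dcell = undefined \<rparr>"

definition two_pushouts :: "('o, 'm, 'c) two_cat \<Rightarrow> 'm set \<Rightarrow> 'm set" where
  "two_pushouts C I =
     {leg K Foot2 | g h K. g \<in> I \<and> h \<in> Arr C \<and> Src C h = Src C g \<and>
                           is_hocolim C (span_diagram C g h) K}"


section \<open>Sequences indexed by ordinals and transfinite composition\<close>

definition strictly_less :: "'w rel \<Rightarrow> 'w \<Rightarrow> 'w \<Rightarrow> bool" where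
  "strictly_less r i j \<longleftrightarrow> (i, j) \<in> r \<and> i \<noteq> j"

definition successor_pair :: "'w rel \<Rightarrow> 'w \<Rightarrow> 'w \<Rightarrow> bool" where
  "successor_pair r i j \<longleftrightarrow>
     strictly_less r i j \<and> (\<nexists>k. strictly_less r i k \<and> strictly_less r k j)"

definition limit_point :: "'w rel \<Rightarrow> 'w \<Rightarrow> bool" where
  "limit_point r b \<longleftrightarrow>
     b \<in> Field r \<and> (\<exists>i. strictly_less r i b) \<and> (\<nexists>i. successor_pair r i b)"

definition is_least :: "'w rel \<Rightarrow> 'w \<Rightarrow> bool" where
  "is_least r b \<longleftrightarrow> b \<in> Field r \<and> (\<forall>i \<in> Field r. (b, i) \<in> r)"

text \<open>A sequence indexed by a well-order is a pseudofunctor on it that is strictly unital, so that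
  only the 1-cells \<open>sar i j\<close> for \<open>i < j\<close> and the 2-cells \<open>scell i j k\<close> from \<open>sar j k \<cdot> sar i j\<close> to
  \<open>sar i k\<close> for \<open>i < j < k\<close> are recorded.\<close>

record ('w, 'o, 'm, 'c) sequence =
  sob :: "'w \<Rightarrow> 'o"
  sar :: "'w \<Rightarrow> 'w \<Rightarrow> 'm"
  scell :: "'w \<Rightarrow> 'w \<Rightarrow> 'w \<Rightarrow> 'c"

definition is_pseudofunctor ::
  "('o, 'm, 'c) two_cat \<Rightarrow> 'w rel \<Rightarrow> ('w, 'o, 'm, 'c) sequence \<Rightarrow> bool" where
  "is_pseudofunctor C r S \<longleftrightarrow>
     (\<forall>i \<in> Field r. sob S i \<in> Obj C) \<and>
     (\<forall>i j. strictly_less r i j \<longrightarrow> sar S i j \<in> hom1 C (sob S i) (sob S j)) \<and>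
     (\<forall>i j k. strictly_less r i j \<and> strictly_less r j k \<longrightarrow>
        scell S i j k \<in> hom2 C (sar S j k \<cdot>\<^bsub>C\<^esub> sar S i j) (sar S i k)) \<and>
     (\<forall>i j k l. strictly_less r i j \<and> strictly_less r j k \<and> strictly_less r k l \<longrightarrow>
        scell S i k l \<odot>\<^bsub>C\<^esub> lwhisker C (sar S k l) (scell S i j k) =
        scell S i j l \<odot>\<^bsub>C\<^esub> rwhisker C (scell S j k l) (sar S i j))"

text \<open>The restriction of a sequence to a set \<open>A\<close> of indices, as a 2-diagram.\<close>

definition seq_diagram ::
  "'w rel \<Rightarrow> 'w set \<Rightarrow> ('w, 'o, 'm, 'c) sequence \<Rightarrow>
   ('w, 'w \<times> 'w, 'w \<times> 'w \<times> 'w, 'o, 'm, 'c) diagram" where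
  "seq_diagram r A S =
     \<lparr> verts = A,
       edges = {(i, j). i \<in> A \<and> j \<in> A \<and> strictly_less r i j},
       tris = {(i, j, k). i \<in> A \<and> j \<in> A \<and> k \<in> A \<and> strictly_less r i j \<and> strictly_less r j k},
       esrc = fst, etgt = snd,
       tri1 = (\<lambda>(i, j, k). (i, j)), tri2 = (\<lambda>(i, j, k). (j, k)), tri3 = (\<lambda>(i, j, k). (i, k)),
       dob = sob S,
       dar = (\<lambda>(i, j). sar S i j),
       dcell = (\<lambda>(i, j, k). scell S i j k) \<rparr>"

definition seq_cocone ::
  "('w, 'o, 'm, 'c) sequence \<Rightarrow> 'w \<Rightarrow> ('w, 'w \<times> 'w, 'o, 'm, 'c) cocone" where
  "seq_cocone S b =
     \<lparr> apex = sob S b, leg = (\<lambda>i. sar S i b), legcell = (\<lambda>(i, j). scell S i j b) \<rparr>"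

text \<open>As usual, preservation of colimits is required at limit ordinals only; in particular the
  initial term of a sequence is arbitrary.\<close>

definition colimit_preserving_sequence ::
  "('o, 'm, 'c) two_cat \<Rightarrow> 'w rel \<Rightarrow> ('w, 'o, 'm, 'c) sequence \<Rightarrow> bool" where
  "colimit_preserving_sequence C r S \<longleftrightarrow>
     Well_order r \<and> Field r \<noteq> {} \<and> is_pseudofunctor C r S \<and>
     (\<forall>b. limit_point r b \<longrightarrow>
        is_hocolim C (seq_diagram r {i. strictly_less r i b} S) (seq_cocone S b))"

definition is_transfinite_composition ::
  "('o, 'm, 'c) two_cat \<Rightarrow> 'w rel \<Rightarrow> ('w, 'o, 'm, 'c) sequence \<Rightarrow> 'm \<Rightarrow> bool" where
  "is_transfinite_composition C r S f \<longleftrightarrow>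
     colimit_preserving_sequence C r S \<and>
     (\<exists>K b. is_hocolim C (seq_diagram r (Field r) S) K \<and> is_least r b \<and> f = leg K b)"


section \<open>Cellular and injective 1-cells\<close>

definition I_cell :: "'k rel \<Rightarrow> ('o, 'm, 'c) two_cat \<Rightarrow> 'm set \<Rightarrow> 'm set" where
  "I_cell \<kappa> C I =
     {f. \<exists>(r :: 'k rel) S. small \<kappa> (Field r) \<and> is_transfinite_composition C r S f \<and>
           (\<forall>i j. successor_pair r i j \<longrightarrow> sar S i j \<in> two_pushouts C I)}"

definition I_inj :: "('o, 'm, 'c) two_cat \<Rightarrow> 'm set \<Rightarrow> 'm set" where
  "I_inj C I =
     {f \<in> Arr C. \<forall>g \<in> I.
        \<forall>h \<in> hom1 C (Src C g) (Src C f). \<forall>h' \<in> hom1 C (Tgt C g) (Tgt C f).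
        \<forall>\<eta> \<in> hom2 C (h' \<cdot>\<^bsub>C\<^esub> g) (f \<cdot>\<^bsub>C\<^esub> h).
          \<exists>k \<in> hom1 C (Tgt C g) (Src C f).
          \<exists>\<nu>\<^sub>1 \<in> hom2 C (k \<cdot>\<^bsub>C\<^esub> g) h. \<exists>\<nu>\<^sub>2 \<in> hom2 C h' (f \<cdot>\<^bsub>C\<^esub> k).
            \<eta> = lwhisker C f \<nu>\<^sub>1 \<odot>\<^bsub>C\<^esub> rwhisker C \<nu>\<^sub>2 g}"


section \<open>The (2,1)-category of small groupoids\<close>

record ('a, 'b) groupoid =
  gobj :: "'a set"
  garr :: "'b set"
  gdom :: "'b \<Rightarrow> 'a"
  gcod :: "'b \<Rightarrow> 'a"
  gid :: "'a \<Rightarrow> 'b"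
  gcomp :: "'b \<Rightarrow> 'b \<Rightarrow> 'b"

definition ghom :: "('a, 'b) groupoid \<Rightarrow> 'a \<Rightarrow> 'a \<Rightarrow> 'b set" where
  "ghom G x y = {a \<in> garr G. gdom G a = x \<and> gcod G a = y}"

definition is_groupoid :: "('a, 'b) groupoid \<Rightarrow> bool" where
  "is_groupoid G \<longleftrightarrow>
     (\<forall>a \<in> garr G. gdom G a \<in> gobj G \<and> gcod G a \<in> gobj G) \<and>
     (\<forall>x \<in> gobj G. gid G x \<in> ghom G x x) \<and>
     (\<forall>x y z a b. a \<in> ghom G x y \<and> b \<in> ghom G y z \<longrightarrow> gcomp G b a \<in> ghom G x z) \<and>
     (\<forall>x y a. a \<in> ghom G x y \<longrightarrow> gcomp G a (gid G x) = a \<and> gcomp G (gid G y) a = a) \<and>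
     (\<forall>w x y z a b c. a \<in> ghom G w x \<and> b \<in> ghom G x y \<and> c \<in> ghom G y z \<longrightarrow>
        gcomp G c (gcomp G b a) = gcomp G (gcomp G c b) a) \<and>
     (\<forall>x y a. a \<in> ghom G x y \<longrightarrow>
        (\<exists>b \<in> ghom G y x. gcomp G b a = gid G x \<and> gcomp G a b = gid G y))"

text \<open>Functors and natural transformations carry their source and target; their underlying maps
  are extensional, so that equality of records is equality of functors (transformations).\<close>

record ('a, 'b) gfunctor =
  fsrc :: "('a, 'b) groupoid"
  ftgt :: "('a, 'b) groupoid"
  fobj :: "'a \<Rightarrow> 'a"
  farr :: "'b \<Rightarrow> 'b"

definition is_gfunctor :: "('a, 'b) gfunctor \<Rightarrow> bool" where
  "is_gfunctor F \<longleftrightarrow>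
     fobj F \<in> gobj (fsrc F) \<rightarrow>\<^sub>E gobj (ftgt F) \<and>
     farr F \<in> garr (fsrc F) \<rightarrow>\<^sub>E garr (ftgt F) \<and>
     (\<forall>x y a. a \<in> ghom (fsrc F) x y \<longrightarrow> farr F a \<in> ghom (ftgt F) (fobj F x) (fobj F y)) \<and>
     (\<forall>x \<in> gobj (fsrc F). farr F (gid (fsrc F) x) = gid (ftgt F) (fobj F x)) \<and>
     (\<forall>x y z a b. a \<in> ghom (fsrc F) x y \<and> b \<in> ghom (fsrc F) y z \<longrightarrow>
        farr F (gcomp (fsrc F) b a) = gcomp (ftgt F) (farr F b) (farr F a))"

record ('a, 'b) gtrans =
  nsrc :: "('a, 'b) gfunctor"
  ntgt :: "('a, 'b) gfunctor"
  ncmp :: "'a \<Rightarrow> 'b"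

definition is_gtrans :: "('a, 'b) gtrans \<Rightarrow> bool" where
  "is_gtrans \<alpha> \<longleftrightarrow>
     fsrc (nsrc \<alpha>) = fsrc (ntgt \<alpha>) \<and> ftgt (nsrc \<alpha>) = ftgt (ntgt \<alpha>) \<and>
     ncmp \<alpha> \<in> extensional (gobj (fsrc (nsrc \<alpha>))) \<and>
     (\<forall>x \<in> gobj (fsrc (nsrc \<alpha>)).
        ncmp \<alpha> x \<in> ghom (ftgt (nsrc \<alpha>)) (fobj (nsrc \<alpha>) x) (fobj (ntgt \<alpha>) x)) \<and>
     (\<forall>x y a. a \<in> ghom (fsrc (nsrc \<alpha>)) x y \<longrightarrow>
        gcomp (ftgt (nsrc \<alpha>)) (ncmp \<alpha> y) (farr (nsrc \<alpha>) a) =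
        gcomp (ftgt (nsrc \<alpha>)) (farr (ntgt \<alpha>) a) (ncmp \<alpha> x))"

definition gfcomp :: "('a, 'b) gfunctor \<Rightarrow> ('a, 'b) gfunctor \<Rightarrow> ('a, 'b) gfunctor" where
  "gfcomp G F =
     \<lparr> fsrc = fsrc F, ftgt = ftgt G,
       fobj = (\<lambda>x \<in> gobj (fsrc F). fobj G (fobj F x)),
       farr = (\<lambda>a \<in> garr (fsrc F). farr G (farr F a)) \<rparr>"

definition small_groupoids :: "'k rel \<Rightarrow> ('a, 'b) groupoid set" where
  "small_groupoids \<kappa> = {G. is_groupoid G \<and> small \<kappa> (gobj G) \<and> small \<kappa> (garr G)}"

definition small_gfunctors :: "'k rel \<Rightarrow> ('a, 'b) gfunctor set" where
  "small_gfunctors \<kappa> =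
     {F. fsrc F \<in> small_groupoids \<kappa> \<and> ftgt F \<in> small_groupoids \<kappa> \<and> is_gfunctor F}"

definition Gpd ::
  "'k rel \<Rightarrow> (('a, 'b) groupoid, ('a, 'b) gfunctor, ('a, 'b) gtrans) two_cat" where
  "Gpd \<kappa> =
     \<lparr> Obj = small_groupoids \<kappa>,
       Arr = small_gfunctors \<kappa>,
       Src = fsrc,
       Tgt = ftgt,
       Id1 = (\<lambda>G. \<lparr> fsrc = G, ftgt = G, fobj = (\<lambda>x \<in> gobj G. x), farr = (\<lambda>a \<in> garr G. a) \<rparr>),
       Comp = gfcomp,
       Cell = {\<alpha>. nsrc \<alpha> \<in> small_gfunctors \<kappa> \<and> ntgt \<alpha> \<in> small_gfunctors \<kappa> \<and> is_gtrans \<alpha>},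
       Dom = nsrc,
       Cod = ntgt,
       Id2 = (\<lambda>F. \<lparr> nsrc = F, ntgt = F,
                    ncmp = (\<lambda>x \<in> gobj (fsrc F). gid (ftgt F) (fobj F x)) \<rparr>),
       VComp = (\<lambda>\<beta> \<alpha>. \<lparr> nsrc = nsrc \<alpha>, ntgt = ntgt \<beta>,
                    ncmp = (\<lambda>x \<in> gobj (fsrc (nsrc \<alpha>)).
                              gcomp (ftgt (nsrc \<alpha>)) (ncmp \<beta> x) (ncmp \<alpha> x)) \<rparr>),
       HComp = (\<lambda>\<beta> \<alpha>. \<lparr> nsrc = gfcomp (nsrc \<beta>) (nsrc \<alpha>), ntgt = gfcomp (ntgt \<beta>) (ntgt \<alpha>),
                    ncmp = (\<lambda>x \<in> gobj (fsrc (nsrc \<alpha>)).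
                              gcomp (ftgt (nsrc \<beta>)) (ncmp \<beta> (fobj (ntgt \<alpha>) x))
                                                    (farr (nsrc \<beta>) (ncmp \<alpha> x))) \<rparr>) \<rparr>"


section \<open>The representable 2-functor \<open>C(x, -)\<close>\<close>

text \<open>The hom-groupoids \<open>C(x, y)\<close> are embedded into the left summands of the types \<open>'m + 'k\<close> and
  \<open>'c + 'k\<close>. The right summands ensure that every small groupoid has an isomorphic copy on these
  types, so that \<^const>\<open>Gpd\<close> on them is indeed the (2,1)-category of all small groupoids, no
  matter how few elements \<open>'m\<close> and \<open>'c\<close> have.\<close>

definition hom_groupoid ::
  "('o, 'm, 'c) two_cat \<Rightarrow> 'o \<Rightarrow> 'o \<Rightarrow> ('m + 'k, 'c + 'k) groupoid" where
  "hom_groupoid C x y =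
     \<lparr> gobj = Inl ` hom1 C x y,
       garr = Inl ` {\<alpha> \<in> Cell C. Dom C \<alpha> \<in> hom1 C x y},
       gdom = (\<lambda>a. Inl (Dom C (projl a))),
       gcod = (\<lambda>a. Inl (Cod C (projl a))),
       gid = (\<lambda>u. Inl (Id2 C (projl u))),
       gcomp = (\<lambda>b a. Inl (projl b \<odot>\<^bsub>C\<^esub> projl a)) \<rparr>"

definition hom_functor ::
  "('o, 'm, 'c) two_cat \<Rightarrow> 'o \<Rightarrow> 'm \<Rightarrow> ('m + 'k, 'c + 'k) gfunctor" where
  "hom_functor C x f =
     \<lparr> fsrc = hom_groupoid C x (Src C f),
       ftgt = hom_groupoid C x (Tgt C f),
       fobj = (\<lambda>u \<in> gobj (hom_groupoid C x (Src C f)). Inl (f \<cdot>\<^bsub>C\<^esub> projl u)),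
       farr = (\<lambda>a \<in> garr (hom_groupoid C x (Src C f)). Inl (lwhisker C f (projl a))) \<rparr>"

definition hom_trans ::
  "('o, 'm, 'c) two_cat \<Rightarrow> 'o \<Rightarrow> 'c \<Rightarrow> ('m + 'k, 'c + 'k) gtrans" where
  "hom_trans C x \<alpha> =
     \<lparr> nsrc = hom_functor C x (Dom C \<alpha>),
       ntgt = hom_functor C x (Cod C \<alpha>),
       ncmp = (\<lambda>u \<in> gobj (hom_groupoid C x (Src C (Dom C \<alpha>))).
                 Inl (rwhisker C \<alpha> (projl u))) \<rparr>"

definition hom_diagram ::
  "('o, 'm, 'c) two_cat \<Rightarrow> 'o \<Rightarrow> ('v, 'e, 't, 'o, 'm, 'c) diagram \<Rightarrow>
   ('v, 'e, 't, ('m + 'k, 'c + 'k) groupoid, ('m + 'k, 'c + 'k) gfunctor,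
    ('m + 'k, 'c + 'k) gtrans) diagram" where
  "hom_diagram C x D =
     \<lparr> verts = verts D, edges = edges D, tris = tris D, esrc = esrc D, etgt = etgt D,
       tri1 = tri1 D, tri2 = tri2 D, tri3 = tri3 D,
       dob = (\<lambda>v. hom_groupoid C x (dob D v)),
       dar = (\<lambda>e. hom_functor C x (dar D e)),
       dcell = (\<lambda>t. hom_trans C x (dcell D t)) \<rparr>"

definition hom_cocone ::
  "('o, 'm, 'c) two_cat \<Rightarrow> 'o \<Rightarrow> ('v, 'e, 'o, 'm, 'c) cocone \<Rightarrow>
   ('v, 'e, ('m + 'k, 'c + 'k) groupoid, ('m + 'k, 'c + 'k) gfunctor,
    ('m + 'k, 'c + 'k) gtrans) cocone" where
  "hom_cocone C x K =
     \<lparr> apex = hom_groupoid C x (apex K),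
       leg = (\<lambda>v. hom_functor C x (leg K v)),
       legcell = (\<lambda>e. hom_trans C x (legcell K e)) \<rparr>"


section \<open>Small objects\<close>

definition filtered_ordinal :: "'k rel \<Rightarrow> 'w rel \<Rightarrow> bool" where
  "filtered_ordinal \<mu> r \<longleftrightarrow>
     (\<forall>A \<subseteq> Field r. |A| <o \<mu> \<longrightarrow> (\<exists>b \<in> Field r. \<forall>a \<in> A. (a, b) \<in> r))"

definition card_small_relative ::
  "'k rel \<Rightarrow> ('o, 'm, 'c) two_cat \<Rightarrow> 'm set \<Rightarrow> 'k rel \<Rightarrow> 'o \<Rightarrow> bool" where
  "card_small_relative \<kappa> C J \<mu> x \<longleftrightarrow>
     (\<forall>(r :: 'k rel) S K.
        small \<kappa> (Field r) \<and> filtered_ordinal \<mu> r \<and> colimit_preserving_sequence C r S \<and>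
        (\<forall>i j. strictly_less r i j \<longrightarrow> sar S i j \<in> J) \<and>
        is_hocolim C (seq_diagram r (Field r) S) K \<longrightarrow>
        is_hocolim (Gpd \<kappa> :: (('m + 'k, 'c + 'k) groupoid, _, _) two_cat)
          (hom_diagram C x (seq_diagram r (Field r) S)) (hom_cocone C x K))"

definition small_relative ::
  "'k rel \<Rightarrow> ('o, 'm, 'c) two_cat \<Rightarrow> 'm set \<Rightarrow> 'o \<Rightarrow> bool" where
  "small_relative \<kappa> C J x \<longleftrightarrow>
     (\<exists>\<mu> :: 'k rel. Card_order \<mu> \<and> \<mu> <o \<kappa> \<and> card_small_relative \<kappa> C J \<mu> x)"

end

theory Submission
  imports Defs
begin

text \<open>This is the small object argument. Starting from \<open>f : X \<rightarrow> Y\<close>, a sequence of objects \<open>Z\<^sub>k\<close> over \<open>Y\<close> is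
built by transfinite recursion: \<open>Z\<close> at the least index is \<open>X\<close>, at limit indices it is the homotopy
colimit of what came before, and at the successor of \<open>i\<close> a single 2-pushout of a member of \<open>I\<close> is
attached to \<open>Z\<^sub>i\<close>, chosen so as to solve one lifting problem between a member of \<open>I\<close> and the
structure map \<open>p\<close> of an earlier object (\<open>pushout_solves\<close>, \<open>next_stage\<close>). If some stage has no lifting
problems at all, its structure map is already in \<open>I\<close>-inj and the construction stops there.

Otherwise the recursion is run along all of \<open>\<kappa>\<close>. An index \<open>i\<close> is assigned a pair (stage, code of a
problem of that stage) in such a way that every pair is met at arbitrarily late indices
(\<open>bookkeeping\<close>). As \<open>\<kappa>\<close> is regular and each stage has a small set of problems, all problems of stage
\<open>j\<close> are solved before some \<open>T j\<close> in \<open>\<kappa>\<close>. There is a limit index \<open>\<delta>\<close> that is closed under \<open>T\<close> and whose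
cofinality exceeds the smallness cardinals of the domains of \<open>I\<close> (\<open>exists_closed_limit_point\<close>). The
factorization is \<open>X \<rightarrow> Z\<^sub>\<delta> \<rightarrow> Y\<close>: a lifting problem against \<open>Z\<^sub>\<delta> \<rightarrow> Y\<close> has its domain mapped into the
colimit \<open>Z\<^sub>\<delta>\<close>, so by smallness it comes from a stage \<open>j\<close> below \<open>\<delta>\<close>, was solved at a stage \<open>k\<close> below
\<open>\<delta>\<close>, and the solution is pushed forward to \<open>Z\<^sub>\<delta>\<close> (\<open>stage_injective\<close>). This is the reason for attaching
cells one at a time along a long index: no comparison of coproducts of cells with transfinite
compositions is required, and the length is adjusted afterwards.

Three points need work beyond the classical argument. Smallness is a statement about sequences whose
1-cells \<open>Z\<^sub>i \<rightarrow> Z\<^sub>j\<close> all lie in \<open>I\<close>-cell, so segments of the sequence must again be transfinite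
compositions (\<open>segment_I_cell\<close>); this rests on the cofinality of final segments for homotopy colimits
(\<open>is_hocolim_final_segment\<close>). Smallness is phrased through homotopy colimits of groupoids, from which
essential surjectivity is extracted by mapping to the one-object groupoid of the group with two
elements (\<open>Gpd_hocolim_covered\<close>). And the 2-cells have to be carried along: a stage consists of a
cocone under the earlier stages, a structure map to \<open>Y\<close>, and the 2-cells that compare the structure
maps; the latter form a factorization of the cocone with apex \<open>Y\<close> through the former cocone.\<close>

section \<open>Calculus of 2-cells\<close>

text \<open>The axioms are restated with equational side conditions on domains and codomains and oriented towards
a normal form: composites are associated to the right, whiskering is distributed over vertical
composition, successive whiskerings by 1-cells are merged, and left whiskering is done before right
whiskering. Composability of the cells involved is then decided by rewriting.\<close>

context strict_21_category
begin

lemma arr_obj [simp]: "f \<in> Arr C \<Longrightarrow> Src C f \<in> Obj C" "f \<in> Arr C \<Longrightarrow> Tgt C f \<in> Obj C"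
  using src_tgt by auto

lemma comp_arr [simp]:
  assumes "f \<in> Arr C" "g \<in> Arr C" "Src C g = Tgt C f"
  shows "g \<cdot> f \<in> Arr C" "Src C (g \<cdot> f) = Src C f" "Tgt C (g \<cdot> f) = Tgt C g"
  using comp_in[of f "Src C f" "Tgt C f" g "Tgt C g"] assms by (auto simp: hom1_def)

lemma comp_assoc_right [simp]:
  assumes "f \<in> Arr C" "g \<in> Arr C" "h \<in> Arr C" "Src C g = Tgt C f" "Src C h = Tgt C g"
  shows "(h \<cdot> g) \<cdot> f = h \<cdot> (g \<cdot> f)"
  using comp_assoc[of f "Src C f" "Tgt C f" g "Tgt C g" h "Tgt C h"] assms by (auto simp: hom1_def)

lemma id1_arr [simp]:
  assumes "x \<in> Obj C"
  shows "Id1 C x \<in> Arr C" "Src C (Id1 C x) = x" "Tgt C (Id1 C x) = x"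
  using id1_in[OF assms] by (auto simp: hom1_def)

lemma comp_id_right [simp]: "f \<in> Arr C \<Longrightarrow> Src C f = x \<Longrightarrow> f \<cdot> Id1 C x = f"
  and comp_id_left [simp]: "f \<in> Arr C \<Longrightarrow> Tgt C f = x \<Longrightarrow> Id1 C x \<cdot> f = f"
  using comp_id[of f "Src C f" "Tgt C f"] by (auto simp: hom1_def)

lemma cell_arr [simp]:
  assumes "\<alpha> \<in> Cell C"
  shows "Dom C \<alpha> \<in> Arr C" "Cod C \<alpha> \<in> Arr C"
    "Src C (Cod C \<alpha>) = Src C (Dom C \<alpha>)" "Tgt C (Cod C \<alpha>) = Tgt C (Dom C \<alpha>)"
  using cell_parallel[OF assms] by auto

lemma vcomp_cell [simp]:
  assumes "\<alpha> \<in> Cell C" "\<beta> \<in> Cell C" "Dom C \<beta> = Cod C \<alpha>"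
  shows "\<beta> \<odot> \<alpha> \<in> Cell C" "Dom C (\<beta> \<odot> \<alpha>) = Dom C \<alpha>" "Cod C (\<beta> \<odot> \<alpha>) = Cod C \<beta>"
  using vcomp_in[of \<alpha> "Dom C \<alpha>" "Cod C \<alpha>" \<beta> "Cod C \<beta>"] assms by (auto simp: hom2_def)

lemma vcomp_assoc_right [simp]:
  assumes "\<alpha> \<in> Cell C" "\<beta> \<in> Cell C" "\<gamma> \<in> Cell C" "Dom C \<beta> = Cod C \<alpha>" "Dom C \<gamma> = Cod C \<beta>"
  shows "(\<gamma> \<odot> \<beta>) \<odot> \<alpha> = \<gamma> \<odot> (\<beta> \<odot> \<alpha>)"
  using vcomp_assoc[of \<alpha> "Dom C \<alpha>" "Cod C \<alpha>" \<beta> "Cod C \<beta>" \<gamma> "Cod C \<gamma>"] assms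
  by (auto simp: hom2_def)

lemma id2_cell [simp]:
  assumes "f \<in> Arr C"
  shows "Id2 C f \<in> Cell C" "Dom C (Id2 C f) = f" "Cod C (Id2 C f) = f"
  using id2_in[OF assms] by (auto simp: hom2_def)

lemma vcomp_id_right [simp]: "\<alpha> \<in> Cell C \<Longrightarrow> Dom C \<alpha> = f \<Longrightarrow> \<alpha> \<odot> Id2 C f = \<alpha>"
  and vcomp_id_left [simp]: "\<alpha> \<in> Cell C \<Longrightarrow> Cod C \<alpha> = f \<Longrightarrow> Id2 C f \<odot> \<alpha> = \<alpha>"
  using vcomp_id[of \<alpha> "Dom C \<alpha>" "Cod C \<alpha>"] by (auto simp: hom2_def)

lemma lwhisker_cell [simp]:
  assumes "\<alpha> \<in> Cell C" "g \<in> Arr C" "Src C g = Tgt C (Dom C \<alpha>)"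
  shows "lwhisker C g \<alpha> \<in> Cell C"
    "Dom C (lwhisker C g \<alpha>) = g \<cdot> Dom C \<alpha>" "Cod C (lwhisker C g \<alpha>) = g \<cdot> Cod C \<alpha>"
  using hcomp_in[of \<alpha> "Dom C \<alpha>" "Cod C \<alpha>" "Id2 C g" g g] assms
  by (auto simp: hom2_def lwhisker_def)

lemma rwhisker_cell [simp]:
  assumes "\<alpha> \<in> Cell C" "f \<in> Arr C" "Src C (Dom C \<alpha>) = Tgt C f"
  shows "rwhisker C \<alpha> f \<in> Cell C"
    "Dom C (rwhisker C \<alpha> f) = Dom C \<alpha> \<cdot> f" "Cod C (rwhisker C \<alpha> f) = Cod C \<alpha> \<cdot> f"
  using hcomp_in[of "Id2 C f" f f \<alpha> "Dom C \<alpha>" "Cod C \<alpha>"] assms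
  by (auto simp: hom2_def rwhisker_def)

lemma lwhisker_vcomp [simp]:
  assumes "\<alpha> \<in> Cell C" "\<beta> \<in> Cell C" "Dom C \<beta> = Cod C \<alpha>" "g \<in> Arr C" "Src C g = Tgt C (Dom C \<alpha>)"
  shows "lwhisker C g (\<beta> \<odot> \<alpha>) = lwhisker C g \<beta> \<odot> lwhisker C g \<alpha>"
  using interchange[of \<alpha> "Dom C \<alpha>" "Cod C \<alpha>" \<beta> "Cod C \<beta>" "Id2 C g" g g "Id2 C g" g] assms
  by (auto simp: hom2_def lwhisker_def)

lemma rwhisker_vcomp [simp]:
  assumes "\<alpha> \<in> Cell C" "\<beta> \<in> Cell C" "Dom C \<beta> = Cod C \<alpha>" "f \<in> Arr C" "Src C (Dom C \<alpha>) = Tgt C f"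
  shows "rwhisker C (\<beta> \<odot> \<alpha>) f = rwhisker C \<beta> f \<odot> rwhisker C \<alpha> f"
  using interchange[of "Id2 C f" f f "Id2 C f" f \<alpha> "Dom C \<alpha>" "Cod C \<alpha>" \<beta> "Cod C \<beta>"] assms
  by (auto simp: hom2_def rwhisker_def)

lemma whisker_id2 [simp]:
  assumes "f \<in> Arr C" "g \<in> Arr C" "Src C g = Tgt C f"
  shows "lwhisker C g (Id2 C f) = Id2 C (g \<cdot> f)" "rwhisker C (Id2 C g) f = Id2 C (g \<cdot> f)"
  using hcomp_id2[of f "Src C f" "Tgt C f" g "Tgt C g"] assms
  by (auto simp: hom1_def lwhisker_def rwhisker_def)

lemma lwhisker_lwhisker [simp]:
  assumes "\<alpha> \<in> Cell C" "g \<in> Arr C" "h \<in> Arr C" "Src C g = Tgt C (Dom C \<alpha>)" "Src C h = Tgt C g"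
  shows "lwhisker C h (lwhisker C g \<alpha>) = lwhisker C (h \<cdot> g) \<alpha>"
  using hcomp_assoc[of \<alpha> "Dom C \<alpha>" "Cod C \<alpha>" "Id2 C g" g g "Id2 C h" h h] assms
    hcomp_id2[of g "Src C g" "Tgt C g" h "Tgt C h"]
  by (auto simp: hom2_def hom1_def lwhisker_def)

lemma rwhisker_rwhisker [simp]:
  assumes "\<alpha> \<in> Cell C" "f \<in> Arr C" "g \<in> Arr C" "Src C (Dom C \<alpha>) = Tgt C g" "Src C g = Tgt C f"
  shows "rwhisker C (rwhisker C \<alpha> g) f = rwhisker C \<alpha> (g \<cdot> f)"
  using hcomp_assoc[of "Id2 C f" f f "Id2 C g" g g \<alpha> "Dom C \<alpha>" "Cod C \<alpha>"] assms
    hcomp_id2[of f "Src C f" "Tgt C f" g "Tgt C g"]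
  by (auto simp: hom2_def hom1_def rwhisker_def)

lemma lwhisker_rwhisker [simp]:
  assumes "\<alpha> \<in> Cell C" "f \<in> Arr C" "g \<in> Arr C"
    "Src C (Dom C \<alpha>) = Tgt C f" "Src C g = Tgt C (Dom C \<alpha>)"
  shows "lwhisker C g (rwhisker C \<alpha> f) = rwhisker C (lwhisker C g \<alpha>) f"
  using hcomp_assoc[of "Id2 C f" f f \<alpha> "Dom C \<alpha>" "Cod C \<alpha>" "Id2 C g" g g] assms
  by (auto simp: hom2_def rwhisker_def lwhisker_def)

lemma whisker_id1 [simp]:
  assumes "\<alpha> \<in> Cell C"
  shows "Src C (Dom C \<alpha>) = x \<Longrightarrow> rwhisker C \<alpha> (Id1 C x) = \<alpha>"
    "Tgt C (Dom C \<alpha>) = y \<Longrightarrow> lwhisker C (Id1 C y) \<alpha> = \<alpha>"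
  using hcomp_unit[of \<alpha> "Dom C \<alpha>" "Cod C \<alpha>"] assms
  by (auto simp: hom2_def rwhisker_def lwhisker_def)

text \<open>The interchange law. It is the only law of the calculus without a preferred direction, so it is applied by hand.\<close>

lemma whisker_swap:
  assumes "\<alpha> \<in> Cell C" "\<beta> \<in> Cell C" "Src C (Dom C \<beta>) = Tgt C (Dom C \<alpha>)"
    "f = Dom C \<alpha>" "f' = Cod C \<alpha>" "g = Dom C \<beta>" "g' = Cod C \<beta>"
  shows "rwhisker C \<beta> f' \<odot> lwhisker C g \<alpha> = lwhisker C g' \<alpha> \<odot> rwhisker C \<beta> f"
  using interchange[of \<alpha> f f' "Id2 C f'" f' "Id2 C g" g g \<beta> g']
    interchange[of "Id2 C f" f f \<alpha> f' \<beta> g g' "Id2 C g'" g'] assms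
  by (auto simp: hom2_def rwhisker_def lwhisker_def)

definition inv2 :: "'c \<Rightarrow> 'c" where
  "inv2 \<alpha> = (SOME \<beta>. \<beta> \<in> hom2 C (Cod C \<alpha>) (Dom C \<alpha>) \<and>
     \<beta> \<odot> \<alpha> = Id2 C (Dom C \<alpha>) \<and> \<alpha> \<odot> \<beta> = Id2 C (Cod C \<alpha>))"

lemma inv2_cell [simp]:
  assumes "\<alpha> \<in> Cell C"
  shows "inv2 \<alpha> \<in> Cell C" "Dom C (inv2 \<alpha>) = Cod C \<alpha>" "Cod C (inv2 \<alpha>) = Dom C \<alpha>"
  and "inv2 \<alpha> \<odot> \<alpha> = Id2 C (Dom C \<alpha>)" "\<alpha> \<odot> inv2 \<alpha> = Id2 C (Cod C \<alpha>)"
proof -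
  have "\<alpha> \<in> hom2 C (Dom C \<alpha>) (Cod C \<alpha>)"
    using assms by (auto simp: hom2_def)
  then have "\<exists>\<beta>. \<beta> \<in> hom2 C (Cod C \<alpha>) (Dom C \<alpha>) \<and>
     \<beta> \<odot> \<alpha> = Id2 C (Dom C \<alpha>) \<and> \<alpha> \<odot> \<beta> = Id2 C (Cod C \<alpha>)"
    using vcomp_inverse by blast
  from someI_ex[OF this, folded inv2_def] show "inv2 \<alpha> \<in> Cell C" "Dom C (inv2 \<alpha>) = Cod C \<alpha>"
    "Cod C (inv2 \<alpha>) = Dom C \<alpha>" "inv2 \<alpha> \<odot> \<alpha> = Id2 C (Dom C \<alpha>)"
    "\<alpha> \<odot> inv2 \<alpha> = Id2 C (Cod C \<alpha>)"
    by (simp_all add: hom2_def)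
qed

lemma inv2_vcomp_vcomp [simp]:
  assumes "\<alpha> \<in> Cell C" "\<beta> \<in> Cell C"
  shows "Cod C \<beta> = Dom C \<alpha> \<Longrightarrow> inv2 \<alpha> \<odot> (\<alpha> \<odot> \<beta>) = \<beta>"
    "Cod C \<beta> = Cod C \<alpha> \<Longrightarrow> \<alpha> \<odot> (inv2 \<alpha> \<odot> \<beta>) = \<beta>"
proof -
  show "inv2 \<alpha> \<odot> (\<alpha> \<odot> \<beta>) = \<beta>" if "Cod C \<beta> = Dom C \<alpha>"
    using that assms by (subst vcomp_assoc_right[symmetric]) simp_all
  show "\<alpha> \<odot> (inv2 \<alpha> \<odot> \<beta>) = \<beta>" if "Cod C \<beta> = Cod C \<alpha>"
    using that assms by (subst vcomp_assoc_right[symmetric]) simp_all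
qed

lemma vcomp_cancel_left:
  assumes "\<alpha> \<odot> \<beta> = \<alpha> \<odot> \<gamma>" "\<alpha> \<in> Cell C" "\<beta> \<in> Cell C" "\<gamma> \<in> Cell C"
    "Cod C \<beta> = Dom C \<alpha>" "Cod C \<gamma> = Dom C \<alpha>"
  shows "\<beta> = \<gamma>"
proof -
  have "\<beta> = inv2 \<alpha> \<odot> (\<alpha> \<odot> \<beta>)"
    using assms(2-) by simp
  also have "\<dots> = \<gamma>"
    unfolding assms(1) using assms(2-) by simp
  finally show ?thesis .
qed

lemma vcomp_cancel_right:
  assumes "\<beta> \<odot> \<alpha> = \<gamma> \<odot> \<alpha>" "\<alpha> \<in> Cell C" "\<beta> \<in> Cell C" "\<gamma> \<in> Cell C"
    "Dom C \<beta> = Cod C \<alpha>" "Dom C \<gamma> = Cod C \<alpha>"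
  shows "\<beta> = \<gamma>"
proof -
  have "\<beta> = (\<beta> \<odot> \<alpha>) \<odot> inv2 \<alpha>"
    using assms(2-) by simp
  also have "\<dots> = \<gamma>"
    unfolding assms(1) using assms(2-) by simp
  finally show ?thesis .
qed

lemma inv2_unique:
  assumes "\<beta> \<odot> \<alpha> = Id2 C (Dom C \<alpha>)" "\<alpha> \<in> Cell C" "\<beta> \<in> Cell C" "Dom C \<beta> = Cod C \<alpha>"
  shows "inv2 \<alpha> = \<beta>"
  using assms by (intro vcomp_cancel_right[of "inv2 \<alpha>" \<alpha> \<beta>]) simp_all

lemma lwhisker_inv2 [simp]:
  assumes "\<alpha> \<in> Cell C" "g \<in> Arr C" "Src C g = Tgt C (Dom C \<alpha>)"
  shows "lwhisker C g (inv2 \<alpha>) = inv2 (lwhisker C g \<alpha>)"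
  using lwhisker_vcomp[of \<alpha> "inv2 \<alpha>" g] assms
  by (intro inv2_unique[symmetric]) auto

lemma rwhisker_inv2 [simp]:
  assumes "\<alpha> \<in> Cell C" "f \<in> Arr C" "Src C (Dom C \<alpha>) = Tgt C f"
  shows "rwhisker C (inv2 \<alpha>) f = inv2 (rwhisker C \<alpha> f)"
  using rwhisker_vcomp[of \<alpha> "inv2 \<alpha>" f] assms
  by (intro inv2_unique[symmetric]) auto

lemma isomorphic1I: "\<alpha> \<in> hom2 C f g \<Longrightarrow> isomorphic1 C f g"
  using vcomp_inverse by (auto simp: isomorphic1_def)

end

section \<open>Cocones and modifications\<close>

lemma hocolimD:
  assumes "is_hocolim C D K"
  shows "is_diagram C D" "is_cocone C D K"
    "is_cocone C D K' \<Longrightarrow> \<exists>u \<psi>. is_factorization C D K K' u \<psi>"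
    "is_cocone C D K' \<Longrightarrow> is_factorization C D K K' u \<psi> \<Longrightarrow> is_factorization C D K K' u' \<psi>' \<Longrightarrow>
     \<exists>!\<theta>. \<theta> \<in> hom2 C u u' \<and> (\<forall>v \<in> verts D. \<psi>' v \<odot>\<^bsub>C\<^esub> rwhisker C \<theta> (leg K v) = \<psi> v)"
  using assms unfolding is_hocolim_def by simp_all

context strict_21_category
begin

text \<open>In a triangle \<open>i \<rightarrow> j \<rightarrow> k\<close> with 2-cell \<open>\<sigma>\<close>, suppose that a family \<open>\<psi>\<close> is compatible with the edge
\<open>j \<rightarrow> k\<close>. Precomposing the equation for \<open>i \<rightarrow> k\<close> with the whiskered \<open>\<sigma>\<close>, and the one for \<open>i \<rightarrow> j\<close> with the
whiskered 2-cell of \<open>j \<rightarrow> k\<close>, gives the same equation, and both 2-cells are invertible. The roles of the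
edges cannot be permuted further, because the equation for \<open>j \<rightarrow> k\<close> enters only after whiskering with \<open>f\<close>.\<close>

lemma modification_third_edge:
  assumes cells: "f \<in> hom1 C vi vj" "g \<in> hom1 C vj vk" "h \<in> hom1 C vi vk"
    "ki \<in> hom1 C vi W" "kj \<in> hom1 C vj W" "kk \<in> hom1 C vk W" "u \<in> hom1 C W W'"
    "ki' \<in> hom1 C vi W'" "kj' \<in> hom1 C vj W'" "kk' \<in> hom1 C vk W'"
    "\<sigma> \<in> hom2 C (g \<cdot> f) h"
    "Kij \<in> hom2 C (kj \<cdot> f) ki" "Kjk \<in> hom2 C (kk \<cdot> g) kj" "Kik \<in> hom2 C (kk \<cdot> h) ki"
    "Kij' \<in> hom2 C (kj' \<cdot> f) ki'" "Kjk' \<in> hom2 C (kk' \<cdot> g) kj'" "Kik' \<in> hom2 C (kk' \<cdot> h) ki'"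
    "\<psi>i \<in> hom2 C (u \<cdot> ki) ki'" "\<psi>j \<in> hom2 C (u \<cdot> kj) kj'" "\<psi>k \<in> hom2 C (u \<cdot> kk) kk'"
    and K: "Kik \<odot> lwhisker C kk \<sigma> = Kij \<odot> rwhisker C Kjk f"
    and K': "Kik' \<odot> lwhisker C kk' \<sigma> = Kij' \<odot> rwhisker C Kjk' f"
    and jk: "\<psi>j \<odot> lwhisker C u Kjk = Kjk' \<odot> rwhisker C \<psi>k g"
  shows "\<psi>i \<odot> lwhisker C u Kik = Kik' \<odot> rwhisker C \<psi>k h \<longleftrightarrow>
         \<psi>i \<odot> lwhisker C u Kij = Kij' \<odot> rwhisker C \<psi>j f" (is "?X3 = ?Y3 \<longleftrightarrow> ?X1 = ?Y1")
proof -
  note [simp] = cells[unfolded hom1_def hom2_def mem_Collect_eq]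
  let ?a = "lwhisker C (u \<cdot> kk) \<sigma>" and ?b = "rwhisker C (lwhisker C u Kjk) f"
  have "lwhisker C u (Kik \<odot> lwhisker C kk \<sigma>) = lwhisker C u (Kij \<odot> rwhisker C Kjk f)"
    by (simp only: K)
  then have uK: "lwhisker C u Kik \<odot> ?a = lwhisker C u Kij \<odot> ?b"
    by simp
  have X: "?X3 \<odot> ?a = ?X1 \<odot> ?b"
    by (simp add: uK)
  have "?Y3 \<odot> ?a = Kik' \<odot> (rwhisker C \<psi>k h \<odot> lwhisker C (u \<cdot> kk) \<sigma>)"
    by simp
  also have "rwhisker C \<psi>k h \<odot> lwhisker C (u \<cdot> kk) \<sigma> = lwhisker C kk' \<sigma> \<odot> rwhisker C \<psi>k (g \<cdot> f)"
    by (rule whisker_swap) simp_all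
  also have "Kik' \<odot> \<dots> = (Kik' \<odot> lwhisker C kk' \<sigma>) \<odot> rwhisker C \<psi>k (g \<cdot> f)"
    by simp
  also have "\<dots> = Kij' \<odot> rwhisker C (Kjk' \<odot> rwhisker C \<psi>k g) f"
    unfolding K' by simp
  also have "\<dots> = ?Y1 \<odot> ?b"
    unfolding jk[symmetric] by simp
  finally have Y: "?Y3 \<odot> ?a = ?Y1 \<odot> ?b" .
  show ?thesis
  proof
    assume "?X3 = ?Y3"
    then have "?X1 \<odot> ?b = ?Y1 \<odot> ?b"
      using X Y by metis
    then show "?X1 = ?Y1"
      by (rule vcomp_cancel_right) simp_all
  next
    assume "?X1 = ?Y1"
    then have "?X3 \<odot> ?a = ?Y3 \<odot> ?a"
      using X Y by metis
    then show "?X3 = ?Y3"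
      by (rule vcomp_cancel_right) simp_all
  qed
qed

text \<open>Five vertices \<open>i\<close>, \<open>j\<close>, \<open>k\<close>, \<open>l\<close> and the apex span five tetrahedra. The one without the apex (assumption
\<open>s\<close>) and the one without \<open>i\<close> (assumption \<open>jkl\<close>) being commutative, the six 2-cells from the longest
path \<open>i \<rightarrow> j \<rightarrow> k \<rightarrow> l \<rightarrow> apex\<close> to the leg at \<open>i\<close> that are the two sides of the three remaining triangle
identities are joined in pairs by \<open>E1\<close>, \<open>E2\<close>, \<open>E3\<close>, and with the identities themselves these pairs close
up to a cycle. Since all cells can be cancelled, any two of the identities imply the third.\<close>

lemma cocone_tetrahedron:
  assumes cells: "fij \<in> hom1 C vi vj" "fik \<in> hom1 C vi vk" "fil \<in> hom1 C vi vl"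
    "fjk \<in> hom1 C vj vk" "fjl \<in> hom1 C vj vl" "fkl \<in> hom1 C vk vl"
    "ki \<in> hom1 C vi W" "kj \<in> hom1 C vj W" "kk \<in> hom1 C vk W" "kl \<in> hom1 C vl W"
    "sijk \<in> hom2 C (fjk \<cdot> fij) fik" "sijl \<in> hom2 C (fjl \<cdot> fij) fil"
    "sikl \<in> hom2 C (fkl \<cdot> fik) fil" "sjkl \<in> hom2 C (fkl \<cdot> fjk) fjl"
    "cij \<in> hom2 C (kj \<cdot> fij) ki" "cik \<in> hom2 C (kk \<cdot> fik) ki" "cil \<in> hom2 C (kl \<cdot> fil) ki"
    "cjk \<in> hom2 C (kk \<cdot> fjk) kj" "cjl \<in> hom2 C (kl \<cdot> fjl) kj" "ckl \<in> hom2 C (kl \<cdot> fkl) kk"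
    and s: "sikl \<odot> lwhisker C fkl sijk = sijl \<odot> rwhisker C sjkl fij"
    and jkl: "cjl \<odot> lwhisker C kl sjkl = cjk \<odot> rwhisker C ckl fjk"
  shows "cik \<odot> lwhisker C kk sijk = cij \<odot> rwhisker C cjk fij \<Longrightarrow>
         cil \<odot> lwhisker C kl sikl = cik \<odot> rwhisker C ckl fik \<Longrightarrow>
         cil \<odot> lwhisker C kl sijl = cij \<odot> rwhisker C cjl fij"
    and "cik \<odot> lwhisker C kk sijk = cij \<odot> rwhisker C cjk fij \<Longrightarrow>
         cil \<odot> lwhisker C kl sijl = cij \<odot> rwhisker C cjl fij \<Longrightarrow>
         cil \<odot> lwhisker C kl sikl = cik \<odot> rwhisker C ckl fik"
    and "cil \<odot> lwhisker C kl sikl = cik \<odot> rwhisker C ckl fik \<Longrightarrow>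
         cil \<odot> lwhisker C kl sijl = cij \<odot> rwhisker C cjl fij \<Longrightarrow>
         cik \<odot> lwhisker C kk sijk = cij \<odot> rwhisker C cjk fij"
proof -
  note [simp] = cells[unfolded hom1_def hom2_def mem_Collect_eq]
  let ?x = "rwhisker C ckl (fjk \<cdot> fij)" and ?y = "rwhisker C (lwhisker C kl sjkl) fij"
    and ?z = "lwhisker C (kl \<cdot> fkl) sijk"
  have "rwhisker C (cjl \<odot> lwhisker C kl sjkl) fij = rwhisker C (cjk \<odot> rwhisker C ckl fjk) fij"
    by (simp only: jkl)
  then have "rwhisker C cjl fij \<odot> ?y = rwhisker C cjk fij \<odot> ?x"
    by simp
  then have E1: "(cij \<odot> rwhisker C cjk fij) \<odot> ?x = (cij \<odot> rwhisker C cjl fij) \<odot> ?y"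
    by simp
  have "rwhisker C ckl fik \<odot> ?z = lwhisker C kk sijk \<odot> ?x"
    by (rule whisker_swap) simp_all
  then have E2: "(cik \<odot> lwhisker C kk sijk) \<odot> ?x = (cik \<odot> rwhisker C ckl fik) \<odot> ?z"
    by simp
  have "lwhisker C kl (sikl \<odot> lwhisker C fkl sijk) = lwhisker C kl (sijl \<odot> rwhisker C sjkl fij)"
    by (simp only: s)
  then have "lwhisker C kl sikl \<odot> ?z = lwhisker C kl sijl \<odot> ?y"
    by simp
  then have E3: "(cil \<odot> lwhisker C kl sikl) \<odot> ?z = (cil \<odot> lwhisker C kl sijl) \<odot> ?y"
    by simp
  show "cil \<odot> lwhisker C kl sijl = cij \<odot> rwhisker C cjl fij"
    if "cik \<odot> lwhisker C kk sijk = cij \<odot> rwhisker C cjk fij"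
      "cil \<odot> lwhisker C kl sikl = cik \<odot> rwhisker C ckl fik"
  proof (rule vcomp_cancel_right)
    show "(cil \<odot> lwhisker C kl sijl) \<odot> ?y = (cij \<odot> rwhisker C cjl fij) \<odot> ?y"
      using E1 E2 E3 that by metis
  qed simp_all
  show "cil \<odot> lwhisker C kl sikl = cik \<odot> rwhisker C ckl fik"
    if "cik \<odot> lwhisker C kk sijk = cij \<odot> rwhisker C cjk fij"
      "cil \<odot> lwhisker C kl sijl = cij \<odot> rwhisker C cjl fij"
  proof (rule vcomp_cancel_right)
    show "(cil \<odot> lwhisker C kl sikl) \<odot> ?z = (cik \<odot> rwhisker C ckl fik) \<odot> ?z"
      using E1 E2 E3 that by metis
  qed simp_all
  show "cik \<odot> lwhisker C kk sijk = cij \<odot> rwhisker C cjk fij"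
    if "cil \<odot> lwhisker C kl sikl = cik \<odot> rwhisker C ckl fik"
      "cil \<odot> lwhisker C kl sijl = cij \<odot> rwhisker C cjl fij"
  proof (rule vcomp_cancel_right)
    show "(cik \<odot> lwhisker C kk sijk) \<odot> ?x = (cij \<odot> rwhisker C cjk fij) \<odot> ?x"
      using E1 E2 E3 that by metis
  qed simp_all
qed

definition postcompose :: "'m \<Rightarrow> ('v, 'e, 'o, 'm, 'c) cocone \<Rightarrow> ('v, 'e, 'o, 'm, 'c) cocone" where
  "postcompose u K = \<lparr>apex = Tgt C u, leg = (\<lambda>v. u \<cdot> leg K v), legcell = (\<lambda>e. lwhisker C u (legcell K e))\<rparr>"

lemma is_cocone_postcompose:
  assumes D: "is_diagram C D" and K: "is_cocone C D K" and u: "u \<in> hom1 C (apex K) W"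
  shows "is_cocone C D (postcompose u K)"
proof -
  note [simp] = u[unfolded hom1_def mem_Collect_eq]
  have e: "dar D e \<in> Arr C" "Tgt C (dar D e) = dob D (etgt D e)" "etgt D e \<in> verts D" "esrc D e \<in> verts D"
    if "e \<in> edges D" for e
    using D that by (auto simp: is_diagram_def hom1_def)
  have v: "leg K v \<in> Arr C" "Tgt C (leg K v) = apex K" "Src C (leg K v) = dob D v" if "v \<in> verts D" for v
    using K that by (auto simp: is_cocone_def hom1_def)
  have c: "legcell K e \<in> Cell C" "Dom C (legcell K e) = leg K (etgt D e) \<cdot> dar D e"
    "Cod C (legcell K e) = leg K (esrc D e)" if "e \<in> edges D" for e
    using K that by (auto simp: is_cocone_def hom2_def)
  have "lwhisker C u (legcell K (tri3 D t)) \<odot> lwhisker C (u \<cdot> leg K (etgt D (tri2 D t))) (dcell D t) =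
        lwhisker C u (legcell K (tri1 D t)) \<odot> rwhisker C (lwhisker C u (legcell K (tri2 D t))) (dar D (tri1 D t))"
    if t: "t \<in> tris D" for t
  proof -
    have tt: "tri1 D t \<in> edges D" "tri2 D t \<in> edges D" "tri3 D t \<in> edges D"
        "etgt D (tri1 D t) = esrc D (tri2 D t)" "esrc D (tri3 D t) = esrc D (tri1 D t)"
        "etgt D (tri3 D t) = etgt D (tri2 D t)" "dcell D t \<in> Cell C"
        "Dom C (dcell D t) = dar D (tri2 D t) \<cdot> dar D (tri1 D t)" "Cod C (dcell D t) = dar D (tri3 D t)"
      using D t by (auto simp: is_diagram_def hom2_def)
    have s: "Src C (dar D (tri2 D t)) = dob D (esrc D (tri2 D t))"
      using D tt by (auto simp: is_diagram_def hom1_def)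
    have "lwhisker C u (legcell K (tri3 D t) \<odot> lwhisker C (leg K (etgt D (tri2 D t))) (dcell D t)) =
        lwhisker C u (legcell K (tri1 D t) \<odot> rwhisker C (legcell K (tri2 D t)) (dar D (tri1 D t)))"
      using K t by (simp add: is_cocone_def)
    then show ?thesis
      by (simp add: tt e v c s)
  qed
  moreover have "W \<in> Obj C"
    using arr_obj(2)[of u] by simp
  ultimately show ?thesis
    using e v c D by (auto simp: is_cocone_def postcompose_def hom1_def hom2_def is_diagram_def)
qed

text \<open>For attaching a cell: with \<open>K\<close> the cocone at the current stage and \<open>u\<close> the leg of the pushout, this
extends the comparison of structure maps with the earlier stages to the new stage.\<close>

lemma is_factorization_postcompose:
  assumes D: "is_diagram C D" and K: "is_cocone C D K" and K': "is_cocone C D K'"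
    and F: "is_factorization C D K K' q \<psi>"
    and u: "u \<in> hom1 C (apex K) W" and p: "p \<in> hom1 C W (apex K')" and \<nu>: "\<nu> \<in> hom2 C (p \<cdot> u) q"
  shows "is_factorization C D (postcompose u K) K' p (\<lambda>v. \<psi> v \<odot> rwhisker C \<nu> (leg K v))"
proof -
  note [simp] = u[unfolded hom1_def mem_Collect_eq] p[unfolded hom1_def mem_Collect_eq]
    \<nu>[unfolded hom2_def mem_Collect_eq]
  have q [simp]: "q \<in> Arr C" "Src C q = apex K" "Tgt C q = apex K'"
    using F by (auto simp: is_factorization_def hom1_def)
  have e: "dar D e \<in> Arr C" "Tgt C (dar D e) = dob D (etgt D e)" "etgt D e \<in> verts D" "esrc D e \<in> verts D"
    if "e \<in> edges D" for e
    using D that by (auto simp: is_diagram_def hom1_def)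
  have v: "leg K v \<in> Arr C" "Tgt C (leg K v) = apex K" "Src C (leg K v) = dob D v"
    "leg K' v \<in> Arr C" "Tgt C (leg K' v) = apex K'" "Src C (leg K' v) = dob D v"
    "\<psi> v \<in> Cell C" "Dom C (\<psi> v) = q \<cdot> leg K v" "Cod C (\<psi> v) = leg K' v" if "v \<in> verts D" for v
    using K K' F that by (auto simp: is_cocone_def is_factorization_def hom1_def hom2_def)
  have c: "legcell K e \<in> Cell C" "Dom C (legcell K e) = leg K (etgt D e) \<cdot> dar D e"
    "Cod C (legcell K e) = leg K (esrc D e)"
    "legcell K' e \<in> Cell C" "Dom C (legcell K' e) = leg K' (etgt D e) \<cdot> dar D e"
    "Cod C (legcell K' e) = leg K' (esrc D e)" if "e \<in> edges D" for e
    using K K' that by (auto simp: is_cocone_def hom2_def)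
  have "(\<psi> (esrc D e) \<odot> rwhisker C \<nu> (leg K (esrc D e))) \<odot> lwhisker C p (lwhisker C u (legcell K e)) =
        legcell K' e \<odot> rwhisker C (\<psi> (etgt D e) \<odot> rwhisker C \<nu> (leg K (etgt D e))) (dar D e)"
    if e': "e \<in> edges D" for e
  proof -
    have "(\<psi> (esrc D e) \<odot> rwhisker C \<nu> (leg K (esrc D e))) \<odot> lwhisker C p (lwhisker C u (legcell K e)) =
      \<psi> (esrc D e) \<odot> (rwhisker C \<nu> (leg K (esrc D e)) \<odot> lwhisker C (p \<cdot> u) (legcell K e))"
      using e' by (simp add: e v c)
    also have "rwhisker C \<nu> (leg K (esrc D e)) \<odot> lwhisker C (p \<cdot> u) (legcell K e) =
        lwhisker C q (legcell K e) \<odot> rwhisker C \<nu> (leg K (etgt D e) \<cdot> dar D e)"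
      using e' by (intro whisker_swap) (simp_all add: e v c)
    also have "\<psi> (esrc D e) \<odot> \<dots> = (\<psi> (esrc D e) \<odot> lwhisker C q (legcell K e)) \<odot> rwhisker C \<nu> (leg K (etgt D e) \<cdot> dar D e)"
      using e' by (simp add: e v c)
    also have "\<psi> (esrc D e) \<odot> lwhisker C q (legcell K e) = legcell K' e \<odot> rwhisker C (\<psi> (etgt D e)) (dar D e)"
      using e' F by (simp add: is_factorization_def)
    finally show ?thesis
      using e' by (simp add: e v c)
  qed
  with v p show ?thesis
    by (auto simp: is_factorization_def postcompose_def hom2_def)
qed

end

section \<open>Sequences and their cocones\<close>

lemma strictly_less_Restr [simp]:
  "strictly_less (Restr r A) i j \<longleftrightarrow> i \<in> A \<and> j \<in> A \<and> strictly_less r i j"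
  by (auto simp: strictly_less_def)

lemma seq_diagram_Restr: "B \<subseteq> A \<Longrightarrow> seq_diagram (Restr r A) B S = seq_diagram r B S"
  by (auto simp: seq_diagram_def)

locale well_ordered_index =
  fixes r :: "'w rel"
  assumes wo: "Well_order r"
begin

abbreviation less_index (infix "\<sqsubset>" 50) where "i \<sqsubset> j \<equiv> strictly_less r i j"

lemma less_Field: "i \<sqsubset> j \<Longrightarrow> i \<in> Field r" "i \<sqsubset> j \<Longrightarrow> j \<in> Field r"
  by (auto simp: strictly_less_def Field_def)

lemma less_irrefl [simp]: "\<not> i \<sqsubset> i"
  by (simp add: strictly_less_def)

lemma less_trans: "i \<sqsubset> j \<Longrightarrow> j \<sqsubset> k \<Longrightarrow> i \<sqsubset> k"
  using wo unfolding well_order_on_def linear_order_on_def partial_order_on_def preorder_on_def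
    strictly_less_def by (metis antisymD transD)

lemma less_asym: "i \<sqsubset> j \<Longrightarrow> \<not> j \<sqsubset> i"
  using less_trans less_irrefl by blast

lemma less_linear: "i \<in> Field r \<Longrightarrow> j \<in> Field r \<Longrightarrow> i = j \<or> i \<sqsubset> j \<or> j \<sqsubset> i"
  using wo unfolding well_order_on_def linear_order_on_def total_on_def strictly_less_def by blast

lemma rel_iff: "i \<in> Field r \<Longrightarrow> (i, j) \<in> r \<longleftrightarrow> i = j \<or> i \<sqsubset> j"
  using wo unfolding well_order_on_def linear_order_on_def partial_order_on_def preorder_on_def
    refl_on_def strictly_less_def by blast

lemma wf_less: "wf {(i, j). i \<sqsubset> j}"
proof -
  have "{(i, j). i \<sqsubset> j} = r - Id"
    by (auto simp: strictly_less_def)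
  then show ?thesis
    using wo by (simp add: well_order_on_def)
qed

end

locale indexed_21_category = strict_21_category C + well_ordered_index r
  for C :: "('o, 'm, 'c) two_cat" (structure) and r :: "'w rel"
begin

text \<open>The order stays fixed and only the set \<open>A\<close> of indices varies, so that pieces of a sequence can be
compared without passing to restricted orders.\<close>

definition pseudofunctor_on :: "'w set \<Rightarrow> ('w, 'o, 'm, 'c) sequence \<Rightarrow> bool" where
  "pseudofunctor_on A S \<longleftrightarrow>
     (\<forall>i \<in> A. sob S i \<in> Obj C) \<and>
     (\<forall>i \<in> A. \<forall>j \<in> A. i \<sqsubset> j \<longrightarrow> sar S i j \<in> hom1 C (sob S i) (sob S j)) \<and>
     (\<forall>i \<in> A. \<forall>j \<in> A. \<forall>k \<in> A. i \<sqsubset> j \<and> j \<sqsubset> k \<longrightarrow>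
        scell S i j k \<in> hom2 C (sar S j k \<cdot> sar S i j) (sar S i k)) \<and>
     (\<forall>i \<in> A. \<forall>j \<in> A. \<forall>k \<in> A. \<forall>l \<in> A. i \<sqsubset> j \<and> j \<sqsubset> k \<and> k \<sqsubset> l \<longrightarrow>
        scell S i k l \<odot> lwhisker C (sar S k l) (scell S i j k) =
        scell S i j l \<odot> rwhisker C (scell S j k l) (sar S i j))"

lemma pseudofunctor_onD:
  assumes "pseudofunctor_on A S"
  shows "i \<in> A \<Longrightarrow> sob S i \<in> Obj C"
    "i \<in> A \<Longrightarrow> j \<in> A \<Longrightarrow> i \<sqsubset> j \<Longrightarrow> sar S i j \<in> hom1 C (sob S i) (sob S j)"
    "i \<in> A \<Longrightarrow> j \<in> A \<Longrightarrow> k \<in> A \<Longrightarrow> i \<sqsubset> j \<Longrightarrow> j \<sqsubset> k \<Longrightarrow>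
       scell S i j k \<in> hom2 C (sar S j k \<cdot> sar S i j) (sar S i k)"
    "i \<in> A \<Longrightarrow> j \<in> A \<Longrightarrow> k \<in> A \<Longrightarrow> l \<in> A \<Longrightarrow> i \<sqsubset> j \<Longrightarrow> j \<sqsubset> k \<Longrightarrow> k \<sqsubset> l \<Longrightarrow>
       scell S i k l \<odot> lwhisker C (sar S k l) (scell S i j k) =
       scell S i j l \<odot> rwhisker C (scell S j k l) (sar S i j)"
  using assms unfolding pseudofunctor_on_def by blast+

lemma pseudofunctor_on_subset: "pseudofunctor_on A S \<Longrightarrow> B \<subseteq> A \<Longrightarrow> pseudofunctor_on B S"
  unfolding pseudofunctor_on_def by (meson subsetD)

lemma is_pseudofunctor_Restr:
  assumes "A \<subseteq> Field r"
  shows "is_pseudofunctor C (Restr r A) S \<longleftrightarrow> pseudofunctor_on A S"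
proof -
  have "Field (Restr r A) = A"
    using assms wo by (simp add: Refl_Field_Restr2 well_order_on_def linear_order_on_def
        partial_order_on_def preorder_on_def)
  then show ?thesis
    by (simp add: is_pseudofunctor_def pseudofunctor_on_def) blast
qed

lemma is_diagram_seq:
  assumes "pseudofunctor_on A S"
  shows "is_diagram C (seq_diagram r A S)"
  using pseudofunctor_onD[OF assms] less_trans by (auto simp: is_diagram_def seq_diagram_def)

lemma is_cocone_seq_iff:
  "is_cocone C (seq_diagram r A S) K \<longleftrightarrow>
     apex K \<in> Obj C \<and> (\<forall>i \<in> A. leg K i \<in> hom1 C (sob S i) (apex K)) \<and>
     (\<forall>i \<in> A. \<forall>j \<in> A. i \<sqsubset> j \<longrightarrow> legcell K (i, j) \<in> hom2 C (leg K j \<cdot> sar S i j) (leg K i)) \<and>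
     (\<forall>i \<in> A. \<forall>j \<in> A. \<forall>k \<in> A. i \<sqsubset> j \<and> j \<sqsubset> k \<longrightarrow>
        legcell K (i, k) \<odot> lwhisker C (leg K k) (scell S i j k) =
        legcell K (i, j) \<odot> rwhisker C (legcell K (j, k)) (sar S i j))"
  by (auto simp: is_cocone_def seq_diagram_def)

lemma is_cocone_seqD:
  assumes "is_cocone C (seq_diagram r A S) K"
  shows "apex K \<in> Obj C" "i \<in> A \<Longrightarrow> leg K i \<in> hom1 C (sob S i) (apex K)"
    "i \<in> A \<Longrightarrow> j \<in> A \<Longrightarrow> i \<sqsubset> j \<Longrightarrow> legcell K (i, j) \<in> hom2 C (leg K j \<cdot> sar S i j) (leg K i)"
    "i \<in> A \<Longrightarrow> j \<in> A \<Longrightarrow> k \<in> A \<Longrightarrow> i \<sqsubset> j \<Longrightarrow> j \<sqsubset> k \<Longrightarrow>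
        legcell K (i, k) \<odot> lwhisker C (leg K k) (scell S i j k) =
        legcell K (i, j) \<odot> rwhisker C (legcell K (j, k)) (sar S i j)"
  using assms unfolding is_cocone_seq_iff by blast+

lemma is_factorization_seq_iff:
  "is_factorization C (seq_diagram r A S) K K' u \<psi> \<longleftrightarrow>
     u \<in> hom1 C (apex K) (apex K') \<and>
     (\<forall>i \<in> A. \<psi> i \<in> hom2 C (u \<cdot> leg K i) (leg K' i)) \<and>
     (\<forall>i \<in> A. \<forall>j \<in> A. i \<sqsubset> j \<longrightarrow> \<psi> i \<odot> lwhisker C u (legcell K (i, j)) =
        legcell K' (i, j) \<odot> rwhisker C (\<psi> j) (sar S i j))"
  by (auto simp: is_factorization_def seq_diagram_def)

lemma is_factorization_seqD:
  assumes "is_factorization C (seq_diagram r A S) K K' u \<psi>"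
  shows "u \<in> hom1 C (apex K) (apex K')"
    "i \<in> A \<Longrightarrow> \<psi> i \<in> hom2 C (u \<cdot> leg K i) (leg K' i)"
    "i \<in> A \<Longrightarrow> j \<in> A \<Longrightarrow> i \<sqsubset> j \<Longrightarrow> \<psi> i \<odot> lwhisker C u (legcell K (i, j)) =
        legcell K' (i, j) \<odot> rwhisker C (\<psi> j) (sar S i j)"
  using assms unfolding is_factorization_seq_iff by blast+

lemma verts_seq [simp]: "verts (seq_diagram r A S) = A"
  by (simp add: seq_diagram_def)

text \<open>This is how sequences are built: since every condition on a pseudofunctor has a largest index \<open>k\<close>,
the data at \<open>k\<close> form nothing but a cocone under the part of the sequence below \<open>k\<close>.\<close>

lemma pseudofunctor_on_cocones:
  assumes "\<And>k. k \<in> A \<Longrightarrow> is_cocone C (seq_diagram r {i \<in> A. i \<sqsubset> k} S) (seq_cocone S k)"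
  shows "pseudofunctor_on A S"
  unfolding pseudofunctor_on_def
proof (intro conjI ballI impI)
  note K = is_cocone_seqD[OF assms]
  fix i assume i: "i \<in> A"
  show "sob S i \<in> Obj C"
    using K(1)[OF i] by (simp add: seq_cocone_def)
  fix j assume j: "j \<in> A"
  show "sar S i j \<in> hom1 C (sob S i) (sob S j)" if "i \<sqsubset> j"
    using K(2)[OF j, of i] i that by (simp add: seq_cocone_def)
  fix k assume k: "k \<in> A"
  show "scell S i j k \<in> hom2 C (sar S j k \<cdot> sar S i j) (sar S i k)" if "i \<sqsubset> j \<and> j \<sqsubset> k"
    using K(3)[OF k, of i j] i j that less_trans[of i j k] by (simp add: seq_cocone_def)
  fix l assume l: "l \<in> A"
  show "scell S i k l \<odot> lwhisker C (sar S k l) (scell S i j k) =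
      scell S i j l \<odot> rwhisker C (scell S j k l) (sar S i j)" if "i \<sqsubset> j \<and> j \<sqsubset> k \<and> k \<sqsubset> l"
    using K(4)[OF l, of i j k] i j k that less_trans[of j k l] less_trans[of i j l]
    by (simp add: seq_cocone_def)
qed

section \<open>The colimit of a sequence with a last index\<close>

definition top_cocone :: "('w, 'o, 'm, 'c) sequence \<Rightarrow> 'w \<Rightarrow> ('w, 'w \<times> 'w, 'o, 'm, 'c) cocone" where
  "top_cocone S t = \<lparr>apex = sob S t, leg = (\<lambda>i. if i = t then Id1 C (sob S t) else sar S i t),
     legcell = (\<lambda>(i, j). if j = t then Id2 C (sar S i t) else scell S i j t)\<rparr>"

lemma is_cocone_top:
  assumes S: "pseudofunctor_on A S" and t: "t \<in> A" "\<And>i. i \<in> A \<Longrightarrow> i \<noteq> t \<Longrightarrow> i \<sqsubset> t"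
  shows "is_cocone C (seq_diagram r A S) (top_cocone S t)"
  unfolding is_cocone_seq_iff
proof (intro conjI ballI impI)
  note S' = pseudofunctor_onD[OF S, unfolded hom1_def hom2_def mem_Collect_eq]
  have nt: "i \<noteq> t" if "i \<sqsubset> j" "j \<in> A" for i j
    using t that less_asym less_irrefl by blast
  show "apex (top_cocone S t) \<in> Obj C"
    using S'(1) t by (simp add: top_cocone_def)
  fix i assume i: "i \<in> A"
  show "leg (top_cocone S t) i \<in> hom1 C (sob S i) (apex (top_cocone S t))"
    using S'(1)[of t] S'(2)[of i t] t i by (cases "i = t") (auto simp: top_cocone_def hom1_def)
  fix j assume j: "j \<in> A"
  { assume ij: "i \<sqsubset> j"
    show "legcell (top_cocone S t) (i, j) \<in>
        hom2 C (leg (top_cocone S t) j \<cdot> sar S i j) (leg (top_cocone S t) i)"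
      using S'(1)[of t] S'(2)[of i t] S'(3)[of i j t] t i j ij nt[OF ij j]
      by (cases "j = t") (simp_all add: top_cocone_def hom2_def) }
  fix k assume k: "k \<in> A" and ijk: "i \<sqsubset> j \<and> j \<sqsubset> k"
  have o: "i \<sqsubset> k" "i \<noteq> t" "j \<noteq> t"
    using ijk less_trans nt j k by blast+
  show "legcell (top_cocone S t) (i, k) \<odot> lwhisker C (leg (top_cocone S t) k) (scell S i j k) =
      legcell (top_cocone S t) (i, j) \<odot> rwhisker C (legcell (top_cocone S t) (j, k)) (sar S i j)"
  proof (cases "k = t")
    case True
    then show ?thesis
      using S'(1)[of t] S'(2)[of i t] S'(2)[of i j] S'(2)[of j t] S'(3)[of i j t] t i j ijk o
      by (simp add: top_cocone_def)
  next
    case False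
    then show ?thesis
      using pseudofunctor_onD(4)[OF S i j k t(1)] t k ijk o by (simp add: top_cocone_def)
  qed
qed

definition top_factorization :: "'w \<Rightarrow> ('w, 'w \<times> 'w, 'o, 'm, 'c) cocone \<Rightarrow> 'w \<Rightarrow> 'c" where
  "top_factorization t K = (\<lambda>i. if i = t then Id2 C (leg K t) else legcell K (i, t))"

lemma is_factorization_top:
  assumes S: "pseudofunctor_on A S" and t: "t \<in> A" "\<And>i. i \<in> A \<Longrightarrow> i \<noteq> t \<Longrightarrow> i \<sqsubset> t"
    and K: "is_cocone C (seq_diagram r A S) K"
  shows "is_factorization C (seq_diagram r A S) (top_cocone S t) K (leg K t) (top_factorization t K)"
  unfolding is_factorization_seq_iff
proof (intro conjI ballI impI)
  note S' = pseudofunctor_onD[OF S, unfolded hom1_def hom2_def mem_Collect_eq]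
  note K' = is_cocone_seqD[OF K, unfolded hom1_def hom2_def mem_Collect_eq]
  show "leg K t \<in> hom1 C (apex (top_cocone S t)) (apex K)"
    using K'(2) t by (simp add: top_cocone_def hom1_def)
  fix i assume i: "i \<in> A"
  show "top_factorization t K i \<in> hom2 C (leg K t \<cdot> leg (top_cocone S t) i) (leg K i)"
    using K'(2)[of t] K'(3)[of i t] t i
    by (cases "i = t") (simp_all add: top_cocone_def top_factorization_def hom2_def)
  fix j assume j: "j \<in> A" and ij: "i \<sqsubset> j"
  have nt: "i \<noteq> t"
    using t ij j less_asym less_irrefl by blast
  show "top_factorization t K i \<odot> lwhisker C (leg K t) (legcell (top_cocone S t) (i, j)) =
      legcell K (i, j) \<odot> rwhisker C (top_factorization t K j) (sar S i j)"
  proof (cases "j = t")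
    case True
    then show ?thesis
      using K'(2)[of t] K'(3)[of i t] S'(2)[of i t] t i ij nt
      by (simp add: top_cocone_def top_factorization_def)
  next
    case False
    then show ?thesis
      using is_cocone_seqD(4)[OF K i j t(1) ij] t j nt
      by (simp add: top_cocone_def top_factorization_def)
  qed
qed

text \<open>A last index is terminal, so a cocone is determined by its leg there: that leg is the factorization,
and a 2-cell between two factorizations is determined by its component at the last index.\<close>

lemma is_hocolim_top:
  assumes S: "pseudofunctor_on A S" and t: "t \<in> A" "\<And>i. i \<in> A \<Longrightarrow> i \<noteq> t \<Longrightarrow> i \<sqsubset> t"
  shows "is_hocolim C (seq_diagram r A S) (top_cocone S t)"
  unfolding is_hocolim_def
proof (intro conjI allI impI)
  show "is_diagram C (seq_diagram r A S)"
    by (rule is_diagram_seq) fact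
  show "is_cocone C (seq_diagram r A S) (top_cocone S t)"
    by (rule is_cocone_top) fact+
next
  fix K assume "is_cocone C (seq_diagram r A S) K"
  then show "\<exists>u \<psi>. is_factorization C (seq_diagram r A S) (top_cocone S t) K u \<psi>"
    using is_factorization_top[OF assms] by blast
next
  fix K u \<psi> u' \<psi>'
  assume K: "is_cocone C (seq_diagram r A S) K"
    and F: "is_factorization C (seq_diagram r A S) (top_cocone S t) K u \<psi> \<and>
            is_factorization C (seq_diagram r A S) (top_cocone S t) K u' \<psi>'"
  note S' = pseudofunctor_onD[OF S, unfolded hom1_def hom2_def mem_Collect_eq]
  note K' = is_cocone_seqD[OF K, unfolded hom1_def hom2_def mem_Collect_eq]
  note F1 = is_factorization_seqD[OF F[THEN conjunct1]]
  note F2 = is_factorization_seqD[OF F[THEN conjunct2]]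
  have u: "u \<in> Arr C" "Src C u = sob S t" "Tgt C u = apex K"
      "u' \<in> Arr C" "Src C u' = sob S t" "Tgt C u' = apex K"
    using F1(1) F2(1) by (auto simp: hom1_def top_cocone_def)
  have \<psi>t: "\<psi> t \<in> Cell C" "Dom C (\<psi> t) = u" "Cod C (\<psi> t) = leg K t"
      "\<psi>' t \<in> Cell C" "Dom C (\<psi>' t) = u'" "Cod C (\<psi>' t) = leg K t"
    using F1(2)[of t] F2(2)[of t] t u by (auto simp: hom2_def top_cocone_def)
  have \<psi>i: "\<psi> i = legcell K (i, t) \<odot> rwhisker C (\<psi> t) (sar S i t)"
    "\<psi>' i = legcell K (i, t) \<odot> rwhisker C (\<psi>' t) (sar S i t)" if i: "i \<in> A" "i \<noteq> t" for i
  proof -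
    have it: "i \<sqsubset> t"
      using i t by blast
    have "\<psi> i \<in> Cell C" "Dom C (\<psi> i) = u \<cdot> sar S i t" "\<psi>' i \<in> Cell C" "Dom C (\<psi>' i) = u' \<cdot> sar S i t"
      using F1(2)[of i] F2(2)[of i] i by (auto simp: hom2_def top_cocone_def)
    then show "\<psi> i = legcell K (i, t) \<odot> rwhisker C (\<psi> t) (sar S i t)"
      "\<psi>' i = legcell K (i, t) \<odot> rwhisker C (\<psi>' t) (sar S i t)"
      using F1(3)[of i t] F2(3)[of i t] it i t u S'(2)[of i t] by (auto simp: top_cocone_def)
  qed
  show "\<exists>!\<theta>. \<theta> \<in> hom2 C u u' \<and>
      (\<forall>v \<in> verts (seq_diagram r A S). \<psi>' v \<odot> rwhisker C \<theta> (leg (top_cocone S t) v) = \<psi> v)"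
  proof (rule ex1I)
    let ?\<theta> = "inv2 (\<psi>' t) \<odot> \<psi> t"
    have "\<psi>' v \<odot> rwhisker C ?\<theta> (leg (top_cocone S t) v) = \<psi> v" if v: "v \<in> A" for v
    proof (cases "v = t")
      case True
      then show ?thesis
        using u \<psi>t by (simp add: top_cocone_def)
    next
      case False
      then have vt: "v \<sqsubset> t"
        using v t by blast
      have s: "sar S v t \<in> Arr C" "Src C (sar S v t) = sob S v" "Tgt C (sar S v t) = sob S t"
        using S'(2)[of v t] v t vt by auto
      have k: "legcell K (v, t) \<in> Cell C" "Dom C (legcell K (v, t)) = leg K t \<cdot> sar S v t"
        "Cod C (legcell K (v, t)) = leg K v" "leg K t \<in> Arr C" "Src C (leg K t) = sob S t"
        using K'(3)[of v t] K'(2)[of t] v t vt by auto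
      have "\<psi>' v \<odot> rwhisker C ?\<theta> (sar S v t) =
          legcell K (v, t) \<odot> rwhisker C (\<psi> t) (sar S v t)"
        unfolding \<psi>i(2)[OF v False] using u \<psi>t s k by simp
      then show ?thesis
        using False by (simp add: \<psi>i[OF v False] top_cocone_def)
    qed
    then show "?\<theta> \<in> hom2 C u u' \<and>
        (\<forall>v \<in> verts (seq_diagram r A S). \<psi>' v \<odot> rwhisker C ?\<theta> (leg (top_cocone S t) v) = \<psi> v)"
      using u \<psi>t by (simp add: hom2_def)
  next
    fix \<theta>
    assume \<theta>: "\<theta> \<in> hom2 C u u' \<and>
        (\<forall>v \<in> verts (seq_diagram r A S). \<psi>' v \<odot> rwhisker C \<theta> (leg (top_cocone S t) v) = \<psi> v)"
    then have c: "\<theta> \<in> Cell C" "Dom C \<theta> = u" "Cod C \<theta> = u'"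
      by (auto simp: hom2_def)
    have "\<psi>' t \<odot> rwhisker C \<theta> (Id1 C (sob S t)) = \<psi> t"
      using \<theta> t by (auto simp: top_cocone_def)
    then have "\<psi> t = \<psi>' t \<odot> \<theta>"
      using c u by simp
    then show "\<theta> = inv2 (\<psi>' t) \<odot> \<psi> t"
      using c \<psi>t by simp
  qed
qed

end

context indexed_21_category
begin

section \<open>Final segments are cofinal\<close>

lemma is_cocone_seq_subset:
  "is_cocone C (seq_diagram r A S) K \<Longrightarrow> B \<subseteq> A \<Longrightarrow> is_cocone C (seq_diagram r B S) K"
  unfolding is_cocone_seq_iff by (meson subsetD)

lemma is_factorization_seq_subset:
  "is_factorization C (seq_diagram r A S) K K' u \<psi> \<Longrightarrow> B \<subseteq> A \<Longrightarrow>
   is_factorization C (seq_diagram r B S) K K' u \<psi>"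
  unfolding is_factorization_seq_iff by (meson subsetD)

definition cocone_triangle ::
  "('w, 'o, 'm, 'c) sequence \<Rightarrow> ('w, 'w \<times> 'w, 'o, 'm, 'c) cocone \<Rightarrow> 'w \<Rightarrow> 'w \<Rightarrow> 'w \<Rightarrow> bool" where
  "cocone_triangle S K i j k \<longleftrightarrow>
     legcell K (i, k) \<odot> lwhisker C (leg K k) (scell S i j k) =
     legcell K (i, j) \<odot> rwhisker C (legcell K (j, k)) (sar S i j)"

text \<open>The legs and 2-cells need not form a cocone yet: this serves to derive the triangle identities of a
candidate cocone from one another.\<close>

lemma cocone_triangles:
  assumes S: "pseudofunctor_on A S"
    and legs: "\<And>i. i \<in> A \<Longrightarrow> leg K i \<in> hom1 C (sob S i) (apex K)"
    and cells: "\<And>i j. i \<in> A \<Longrightarrow> j \<in> A \<Longrightarrow> i \<sqsubset> j \<Longrightarrow>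
      legcell K (i, j) \<in> hom2 C (leg K j \<cdot> sar S i j) (leg K i)"
    and ijkl: "i \<in> A" "j \<in> A" "k \<in> A" "l \<in> A" "i \<sqsubset> j" "j \<sqsubset> k" "k \<sqsubset> l"
    and jkl: "cocone_triangle S K j k l"
  shows "cocone_triangle S K i j k \<Longrightarrow> cocone_triangle S K i k l \<Longrightarrow> cocone_triangle S K i j l"
    and "cocone_triangle S K i j k \<Longrightarrow> cocone_triangle S K i j l \<Longrightarrow> cocone_triangle S K i k l"
    and "cocone_triangle S K i k l \<Longrightarrow> cocone_triangle S K i j l \<Longrightarrow> cocone_triangle S K i j k"
proof -
  have o: "i \<sqsubset> k" "i \<sqsubset> l" "j \<sqsubset> l"
    using ijkl less_trans by blast+
  note S' = pseudofunctor_onD[OF S]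
  note T = cocone_tetrahedron[OF S'(2)[OF ijkl(1,2,5)] S'(2)[OF ijkl(1,3) o(1)]
      S'(2)[OF ijkl(1,4) o(2)] S'(2)[OF ijkl(2,3,6)] S'(2)[OF ijkl(2,4) o(3)] S'(2)[OF ijkl(3,4,7)]
      legs[OF ijkl(1)] legs[OF ijkl(2)] legs[OF ijkl(3)] legs[OF ijkl(4)]
      S'(3)[OF ijkl(1,2,3,5,6)] S'(3)[OF ijkl(1,2,4,5) o(3)]
      S'(3)[OF ijkl(1,3,4) o(1) ijkl(7)] S'(3)[OF ijkl(2,3,4,6,7)]
      cells[OF ijkl(1,2,5)] cells[OF ijkl(1,3) o(1)] cells[OF ijkl(1,4) o(2)]
      cells[OF ijkl(2,3,6)] cells[OF ijkl(2,4) o(3)] cells[OF ijkl(3,4,7)]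
      S'(4)[OF ijkl] jkl[unfolded cocone_triangle_def]]
  show "cocone_triangle S K i j k \<Longrightarrow> cocone_triangle S K i k l \<Longrightarrow> cocone_triangle S K i j l"
    and "cocone_triangle S K i j k \<Longrightarrow> cocone_triangle S K i j l \<Longrightarrow> cocone_triangle S K i k l"
    and "cocone_triangle S K i k l \<Longrightarrow> cocone_triangle S K i j l \<Longrightarrow> cocone_triangle S K i j k"
    unfolding cocone_triangle_def using T by blast+
qed

text \<open>A cocone on the indices from \<open>i0\<close> on is extended downwards by composing with the 1-cells to \<open>i0\<close>.
The 2-cells at the edges \<open>(i, i0)\<close> are then identities, and the triangle identities for
\<open>i < j < i0\<close> and for \<open>i < i0 < j\<close> leave no choice for the others.\<close>

definition extend_cocone ::
  "('w, 'o, 'm, 'c) sequence \<Rightarrow> 'w \<Rightarrow> ('w, 'w \<times> 'w, 'o, 'm, 'c) cocone \<Rightarrow>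
   ('w, 'w \<times> 'w, 'o, 'm, 'c) cocone" where
  "extend_cocone S i0 K =
     \<lparr>apex = apex K,
      leg = (\<lambda>i. if i \<sqsubset> i0 then leg K i0 \<cdot> sar S i i0 else leg K i),
      legcell = (\<lambda>(i, j).
        if \<not> i \<sqsubset> i0 then legcell K (i, j)
        else if j \<sqsubset> i0 then lwhisker C (leg K i0) (scell S i j i0)
        else if j = i0 then Id2 C (leg K i0 \<cdot> sar S i i0)
        else rwhisker C (legcell K (i0, j)) (sar S i i0) \<odot>
             inv2 (lwhisker C (leg K j) (scell S i i0 j)))\<rparr>"

context
  fixes A B :: "'w set" and S :: "('w, 'o, 'm, 'c) sequence" and i0 :: 'w
  assumes S: "pseudofunctor_on A S" and A: "A \<subseteq> Field r" and i0: "i0 \<in> A"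
    and B: "B = {i \<in> A. i = i0 \<or> i0 \<sqsubset> i}"
begin

lemma final_segment_cases: "i \<in> A \<Longrightarrow> i \<sqsubset> i0 \<or> i \<in> B"
  using less_linear[of i i0] A i0 B by auto

lemma final_segmentD: "i \<in> B \<Longrightarrow> i \<in> A" "i \<in> B \<Longrightarrow> \<not> i \<sqsubset> i0" "i \<in> B \<Longrightarrow> i \<noteq> i0 \<Longrightarrow> i0 \<sqsubset> i"
    "i0 \<in> B" "i \<in> B \<Longrightarrow> i \<sqsubset> j \<Longrightarrow> j \<in> A \<Longrightarrow> j \<in> B"
  unfolding B using i0 less_asym less_trans less_irrefl by blast+

text \<open>The triangle identities that involve \<open>i0\<close> hold by construction. Every other one is a face of a
tetrahedron with the additional vertex \<open>i0\<close>, whose position relative to \<open>i < j < k\<close> decides which of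
the three cases of \<open>cocone_triangles\<close> applies.\<close>

lemma is_cocone_extend:
  assumes K: "is_cocone C (seq_diagram r B S) K"
  shows "is_cocone C (seq_diagram r A S) (extend_cocone S i0 K)"
proof -
  let ?E = "extend_cocone S i0 K"
  note S' = pseudofunctor_onD[OF S, unfolded hom1_def hom2_def mem_Collect_eq]
  note K' = is_cocone_seqD[OF K, unfolded hom1_def hom2_def mem_Collect_eq]
  have legs: "leg ?E i \<in> hom1 C (sob S i) (apex ?E)" if "i \<in> A" for i
    using final_segment_cases[OF that] that S'(2)[of i i0] K'(2)[of i] K'(2)[of i0] i0
      final_segmentD(4)
    by (cases "i \<sqsubset> i0") (simp_all add: extend_cocone_def hom1_def)
  have cells: "legcell ?E (i, j) \<in> hom2 C (leg ?E j \<cdot> sar S i j) (leg ?E i)"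
    if ij: "i \<in> A" "j \<in> A" "i \<sqsubset> j" for i j
  proof (cases "i \<sqsubset> i0")
    case False
    then have "i \<in> B" "j \<in> B" "\<not> j \<sqsubset> i0"
      using that final_segment_cases final_segmentD by blast+
    then show ?thesis
      using K'(3)[of i j] that False by (simp add: extend_cocone_def hom2_def)
  next
    case i: True
    note k = K'(2)[OF final_segmentD(4)] S'(2)[of i i0] S'(2)[of i j] S'(2)[of j i0]
      S'(3)[of i j i0] S'(3)[of i i0 j] S'(2)[of i0 j]
    consider "j \<sqsubset> i0" | "j = i0" | "j \<in> B" "\<not> j \<sqsubset> i0" "j \<noteq> i0" "i0 \<sqsubset> j"
      using final_segment_cases[OF ij(2)] final_segmentD(2,3)[of j] by blast
    then show ?thesis
    proof cases
      case 1
      then show ?thesis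
        using k i0 that i by (simp add: extend_cocone_def hom2_def)
    next
      case 2
      then show ?thesis
        using k i0 that i by (simp add: extend_cocone_def hom2_def)
    next
      case 3
      then show ?thesis
        using k i0 that i K'(2)[of j] K'(3)[of i0 j] final_segmentD(4)
        by (simp add: extend_cocone_def hom2_def)
    qed
  qed
  have T1: "cocone_triangle S ?E i j i0" if "i \<in> A" "j \<in> A" "i \<sqsubset> j" "j \<sqsubset> i0" for i j
  proof -
    have "i \<sqsubset> i0"
      using that less_trans by blast
    then show ?thesis
      using that K'(2)[OF final_segmentD(4)] S'(2)[of i j] S'(2)[of j i0] S'(2)[of i i0]
        S'(3)[of i j i0] i0
      by (simp add: extend_cocone_def cocone_triangle_def)
  qed
  have T2: "cocone_triangle S ?E i i0 k" if "i \<in> A" "k \<in> A" "i \<sqsubset> i0" "i0 \<sqsubset> k" for i k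
  proof -
    have ik: "i \<sqsubset> k" "\<not> k \<sqsubset> i0" "k \<noteq> i0" "k \<in> B"
      using that less_trans less_asym less_irrefl B by blast+
    then show ?thesis
      using that K'(2)[OF final_segmentD(4)] S'(2)[of i k] S'(2)[of i0 k] S'(2)[of i i0]
        S'(3)[of i i0 k] i0 K'(2)[of k] K'(3)[of i0 k] final_segmentD(4)
      by (simp add: extend_cocone_def cocone_triangle_def)
  qed
  have T3: "cocone_triangle S ?E i j k" if "i \<in> B" "j \<in> B" "k \<in> B" "i \<sqsubset> j" "j \<sqsubset> k" for i j k
    using K'(4)[OF that] that final_segmentD(2) by (simp add: extend_cocone_def cocone_triangle_def)
  note T = cocone_triangles[where K = "?E", OF S]
  have "cocone_triangle S ?E i j k" if ijk: "i \<in> A" "j \<in> A" "k \<in> A" "i \<sqsubset> j" "j \<sqsubset> k" for i j k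
  proof (cases "i \<sqsubset> i0")
    case False
    then have "i \<in> B"
      using that final_segment_cases by blast
    then have "j \<in> B" "k \<in> B"
      using that final_segmentD(5) by blast+
    then show ?thesis
      using T3 that \<open>i \<in> B\<close> by blast
  next
    case i: True
    consider "k \<sqsubset> i0" | "k = i0" | "i0 \<sqsubset> k" "j \<sqsubset> i0" | "j = i0" | "i0 \<sqsubset> j"
      using less_linear[of k i0] less_linear[of j i0] A i0 ijk by blast
    then show ?thesis
    proof cases
      case 1
      have "j \<sqsubset> i0"
        using 1 ijk less_trans by blast
      then show ?thesis
        using ijk i i0 1 legs cells less_trans[of i j k]
        by (intro T(3)[of i j k i0] T1) simp_all
    next
      case 2
      then show ?thesis
        using T1 ijk by blast
    next
      case 3
      then show ?thesis
        using ijk i i0 3 legs cells less_trans[of i j k]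
        by (intro T(1)[of i j i0 k] T1 T2) simp_all
    next
      case 4
      then show ?thesis
        using T2 ijk i by blast
    next
      case 5
      then have "j \<in> B" "k \<in> B"
        using ijk B less_trans by blast+
      moreover have "i0 \<sqsubset> k"
        using ijk 5 less_trans by blast
      ultimately show ?thesis
        using ijk i i0 5 legs cells less_trans[of i j k] final_segmentD(4)
        by (intro T(2)[of i i0 j k] T2 T3) simp_all
    qed
  qed
  then show ?thesis
    using K'(1) legs cells by (simp add: is_cocone_seq_iff cocone_triangle_def[symmetric])
      (simp add: extend_cocone_def)
qed

text \<open>Below \<open>i0\<close> the 2-cells are chosen to be compatible with the edge to \<open>i0\<close>; all other edges follow from
\<open>modification_third_edge\<close>, applied to triangles with vertex \<open>i0\<close>.\<close>

lemma is_factorization_extend: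
  assumes K: "is_cocone C (seq_diagram r A S) K" and K': "is_cocone C (seq_diagram r B S) K'"
    and F: "is_factorization C (seq_diagram r B S) K K' u \<psi>"
  shows "is_factorization C (seq_diagram r A S) K (extend_cocone S i0 K') u
    (\<lambda>i. if i \<sqsubset> i0 then rwhisker C (\<psi> i0) (sar S i i0) \<odot> inv2 (lwhisker C u (legcell K (i, i0)))
         else \<psi> i)"
    (is "is_factorization C _ K ?E u ?\<psi>")
proof -
  have E: "is_cocone C (seq_diagram r A S) ?E"
    by (rule is_cocone_extend) fact
  note Sh = pseudofunctor_onD[OF S]
  note Kh = is_cocone_seqD[OF K]
  note Eh = is_cocone_seqD[OF E]
  note Kh' = is_cocone_seqD[OF K']
  note Fh = is_factorization_seqD[OF F]
  note S' = Sh[unfolded hom1_def hom2_def mem_Collect_eq]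
  note K1 = Kh[unfolded hom1_def hom2_def mem_Collect_eq]
  note K2 = Kh'[unfolded hom1_def hom2_def mem_Collect_eq]
  note F' = Fh[unfolded hom1_def hom2_def mem_Collect_eq]
  have a: "apex ?E = apex K'"
    by (simp add: extend_cocone_def)
  have cells: "?\<psi> i \<in> hom2 C (u \<cdot> leg K i) (leg ?E i)" if i: "i \<in> A" for i
  proof (cases "i \<sqsubset> i0")
    case True
    then show ?thesis
      using F'(1) F'(2)[OF final_segmentD(4)] S'(2)[of i i0] K1(2)[of i] K1(2)[of i0]
        K1(3)[of i i0] i i0 K2(2)[OF final_segmentD(4)]
      by (simp add: hom2_def extend_cocone_def)
  next
    case False
    then have "i \<in> B"
      using final_segment_cases i by blast
    then show ?thesis
      using F'(2)[of i] False by (simp add: hom2_def extend_cocone_def)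
  qed
  define edge where "edge i j \<longleftrightarrow> ?\<psi> i \<odot> lwhisker C u (legcell K (i, j)) =
      legcell ?E (i, j) \<odot> rwhisker C (?\<psi> j) (sar S i j)" for i j
  have E1: "edge i i0" if "i \<in> A" "i \<sqsubset> i0" for i
    using that F'(1) F'(2)[OF final_segmentD(4)] S'(2)[of i i0] K1(2)[of i] K1(2)[of i0]
        K1(3)[of i i0] i0 K2(2)[OF final_segmentD(4)]
    by (simp add: edge_def extend_cocone_def)
  have E2: "edge i j" if "i \<in> B" "j \<in> B" "i \<sqsubset> j" for i j
    using Fh(3)[OF that] that final_segmentD(2) by (simp add: edge_def extend_cocone_def)
  have third: "edge i k \<longleftrightarrow> edge i j" if ijk: "i \<in> A" "j \<in> A" "k \<in> A" "i \<sqsubset> j" "j \<sqsubset> k" "edge j k" for i j k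
  proof -
    have ik: "i \<sqsubset> k"
      using ijk less_trans by blast
    show ?thesis
      unfolding edge_def
      by (rule modification_third_edge[OF Sh(2)[OF ijk(1,2,4)] Sh(2)[OF ijk(2,3,5)] Sh(2)[OF ijk(1,3) ik]
        Kh(2)[OF ijk(1)] Kh(2)[OF ijk(2)] Kh(2)[OF ijk(3)] Fh(1)[folded a]
        Eh(2)[OF ijk(1)] Eh(2)[OF ijk(2)] Eh(2)[OF ijk(3)] Sh(3)[OF ijk(1-5)]
        Kh(3)[OF ijk(1,2,4)] Kh(3)[OF ijk(2,3,5)] Kh(3)[OF ijk(1,3) ik]
        Eh(3)[OF ijk(1,2,4)] Eh(3)[OF ijk(2,3,5)] Eh(3)[OF ijk(1,3) ik]
        cells[OF ijk(1)] cells[OF ijk(2)] cells[OF ijk(3)]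
        Kh(4)[OF ijk(1-5)] Eh(4)[OF ijk(1-5)] ijk(6)[unfolded edge_def]])
  qed
  have "edge i j" if ij: "i \<in> A" "j \<in> A" "i \<sqsubset> j" for i j
  proof (cases "i \<sqsubset> i0")
    case False
    then show ?thesis
      using E2 ij final_segment_cases final_segmentD(5) by blast
  next
    case i: True
    consider "j \<sqsubset> i0" | "j = i0" | "i0 \<sqsubset> j"
      using less_linear[of j i0] A i0 ij by blast
    then show ?thesis
    proof cases
      case 1
      then show ?thesis
        using third[of i j i0] E1 ij i i0 by blast
    next
      case 2
      then show ?thesis
        using E1 ij by blast
    next
      case 3
      then have "edge i0 j"
        using E2 final_segmentD(4,5) ij by blast
      then show ?thesis
        using third[of i i0 j] E1 ij i i0 3 by blast
    qed
  qed
  then show ?thesis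
    unfolding is_factorization_seq_iff edge_def using cells Fh(1) a by auto
qed

text \<open>Restriction to a final segment loses no information about cocones and their factorizations, by the
two extension lemmas. It allows a sequence to be started at any of its terms without
losing the colimit property at limit indices.\<close>

lemma is_hocolim_final_segment:
  assumes K: "is_hocolim C (seq_diagram r A S) K"
  shows "is_hocolim C (seq_diagram r B S) K"
  unfolding is_hocolim_def
proof (intro conjI allI impI)
  have BA: "B \<subseteq> A"
    using B by blast
  have KA: "is_cocone C (seq_diagram r A S) K"
    using K by (simp add: is_hocolim_def)
  show "is_diagram C (seq_diagram r B S)"
    using is_diagram_seq pseudofunctor_on_subset[OF S BA] by blast
  show "is_cocone C (seq_diagram r B S) K"
    using KA BA is_cocone_seq_subset by blast
  fix K' assume K': "is_cocone C (seq_diagram r B S) K'"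
  let ?E = "extend_cocone S i0 K'"
  have E: "is_cocone C (seq_diagram r A S) ?E"
    by (rule is_cocone_extend) fact
  have EB: "apex ?E = apex K'" "i \<in> B \<Longrightarrow> leg ?E i = leg K' i"
    "i \<in> B \<Longrightarrow> legcell ?E (i, j) = legcell K' (i, j)" for i j
    using final_segmentD(2) by (simp_all add: extend_cocone_def)
  have "\<exists>u \<psi>. is_factorization C (seq_diagram r A S) K ?E u \<psi>"
    using K E by (auto simp: is_hocolim_def)
  then obtain u \<psi> where "is_factorization C (seq_diagram r B S) K ?E u \<psi>"
    using is_factorization_seq_subset BA by blast
  then have "is_factorization C (seq_diagram r B S) K K' u \<psi>"
    unfolding is_factorization_seq_iff using EB by simp
  then show "\<exists>u \<psi>. is_factorization C (seq_diagram r B S) K K' u \<psi>"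
    by blast
  fix u \<psi> u' \<psi>'
  assume F: "is_factorization C (seq_diagram r B S) K K' u \<psi> \<and>
    is_factorization C (seq_diagram r B S) K K' u' \<psi>'"
  define ext where "ext u \<psi> = (\<lambda>i. if i \<sqsubset> i0
      then rwhisker C (\<psi> i0) (sar S i i0) \<odot> inv2 (lwhisker C u (legcell K (i, i0)))
      else \<psi> i)" for u \<psi>
  have "is_factorization C (seq_diagram r A S) K ?E u (ext u \<psi>)"
    "is_factorization C (seq_diagram r A S) K ?E u' (ext u' \<psi>')"
    unfolding ext_def using is_factorization_extend[OF KA K'] F by blast+
  then have ex1: "\<exists>!\<theta>. \<theta> \<in> hom2 C u u' \<and> (\<forall>v \<in> A. ext u' \<psi>' v \<odot> rwhisker C \<theta> (leg K v) = ext u \<psi> v)"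
    using K E unfolding is_hocolim_def by auto
  \<comment> \<open>Below \<open>i0\<close> the condition on \<open>\<theta>\<close> is implied by the one at \<open>i0\<close>, as the extended 2-cells are
    determined by the one at \<open>i0\<close>.\<close>
  have "(\<forall>v \<in> A. ext u' \<psi>' v \<odot> rwhisker C \<theta> (leg K v) = ext u \<psi> v) \<longleftrightarrow>
        (\<forall>v \<in> B. \<psi>' v \<odot> rwhisker C \<theta> (leg K v) = \<psi> v)" if \<theta>: "\<theta> \<in> hom2 C u u'" for \<theta>
  proof
    assume *: "\<forall>v \<in> A. ext u' \<psi>' v \<odot> rwhisker C \<theta> (leg K v) = ext u \<psi> v"
    have "ext u \<psi> v = \<psi> v" if "v \<in> B" for u \<psi> v
      using final_segmentD(2)[OF that] by (simp add: ext_def)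
    then show "\<forall>v \<in> B. \<psi>' v \<odot> rwhisker C \<theta> (leg K v) = \<psi> v"
      using * BA by (metis subsetD)
  next
    assume *: "\<forall>v \<in> B. \<psi>' v \<odot> rwhisker C \<theta> (leg K v) = \<psi> v"
    show "\<forall>v \<in> A. ext u' \<psi>' v \<odot> rwhisker C \<theta> (leg K v) = ext u \<psi> v"
    proof
      fix v assume v: "v \<in> A"
      show "ext u' \<psi>' v \<odot> rwhisker C \<theta> (leg K v) = ext u \<psi> v"
      proof (cases "v \<sqsubset> i0")
        case False
        then show ?thesis
          using * final_segment_cases[OF v] by (simp add: ext_def)
      next
        case True
        note F1 = is_factorization_seqD[OF F[THEN conjunct1], unfolded hom1_def hom2_def mem_Collect_eq]
        note F2 = is_factorization_seqD[OF F[THEN conjunct2], unfolded hom1_def hom2_def mem_Collect_eq]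
        note K1 = is_cocone_seqD[OF KA, unfolded hom1_def hom2_def mem_Collect_eq]
        note [simp] = F1(1) F2(1) F1(2)[OF final_segmentD(4)] F2(2)[OF final_segmentD(4)]
          K1(2)[OF v] K1(2)[OF i0] K1(3)[OF v i0 True]
          pseudofunctor_onD(2)[OF S v i0 True, unfolded hom1_def mem_Collect_eq]
          \<theta>[unfolded hom2_def mem_Collect_eq]
        let ?c = "legcell K (v, i0)"
        have "rwhisker C \<theta> (leg K v) \<odot> lwhisker C u ?c =
            lwhisker C u' ?c \<odot> rwhisker C \<theta> (leg K i0 \<cdot> sar S v i0)"
          by (rule whisker_swap) simp_all
        then have "inv2 (lwhisker C u' ?c) \<odot> ((rwhisker C \<theta> (leg K v) \<odot> lwhisker C u ?c) \<odot> inv2 (lwhisker C u ?c)) =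
            inv2 (lwhisker C u' ?c) \<odot> ((lwhisker C u' ?c \<odot> rwhisker C \<theta> (leg K i0 \<cdot> sar S v i0)) \<odot> inv2 (lwhisker C u ?c))"
          by (simp only:)
        then have swap: "inv2 (lwhisker C u' ?c) \<odot> rwhisker C \<theta> (leg K v) =
            rwhisker C \<theta> (leg K i0 \<cdot> sar S v i0) \<odot> inv2 (lwhisker C u ?c)"
          by simp
        have "ext u' \<psi>' v \<odot> rwhisker C \<theta> (leg K v) =
            rwhisker C (\<psi>' i0) (sar S v i0) \<odot> (inv2 (lwhisker C u' ?c) \<odot> rwhisker C \<theta> (leg K v))"
          using True by (simp add: ext_def)
        also have "\<dots> = rwhisker C (\<psi>' i0 \<odot> rwhisker C \<theta> (leg K i0)) (sar S v i0) \<odot> inv2 (lwhisker C u ?c)"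
          unfolding swap by simp
        also have "\<psi>' i0 \<odot> rwhisker C \<theta> (leg K i0) = \<psi> i0"
          using * final_segmentD(4) by blast
        finally show ?thesis
          using True by (simp add: ext_def)
      qed
    qed
  qed
  then show "\<exists>!\<theta>. \<theta> \<in> hom2 C u u' \<and> (\<forall>v \<in> verts (seq_diagram r B S). \<psi>' v \<odot> rwhisker C \<theta> (leg K v) = \<psi> v)"
    using ex1 unfolding verts_seq by (metis (lifting))
qed

end

end

section \<open>Inaccessible cardinals\<close>

lemma regular_strict_bound:
  fixes \<rho> :: "'w rel"
  assumes \<rho>: "Card_order \<rho>" "\<not> finite (Field \<rho>)" "regularCard \<rho>"
    and A: "A \<subseteq> Field \<rho>" "|A| <o \<rho>"
  shows "\<exists>b \<in> Field \<rho>. \<forall>a \<in> A. strictly_less \<rho> a b"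
proof -
  interpret well_ordered_index \<rho>
    using \<rho>(1) by unfold_locales (simp add: card_order_on_def)
  have "\<not> cofinal A \<rho>"
    using \<rho>(3) A not_ordLess_ordIso unfolding regularCard_def by blast
  then obtain a where a: "a \<in> Field \<rho>" "\<forall>b \<in> A. \<not> strictly_less \<rho> a b"
    unfolding cofinal_def strictly_less_def by blast
  obtain b where b: "b \<in> Field \<rho>" "strictly_less \<rho> a b"
    using infinite_Card_order_limit[OF \<rho>(1,2) a(1)] unfolding strictly_less_def by blast
  have "strictly_less \<rho> x b" if "x \<in> A" for x
    using a A(1) b that less_linear[of x a] less_trans by blast
  with b(1) show ?thesis
    by blast
qed

locale inaccessible_cardinal =
  fixes \<kappa> :: "'k rel"
  assumes inaccessible: "inaccessible \<kappa>"
begin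

lemma Card_order: "Card_order \<kappa>" and regular: "regularCard \<kappa>" and uncountable: "natLeq <o \<kappa>"
  and Pow_small: "|A| <o \<kappa> \<Longrightarrow> |Pow (A :: 'k set)| <o \<kappa>"
  using inaccessible by (auto simp: inaccessible_def)

sublocale well_ordered_index \<kappa>
  using Card_order by unfold_locales (simp add: card_order_on_def)

abbreviation less_rank (infix "\<sqsubset>" 50) where "i \<sqsubset> j \<equiv> strictly_less \<kappa> i j"

lemma infinite_Field: "\<not> finite (Field \<kappa>)"
proof -
  have "cinfinite \<kappa>"
    using cinfinite_mono[OF ordLess_imp_ordLeq[OF uncountable] natLeq_cinfinite] .
  then show ?thesis
    by (simp add: cinfinite_def)
qed

lemma stable: "stable \<kappa>"
  using regularCard_stable[OF Card_order infinite_Field regular] .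

lemma small_subset: "small \<kappa> A \<Longrightarrow> B \<subseteq> A \<Longrightarrow> small \<kappa> B"
  unfolding small_def using card_of_mono1 ordLeq_ordLess_trans by blast

lemma small_image: "small \<kappa> A \<Longrightarrow> small \<kappa> (f ` A)"
  unfolding small_def using card_of_image ordLeq_ordLess_trans by blast

lemma small_Sigma: "small \<kappa> A \<Longrightarrow> (\<And>a. a \<in> A \<Longrightarrow> small \<kappa> (B a)) \<Longrightarrow> small \<kappa> (Sigma A B)"
  unfolding small_def by (rule stable_elim[OF stable])

lemma small_UNION: "small \<kappa> A \<Longrightarrow> (\<And>a. a \<in> A \<Longrightarrow> small \<kappa> (B a)) \<Longrightarrow> small \<kappa> (\<Union>a\<in>A. B a)"
  unfolding small_def by (rule stable_UNION[OF stable])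

lemma small_nat: "small \<kappa> (UNIV :: nat set)"
  unfolding small_def using uncountable card_of_nat ordIso_ordLess_trans by blast

lemma small_finite: "finite A \<Longrightarrow> small \<kappa> A"
proof -
  assume "finite A"
  then have "|A| <o natLeq"
    by (simp add: finite_iff_ordLess_natLeq)
  then show ?thesis
    using uncountable ordLess_transitive unfolding small_def by blast
qed

lemma small_Un: "small \<kappa> A \<Longrightarrow> small \<kappa> B \<Longrightarrow> small \<kappa> (A \<union> B)"
  unfolding small_def by (rule card_of_Un_ordLess_infinite_Field[OF infinite_Field Card_order])

lemma small_below: "small \<kappa> {i. i \<sqsubset> k}"
proof (cases "k \<in> Field \<kappa>")
  case True
  have "{i. i \<sqsubset> k} = underS \<kappa> k"
    by (auto simp: underS_def strictly_less_def)
  then show ?thesis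
    using card_of_underS[OF Card_order True] by (simp add: small_def)
next
  case False
  then have "{i. i \<sqsubset> k} = {}"
    using less_Field by blast
  then show ?thesis
    by (simp add: small_finite)
qed

lemma small_downset: "small \<kappa> {i. (i, k) \<in> \<kappa>}"
proof -
  have "{i. (i, k) \<in> \<kappa>} \<subseteq> {i. i \<sqsubset> k} \<union> {k}"
    by (auto simp: strictly_less_def)
  then show ?thesis
    by (rule small_subset[OF small_Un[OF small_below small_finite[of "{k}"]], rotated]) simp
qed

lemma small_bounded:
  assumes "small \<kappa> A" "A \<subseteq> Field \<kappa>"
  shows "\<exists>b \<in> Field \<kappa>. \<forall>a \<in> A. a \<sqsubset> b"
  using regular_strict_bound[OF Card_order infinite_Field regular] assms by (simp add: small_def)

lemma small_inj_Field:
  assumes "small \<kappa> A"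
  shows "\<exists>f. inj_on f A \<and> f ` A \<subseteq> Field \<kappa>"
proof -
  have "|A| \<le>o |Field \<kappa>|"
    using assms unfolding small_def
    using card_of_Field_ordIso[OF Card_order] ordIso_symmetric ordLess_ordIso_trans
      ordLess_imp_ordLeq by blast
  then show ?thesis
    by (simp add: card_of_ordLeq)
qed

lemma successor_exists:
  assumes "i \<in> Field \<kappa>"
  shows "\<exists>k \<in> Field \<kappa>. successor_pair \<kappa> i k"
proof -
  obtain b where b: "b \<in> {k. i \<sqsubset> k}"
    using infinite_Card_order_limit[OF Card_order infinite_Field assms] by (auto simp: strictly_less_def)
  obtain k where k: "k \<in> {k. i \<sqsubset> k}" "\<And>y. (y, k) \<in> {(i, j). i \<sqsubset> j} \<Longrightarrow> y \<notin> {k. i \<sqsubset> k}"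
    using b by (rule wfE_min[OF wf_less]) blast
  then show ?thesis
    using less_Field(2)[of i k] by (auto simp: successor_pair_def)
qed

lemma least_exists: "\<exists>z. is_least \<kappa> z"
proof -
  obtain b where b: "b \<in> Field \<kappa>"
    using infinite_Field by (metis ex_in_conv finite.emptyI)
  obtain z where z: "z \<in> Field \<kappa>" "\<And>y. (y, z) \<in> {(i, j). i \<sqsubset> j} \<Longrightarrow> y \<notin> Field \<kappa>"
    using b by (rule wfE_min[OF wf_less]) blast
  have "(z, i) \<in> \<kappa>" if i: "i \<in> Field \<kappa>" for i
    using z(2)[of i] i less_linear[OF z(1) i] rel_iff[OF z(1), of i] by auto
  then show ?thesis
    using z(1) by (auto simp: is_least_def)
qed

text \<open>Composing a bijection of \<open>\<kappa>\<close> with its square with itself yields a bijection of \<open>\<kappa>\<close> with its cube; after one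
factor is forgotten, every pair has \<open>\<kappa>\<close> many preimages, too many to lie below a given \<open>j\<close>.\<close>

lemma bookkeeping:
  "\<exists>\<phi> :: 'k \<Rightarrow> 'k \<times> 'k. \<forall>j \<in> Field \<kappa>. \<forall>a \<in> Field \<kappa>. \<exists>i \<in> Field \<kappa>. (j, i) \<in> \<kappa> \<and> \<phi> i = (j, a)"
proof -
  let ?F = "Field \<kappa>"
  have "|?F \<times> ?F| =o |?F|"
    by (rule card_of_Times_same_infinite[OF infinite_Field])
  then obtain g where g: "bij_betw g ?F (?F \<times> ?F)"
    using card_of_ordIso ordIso_symmetric by metis
  have surj: "\<exists>i \<in> ?F. g i = (a, b)" if "a \<in> ?F" "b \<in> ?F" for a b
    using g that unfolding bij_betw_def by (metis SigmaI imageE)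
  have "\<exists>i \<in> ?F. (j, i) \<in> \<kappa> \<and> g (fst (g i)) = (j, a)" if ja: "j \<in> ?F" "a \<in> ?F" for j a
  proof (rule ccontr)
    assume *: "\<not> ?thesis"
    have "?F \<subseteq> (snd \<circ> g) ` {i. i \<sqsubset> j}"
    proof
      fix b assume "b \<in> ?F"
      moreover obtain c where c: "c \<in> ?F" "g c = (j, a)"
        using surj ja by blast
      ultimately obtain i where i: "i \<in> ?F" "g i = (c, b)"
        using surj by blast
      then have "i \<sqsubset> j"
        using * c ja less_linear[of i j] rel_iff by force
      then show "b \<in> (snd \<circ> g) ` {i. i \<sqsubset> j}"
        using i by force
    qed
    then have "small \<kappa> ?F"
      using small_image small_below small_subset by blast
    then show False
      unfolding small_def using card_of_Field_ordIso[OF Card_order] not_ordLess_ordIso by blast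
  qed
  then show ?thesis
    by (intro exI[of _ "\<lambda>i. g (fst (g i))"]) blast
qed

text \<open>Let \<open>\<rho>\<close> be an infinite successor cardinal above the cardinality of \<open>M\<close>; it is below \<open>\<kappa>\<close>, as \<open>\<kappa>\<close> is a
strong limit. A strictly increasing function \<open>d\<close> on \<open>\<rho>\<close> that overtakes \<open>T\<close> at every step has a supremum
\<open>\<delta>\<close> in \<open>\<kappa>\<close>, which is closed under \<open>T\<close>. It has the cofinality of the regular cardinal \<open>\<rho>\<close>, so subsets of
cardinality at most that of \<open>M\<close> are bounded below \<open>\<delta>\<close>.\<close>

lemma exists_closed_limit_point:
  fixes M :: "'k set" and T :: "'k \<Rightarrow> 'k"
  assumes M: "small \<kappa> M" and T: "\<And>j. j \<in> Field \<kappa> \<Longrightarrow> T j \<in> Field \<kappa>"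
  shows "\<exists>\<delta>. limit_point \<kappa> \<delta> \<and> (\<forall>j. j \<sqsubset> \<delta> \<longrightarrow> T j \<sqsubset> \<delta>) \<and>
    (\<forall>A \<subseteq> {i. i \<sqsubset> \<delta>}. |A| \<le>o |M| \<longrightarrow> (\<exists>b. b \<sqsubset> \<delta> \<and> (\<forall>a \<in> A. a \<sqsubset> b)))"
proof -
  \<comment> \<open>The natural numbers are added to make the cardinal infinite, so that its successor is regular.\<close>
  define M' where "M' = M <+> (UNIV :: nat set)"
  define \<rho> where "\<rho> = cardSuc |M'|"
  have infM: "\<not> finite M'"
    by (simp add: M'_def)
  have MM': "|M| \<le>o |M'|"
    unfolding M'_def by (rule card_of_Plus1)
  have M'small: "|M'| <o \<kappa>"
    unfolding M'_def using card_of_Plus_ordLess_infinite_Field[OF infinite_Field Card_order] M small_nat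
    by (simp add: small_def)
  have \<rho>: "Card_order \<rho>" "regularCard \<rho>" "|M'| <o \<rho>"
    unfolding \<rho>_def using infM
    by (auto intro: cardSuc_Card_order infinite_cardSuc_regularCard cardSuc_greater
        card_of_Card_order simp: Field_card_of)
  have inf\<rho>: "\<not> finite (Field \<rho>)"
    unfolding \<rho>_def using cardSuc_finite[OF card_of_Card_order, of M'] infM by (simp add: Field_card_of)
  obtain A' :: "'k set" where A': "|A'| <o \<kappa>" "|M'| =o |A'|"
    using internalize_card_of_ordLess[of M' \<kappa>] M'small by blast
  have "\<rho> \<le>o |Pow M'|"
    unfolding \<rho>_def by (intro cardSuc_least card_of_Card_order card_of_Pow)
  moreover have "|Pow M'| \<le>o |Pow A'|"
  proof -
    obtain h where "bij_betw h M' A'"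
      using A'(2) card_of_ordIso by blast
    then have "bij_betw (image h) (Pow M') (Pow A')"
      by (rule bij_betw_Pow)
    then show ?thesis
      using card_of_ordIso ordIso_iff_ordLeq by blast
  qed
  ultimately have \<rho>\<kappa>: "\<rho> <o \<kappa>"
    using Pow_small[OF A'(1)] ordLeq_transitive ordLeq_ordLess_trans by blast
  interpret R: well_ordered_index \<rho>
    using \<rho>(1) by unfold_locales (simp add: card_order_on_def)
  define P where "P d a x \<longleftrightarrow> (a \<in> Field \<rho> \<longrightarrow> x \<in> Field \<kappa> \<and>
      (\<forall>b. strictly_less \<rho> b a \<longrightarrow> d b \<sqsubset> x \<and> (\<forall>j. (j, d b) \<in> \<kappa> \<longrightarrow> T j \<sqsubset> x)))" for d a x
  have "\<exists>d. \<forall>a. P d a (d a)"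
  proof (rule dependent_wf_choice[OF R.wf_less])
    show "P f x r \<longleftrightarrow> P g x r"
      if "\<And>z. (z, x) \<in> {(i, j). strictly_less \<rho> i j} \<Longrightarrow> f z = g z" for f g x r
      unfolding P_def using that by simp
    fix a d
    assume IH: "\<And>y. (y, a) \<in> {(i, j). strictly_less \<rho> i j} \<Longrightarrow> P d y (d y)"
    show "\<exists>x. P d a x"
    proof (cases "a \<in> Field \<rho>")
      case True
      let ?W = "\<Union>b \<in> {b. strictly_less \<rho> b a}. {d b} \<union> T ` {j. (j, d b) \<in> \<kappa>}"
      have "{b. strictly_less \<rho> b a} = underS \<rho> a"
        by (auto simp: underS_def strictly_less_def)
      then have "small \<kappa> {b. strictly_less \<rho> b a}"
        unfolding small_def using card_of_underS[OF \<rho>(1) True] \<rho>\<kappa> ordLess_transitive by metis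
      then have "small \<kappa> ?W"
        by (rule small_UNION) (intro small_Un small_image small_downset small_finite finite.intros)
      moreover have "?W \<subseteq> Field \<kappa>"
      proof -
        have "d b \<in> Field \<kappa>" if "strictly_less \<rho> b a" for b
          using IH[of b] that R.less_Field by (auto simp: P_def)
        moreover have "j \<in> Field \<kappa>" if "(j, i) \<in> \<kappa>" for i j
          using that by (auto simp: Field_def)
        ultimately show ?thesis
          using T by blast
      qed
      ultimately obtain x where "x \<in> Field \<kappa>" "\<forall>y \<in> ?W. y \<sqsubset> x"
        using small_bounded by blast
      then have "P d a x"
        unfolding P_def by blast
      then show ?thesis
        by blast
    qed (simp add: P_def)
  qed
  then obtain d where d: "\<And>a. P d a (d a)"
    by blast
  have dF: "d a \<in> Field \<kappa>" if "a \<in> Field \<rho>" for a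
    using d[of a] that by (simp add: P_def)
  have d_less: "d b \<sqsubset> d a" and dT: "(j, d b) \<in> \<kappa> \<Longrightarrow> T j \<sqsubset> d a" if "strictly_less \<rho> b a" for a b j
    using d[of a] that R.less_Field by (auto simp: P_def)
  have above: "\<exists>a' \<in> Field \<rho>. strictly_less \<rho> a a'" if "a \<in> Field \<rho>" for a
    using infinite_Card_order_limit[OF \<rho>(1) inf\<rho> that] by (auto simp: strictly_less_def)
  have "small \<kappa> (d ` Field \<rho>)"
    using \<rho>\<kappa> card_of_Field_ordIso[OF \<rho>(1)] ordIso_ordLess_trans
    by (intro small_image) (auto simp: small_def)
  then obtain x where "x \<in> Field \<kappa> \<and> (\<forall>a \<in> Field \<rho>. d a \<sqsubset> x)"
    using small_bounded[of "d ` Field \<rho>"] dF by blast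
  then have "x \<in> {x. x \<in> Field \<kappa> \<and> (\<forall>a \<in> Field \<rho>. d a \<sqsubset> x)}" (is "x \<in> ?U")
    by simp
  \<comment> \<open>The least strict upper bound: being least, it has values of \<open>d\<close> cofinal below it.\<close>
  then obtain \<delta> where \<delta>U: "\<delta> \<in> ?U" and min: "\<And>y. (y, \<delta>) \<in> {(i, j). i \<sqsubset> j} \<Longrightarrow> y \<notin> ?U"
    by (rule wfE_min[OF wf_less]) blast
  have \<delta>: "\<delta> \<in> Field \<kappa>" "\<And>a. a \<in> Field \<rho> \<Longrightarrow> d a \<sqsubset> \<delta>"
    using \<delta>U by blast+
  have below: "\<exists>a \<in> Field \<rho>. (i, d a) \<in> \<kappa>" if i: "i \<sqsubset> \<delta>" for i
  proof -
    obtain a where "a \<in> Field \<rho>" "\<not> d a \<sqsubset> i"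
      using min[of i] i less_Field(1)[OF i] by auto
    then show ?thesis
      using less_linear[of i "d a"] less_Field(1)[OF i] dF rel_iff[of i "d a"] by blast
  qed
  have step: "\<exists>a \<in> Field \<rho>. i \<sqsubset> d a \<and> T i \<sqsubset> d a \<and> d a \<sqsubset> \<delta>" if i: "i \<sqsubset> \<delta>" for i
  proof -
    obtain a where a: "a \<in> Field \<rho>" "(i, d a) \<in> \<kappa>"
      using below i by blast
    obtain a' where a': "a' \<in> Field \<rho>" "strictly_less \<rho> a a'"
      using above a by blast
    have "i \<sqsubset> d a'"
      using d_less[OF a'(2)] a(2) less_trans rel_iff[OF less_Field(1)[OF i], of "d a"] by blast
    then show ?thesis
      using a' dT[OF a'(2) a(2)] \<delta>(2) by blast
  qed
  have "limit_point \<kappa> \<delta>"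
    unfolding limit_point_def
  proof (intro conjI)
    show "\<delta> \<in> Field \<kappa>"
      by fact
    show "\<exists>i. i \<sqsubset> \<delta>"
      using \<delta>(2) inf\<rho> by (metis finite.emptyI ex_in_conv)
    show "\<nexists>i. successor_pair \<kappa> i \<delta>"
      using step unfolding successor_pair_def by blast
  qed
  moreover have "\<forall>j. j \<sqsubset> \<delta> \<longrightarrow> T j \<sqsubset> \<delta>"
    using step less_trans by blast
  moreover have "\<exists>b. b \<sqsubset> \<delta> \<and> (\<forall>x \<in> A. x \<sqsubset> b)" if A: "A \<subseteq> {i. i \<sqsubset> \<delta>}" "|A| \<le>o |M|" for A
  proof -
    have "\<forall>x \<in> A. \<exists>a. a \<in> Field \<rho> \<and> (x, d a) \<in> \<kappa>"
      using below A by blast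
    then obtain s where s: "\<And>x. x \<in> A \<Longrightarrow> s x \<in> Field \<rho> \<and> (x, d (s x)) \<in> \<kappa>"
      by metis
    have "|s ` A| <o \<rho>"
      using card_of_image A(2) MM' \<rho>(3) ordLeq_transitive ordLeq_ordLess_trans by metis
    then obtain b where b: "b \<in> Field \<rho>" "\<forall>a \<in> s ` A. strictly_less \<rho> a b"
      using regular_strict_bound[OF \<rho>(1) inf\<rho> \<rho>(2), of "s ` A"] s by blast
    have "x \<sqsubset> d b" if "x \<in> A" for x
    proof -
      have "d (s x) \<sqsubset> d b"
        using d_less b that by blast
      then show ?thesis
        using s[OF that] less_trans rel_iff[of x "d (s x)"] by (metis FieldI1)
    qed
    then show ?thesis
      using \<delta>(2)[OF b(1)] by blast
  qed
  ultimately show ?thesis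
    by blast
qed

end

section \<open>Cocompleteness for small diagrams of arbitrary shape\<close>

locale cocomplete_21_category = strict_21_category C + inaccessible_cardinal \<kappa>
  for C :: "('o, 'm, 'c) two_cat" (structure) and \<kappa> :: "'k rel" +
  assumes cocomplete: "two_cocomplete \<kappa> C"
    and locally_small: "locally_small \<kappa> C"
begin

sublocale indexed_21_category C \<kappa> ..

text \<open>A small set of vertices, edges or triangles embeds into \<open>'k\<close>, and homotopy colimits do not depend on
the names of the elements of the shape.\<close>

lemma hocolim_exists:
  fixes D :: "('v, 'e, 't, 'o, 'm, 'c) diagram"
  assumes D: "is_diagram C D" and small: "small \<kappa> (verts D)" "small \<kappa> (edges D)" "small \<kappa> (tris D)"
  shows "\<exists>K. is_hocolim C D K"
proof -
  obtain fv fe ft :: "_ \<Rightarrow> 'k" where inj: "inj_on fv (verts D)" "inj_on fe (edges D)" "inj_on ft (tris D)"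
    using small small_inj_Field by metis
  define gv ge gt where "gv = inv_into (verts D) fv" and "ge = inv_into (edges D) fe"
    and "gt = inv_into (tris D) ft"
  have g [simp]: "v \<in> verts D \<Longrightarrow> gv (fv v) = v" "e \<in> edges D \<Longrightarrow> ge (fe e) = e"
    "t \<in> tris D \<Longrightarrow> gt (ft t) = t" for v e t
    using inj by (simp_all add: gv_def ge_def gt_def)
  define D' :: "('k, 'k, 'k, 'o, 'm, 'c) diagram" where "D' =
    \<lparr>verts = fv ` verts D, edges = fe ` edges D, tris = ft ` tris D,
     esrc = fv \<circ> esrc D \<circ> ge, etgt = fv \<circ> etgt D \<circ> ge,
     tri1 = fe \<circ> tri1 D \<circ> gt, tri2 = fe \<circ> tri2 D \<circ> gt, tri3 = fe \<circ> tri3 D \<circ> gt,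
     dob = dob D \<circ> gv, dar = dar D \<circ> ge, dcell = dcell D \<circ> gt\<rparr>"
  define pull :: "('k, 'k, 'o, 'm, 'c) cocone \<Rightarrow> ('v, 'e, 'o, 'm, 'c) cocone" where
    "pull K = \<lparr>apex = apex K, leg = leg K \<circ> fv, legcell = legcell K \<circ> fe\<rparr>" for K
  define push :: "('v, 'e, 'o, 'm, 'c) cocone \<Rightarrow> ('k, 'k, 'o, 'm, 'c) cocone" where
    "push K = \<lparr>apex = apex K, leg = leg K \<circ> gv, legcell = legcell K \<circ> ge\<rparr>" for K
  have e [simp]: "esrc D e \<in> verts D" "etgt D e \<in> verts D" if "e \<in> edges D" for e
    using D that by (auto simp: is_diagram_def)
  have t [simp]: "tri1 D t \<in> edges D" "tri2 D t \<in> edges D" "tri3 D t \<in> edges D" if "t \<in> tris D" for t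
    using D that by (auto simp: is_diagram_def)
  have diag: "is_diagram C D'"
    using D by (simp add: is_diagram_def D'_def)
  moreover have "small \<kappa> (verts D')" "small \<kappa> (edges D')" "small \<kappa> (tris D')"
    using small by (simp_all add: D'_def small_image)
  ultimately obtain K where K: "is_hocolim C D' K"
    using cocomplete unfolding two_cocomplete_def by blast
  have pull: "is_cocone C D' K \<Longrightarrow> is_cocone C D (pull K)" for K
    by (simp add: is_cocone_def D'_def pull_def)
  have push: "is_cocone C D L \<Longrightarrow> is_cocone C D' (push L)" for L
    by (simp add: is_cocone_def D'_def push_def)
  have fact: "is_factorization C D' K (push L) u \<psi> \<longleftrightarrow> is_factorization C D (pull K) L u (\<psi> \<circ> fv)" for L u \<psi>
    by (simp add: is_factorization_def D'_def push_def pull_def)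
  have fact': "is_factorization C D (pull K) L u \<psi> \<Longrightarrow> is_factorization C D' K (push L) u (\<psi> \<circ> gv)" for L u \<psi>
    unfolding fact by (simp add: is_factorization_def)
  have "is_hocolim C D (pull K)"
    unfolding is_hocolim_def
  proof (intro conjI allI impI)
    show "is_cocone C D (pull K)"
      by (rule pull[OF hocolimD(2)[OF K]])
    fix L assume "is_cocone C D L"
    then have L: "is_cocone C D' (push L)"
      by (rule push)
    then show "\<exists>u \<psi>. is_factorization C D (pull K) L u \<psi>"
      using hocolimD(3)[OF K L] fact by blast
    fix u \<psi> u' \<psi>'
    assume F: "is_factorization C D (pull K) L u \<psi> \<and> is_factorization C D (pull K) L u' \<psi>'"
    have "\<exists>!\<theta>. \<theta> \<in> hom2 C u u' \<and>
        (\<forall>v \<in> verts D'. (\<psi>' \<circ> gv) v \<odot> rwhisker C \<theta> (leg K v) = (\<psi> \<circ> gv) v)"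
      by (rule hocolimD(4)[OF K L F[THEN conjunct1, THEN fact'] F[THEN conjunct2, THEN fact']])
    then show "\<exists>!\<theta>. \<theta> \<in> hom2 C u u' \<and>
        (\<forall>v \<in> verts D. \<psi>' v \<odot> rwhisker C \<theta> (leg (pull K) v) = \<psi> v)"
      by (simp add: D'_def pull_def)
  qed (rule D)
  then show ?thesis
    by blast
qed

lemma seq_hocolim_exists:
  assumes "pseudofunctor_on A S" "small \<kappa> A"
  shows "\<exists>K. is_hocolim C (seq_diagram \<kappa> A S) K"
proof (rule hocolim_exists[OF is_diagram_seq[OF assms(1)]])
  show "small \<kappa> (verts (seq_diagram \<kappa> A S))"
    using assms by simp
  have "edges (seq_diagram \<kappa> A S) \<subseteq> A \<times> A"
    by (auto simp: seq_diagram_def)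
  then show "small \<kappa> (edges (seq_diagram \<kappa> A S))"
    by (rule small_subset[rotated]) (intro small_Sigma assms)
  have "tris (seq_diagram \<kappa> A S) \<subseteq> A \<times> A \<times> A"
    by (auto simp: seq_diagram_def)
  then show "small \<kappa> (tris (seq_diagram \<kappa> A S))"
    by (rule small_subset[rotated]) (intro small_Sigma assms)
qed

lemma pushout_exists:
  assumes "g \<in> Arr C" "h \<in> Arr C" "Src C h = Src C g"
  shows "\<exists>K. is_hocolim C (span_diagram C g h) K"
proof (rule hocolim_exists)
  show "is_diagram C (span_diagram C g h)"
    using assms by (auto simp: is_diagram_def span_diagram_def hom1_def
        split: span_edge.splits span_vertex.splits)
  have "finite (UNIV :: span_vertex set)" "finite (UNIV :: span_edge set)"
  proof -
    have "(UNIV :: span_vertex set) = {Peak, Foot1, Foot2}" "(UNIV :: span_edge set) = {Leg1, Leg2}"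
      using span_vertex.exhaust span_edge.exhaust by auto
    then show "finite (UNIV :: span_vertex set)" "finite (UNIV :: span_edge set)"
      by (metis finite.emptyI finite.insertI)+
  qed
  then show "small \<kappa> (verts (span_diagram C g h))" "small \<kappa> (edges (span_diagram C g h))"
    "small \<kappa> (tris (span_diagram C g h))"
    by (auto simp: span_diagram_def intro: small_finite)
qed

section \<open>Segments of cellular sequences\<close>

text \<open>The conditions on a cellular sequence that concern indices in \<open>D\<close>. For a down-closed \<open>D\<close> they only
involve the restriction of the sequence to \<open>D\<close>.\<close>

definition cellular_on :: "'m set \<Rightarrow> 'k set \<Rightarrow> ('k, 'o, 'm, 'c) sequence \<Rightarrow> bool" where
  "cellular_on I D S \<longleftrightarrow> pseudofunctor_on D S \<and>
     (\<forall>b \<in> D. limit_point \<kappa> b \<longrightarrow> is_hocolim C (seq_diagram \<kappa> {i. i \<sqsubset> b} S) (seq_cocone S b)) \<and>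
     (\<forall>b \<in> D. \<forall>i. successor_pair \<kappa> i b \<longrightarrow> sar S i b \<in> two_pushouts C I)"

lemma Field_Restr: "A \<subseteq> Field \<kappa> \<Longrightarrow> Field (Restr \<kappa> A) = A"
  using wo by (simp add: Refl_Field_Restr2 well_order_on_def linear_order_on_def
      partial_order_on_def preorder_on_def)

context
  fixes I :: "'m set" and D A :: "'k set" and S :: "('k, 'o, 'm, 'c) sequence" and i :: 'k
  assumes S: "cellular_on I D S" and D: "D \<subseteq> Field \<kappa>" "\<And>b k. b \<in> D \<Longrightarrow> k \<sqsubset> b \<Longrightarrow> k \<in> D"
    and i: "i \<in> D" and A: "A = {k \<in> D. k = i \<or> i \<sqsubset> k}"
begin

lemma segment_predecessor:
  assumes "p \<sqsubset> b" "successor_pair \<kappa> p b" "i \<sqsubset> b" "b \<in> D"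
  shows "p \<in> A"
proof -
  have "p \<in> D"
    using assms D by blast
  moreover have "\<not> p \<sqsubset> i"
    using assms by (auto simp: successor_pair_def)
  ultimately show ?thesis
    unfolding A using less_linear[of p i] D(1) i by blast
qed

lemma segment_successor:
  assumes "successor_pair (Restr \<kappa> A) p b"
  shows "successor_pair \<kappa> p b" "b \<in> D"
proof -
  have pb: "p \<in> A" "b \<in> A" "p \<sqsubset> b"
    using assms by (auto simp: successor_pair_def)
  then show "b \<in> D"
    using A by blast
  have "k \<in> A" if "p \<sqsubset> k" "k \<sqsubset> b" for k
    using pb that D(2)[of b k] less_trans[of i p k] unfolding A by blast
  then show "successor_pair \<kappa> p b"
    using assms pb unfolding successor_pair_def by auto
qed

text \<open>A limit index of the segment starting at \<open>i\<close> is a limit index of \<open>\<kappa>\<close>, since an immediate predecessor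
in \<open>\<kappa>\<close> would lie in the segment; there the colimit over all smaller indices is also the colimit over those
from \<open>i\<close> on.\<close>

lemma segment_colimit_preserving: "colimit_preserving_sequence C (Restr \<kappa> A) S"
  unfolding colimit_preserving_sequence_def
proof (intro conjI allI impI)
  have AD: "A \<subseteq> D" "A \<subseteq> Field \<kappa>" "i \<in> A"
    using A D i by auto
  show "Well_order (Restr \<kappa> A)"
    using wo by (rule Well_order_Restr)
  show "Field (Restr \<kappa> A) \<noteq> {}"
    using Field_Restr AD by auto
  have pf: "pseudofunctor_on D S"
    using S by (simp add: cellular_on_def)
  show "is_pseudofunctor C (Restr \<kappa> A) S"
    unfolding is_pseudofunctor_Restr[OF AD(2)] by (rule pseudofunctor_on_subset[OF pf AD(1)])
  fix b assume b: "limit_point (Restr \<kappa> A) b"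
  then obtain k where k: "k \<in> A" "b \<in> A" "k \<sqsubset> b"
    by (auto simp: limit_point_def)
  then have bD: "b \<in> D" and ib: "i \<sqsubset> b"
    using less_trans[of i k b] unfolding A by blast+
  have "limit_point \<kappa> b"
    unfolding limit_point_def
  proof (intro conjI)
    show "b \<in> Field \<kappa>" "\<exists>i. i \<sqsubset> b"
      using bD D(1) ib by blast+
    show "\<nexists>p. successor_pair \<kappa> p b"
    proof
      assume "\<exists>p. successor_pair \<kappa> p b"
      then obtain p where p: "successor_pair \<kappa> p b"
        by blast
      then have "p \<in> A"
        using segment_predecessor bD ib by (auto simp: successor_pair_def)
      then have "successor_pair (Restr \<kappa> A) p b"
        using p k by (auto simp: successor_pair_def)
      then show False
        using b by (auto simp: limit_point_def)
    qed
  qed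
  then have hc: "is_hocolim C (seq_diagram \<kappa> {k. k \<sqsubset> b} S) (seq_cocone S b)"
    using S bD by (simp add: cellular_on_def)
  have "pseudofunctor_on {k. k \<sqsubset> b} S"
    using D(2)[OF bD] by (intro pseudofunctor_on_subset[OF pf]) blast
  moreover have "{k. strictly_less (Restr \<kappa> A) k b} = {k \<in> {k. k \<sqsubset> b}. k = i \<or> i \<sqsubset> k}"
    using k(2) D(2)[OF bD] unfolding A by auto
  moreover have "{k. k \<sqsubset> b} \<subseteq> Field \<kappa>"
    using less_Field by blast
  ultimately have "is_hocolim C (seq_diagram \<kappa> {k. strictly_less (Restr \<kappa> A) k b} S) (seq_cocone S b)"
    using is_hocolim_final_segment[of "{k. k \<sqsubset> b}" S i] hc ib by simp
  moreover have "seq_diagram (Restr \<kappa> A) {k. strictly_less (Restr \<kappa> A) k b} S =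
      seq_diagram \<kappa> {k. strictly_less (Restr \<kappa> A) k b} S"
    by (rule seq_diagram_Restr) auto
  ultimately show "is_hocolim C (seq_diagram (Restr \<kappa> A) {k. strictly_less (Restr \<kappa> A) k b} S)
      (seq_cocone S b)"
    by simp
qed

end

text \<open>The 1-cell from \<open>i\<close> to \<open>j\<close> is the leg at \<open>i\<close> of the colimit of the closed segment from \<open>i\<close> to \<open>j\<close>,
because \<open>j\<close> is its last index. The cases \<open>i = j\<close> and \<open>i < j\<close> are treated together, as sequences do not
record identity 1-cells.\<close>

lemma segment_I_cell:
  assumes S: "cellular_on I D S" and D: "D \<subseteq> Field \<kappa>" "\<And>b k. b \<in> D \<Longrightarrow> k \<sqsubset> b \<Longrightarrow> k \<in> D"
    and ij: "j \<in> D" "i = j \<or> i \<sqsubset> j"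
  shows "(if i = j then Id1 C (sob S j) else sar S i j) \<in> I_cell \<kappa> C I"
proof -
  define E where "E = {k. (k, j) \<in> \<kappa>}"
  have jF: "j \<in> Field \<kappa>"
    using ij D by blast
  have E: "k \<in> E \<longleftrightarrow> k = j \<or> k \<sqsubset> j" for k
    using jF rel_iff[of k j] less_Field(1)[of k j] FieldI1[of k j \<kappa>]
    by (cases "k \<in> Field \<kappa>") (auto simp: E_def)
  have ED: "E \<subseteq> D"
    using ij(1) D(2)[OF ij(1)] by (auto simp: E)
  have S': "cellular_on I E S"
    using S ED pseudofunctor_on_subset[of D S E] unfolding cellular_on_def by (meson subsetD)
  have E': "E \<subseteq> Field \<kappa>" "\<And>b k. b \<in> E \<Longrightarrow> k \<sqsubset> b \<Longrightarrow> k \<in> E" "i \<in> E"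
    using ED D(1) ij(2) by (auto simp: E dest: less_trans)
  let ?A = "{k \<in> E. k = i \<or> i \<sqsubset> k}"
  have F: "Field (Restr \<kappa> ?A) = ?A"
    using E'(1) by (intro Field_Restr) blast
  have jA: "j \<in> ?A" and iA: "i \<in> ?A"
    using E ij by auto
  have "is_hocolim C (seq_diagram \<kappa> ?A S) (top_cocone S j)"
  proof (rule is_hocolim_top)
    show "pseudofunctor_on ?A S"
      using S' pseudofunctor_on_subset[of E S ?A] by (auto simp: cellular_on_def)
  qed (use jA E in auto)
  moreover have "seq_diagram (Restr \<kappa> ?A) (Field (Restr \<kappa> ?A)) S = seq_diagram \<kappa> ?A S"
    unfolding F by (rule seq_diagram_Restr) simp
  ultimately have "is_hocolim C (seq_diagram (Restr \<kappa> ?A) (Field (Restr \<kappa> ?A)) S) (top_cocone S j)"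
    by simp
  moreover have cp: "colimit_preserving_sequence C (Restr \<kappa> ?A) S"
    by (rule segment_colimit_preserving[OF S' E'(1) _ E'(3) refl]) (rule E'(2))
  moreover have "is_least (Restr \<kappa> ?A) i"
  proof -
    have "(i, k) \<in> \<kappa>" if "k = i \<or> i \<sqsubset> k" for k
      using that E' rel_iff[of i k] by blast
    then show ?thesis
      unfolding is_least_def F using iA by auto
  qed
  moreover have "(if i = j then Id1 C (sob S j) else sar S i j) = leg (top_cocone S j) i"
    by (simp add: top_cocone_def)
  ultimately have "is_transfinite_composition C (Restr \<kappa> ?A) S (if i = j then Id1 C (sob S j) else sar S i j)"
    unfolding is_transfinite_composition_def
    using cp by blast
  moreover have "small \<kappa> (Field (Restr \<kappa> ?A))"
    unfolding F by (rule small_subset[OF small_downset[of j]]) (auto simp: E_def)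
  moreover have "sar S p b \<in> two_pushouts C I" if "successor_pair (Restr \<kappa> ?A) p b" for p b
  proof -
    have "successor_pair \<kappa> p b \<and> b \<in> E"
      using segment_successor[OF S' E'(1) _ E'(3) refl that] E'(2) by blast
    then show ?thesis
      using S' by (simp add: cellular_on_def)
  qed
  ultimately show ?thesis
    unfolding I_cell_def by blast
qed

end

section \<open>Lifting problems and pushouts\<close>

context strict_21_category
begin

definition lifts :: "'m \<Rightarrow> 'm \<Rightarrow> 'm \<Rightarrow> 'm \<Rightarrow> 'c \<Rightarrow> bool" where
  "lifts p g h h' \<eta> \<longleftrightarrow> (\<exists>k \<in> hom1 C (Tgt C g) (Src C p).
     \<exists>\<nu>1 \<in> hom2 C (k \<cdot> g) h. \<exists>\<nu>2 \<in> hom2 C h' (p \<cdot> k). \<eta> = lwhisker C p \<nu>1 \<odot> rwhisker C \<nu>2 g)"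

text \<open>The lifting problems \<open>(g, h, h', \<eta>)\<close> that a member of \<open>I\<close>-inj must solve.\<close>

definition problems :: "'m set \<Rightarrow> 'm \<Rightarrow> ('m \<times> 'm \<times> 'm \<times> 'c) set" where
  "problems I p = {(g, h, h', \<eta>). g \<in> I \<and> h \<in> hom1 C (Src C g) (Src C p) \<and>
     h' \<in> hom1 C (Tgt C g) (Tgt C p) \<and> \<eta> \<in> hom2 C (h' \<cdot> g) (p \<cdot> h)}"

lemma I_inj_iff:
  "I_inj C I = {p \<in> Arr C. \<forall>(g, h, h', \<eta>) \<in> problems I p. lifts p g h h' \<eta>}"
  unfolding I_inj_def problems_def lifts_def by auto

lemma lifts_iso:
  assumes l: "lifts p g h h' \<eta>" and arr: "p \<in> Arr C" "g \<in> Arr C" "h \<in> hom1 C (Src C g) (Src C p)"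
    "h' \<in> hom1 C (Tgt C g) (Tgt C p)" and \<omega>: "\<omega> \<in> hom2 C h h2"
  shows "lifts p g h2 h' (lwhisker C p \<omega> \<odot> \<eta>)"
proof -
  obtain k \<nu>1 \<nu>2 where k: "k \<in> hom1 C (Tgt C g) (Src C p)" "\<nu>1 \<in> hom2 C (k \<cdot> g) h"
    "\<nu>2 \<in> hom2 C h' (p \<cdot> k)" and \<eta>: "\<eta> = lwhisker C p \<nu>1 \<odot> rwhisker C \<nu>2 g"
    using l unfolding lifts_def by blast
  note [simp] = arr[unfolded hom1_def mem_Collect_eq] k[unfolded hom1_def hom2_def mem_Collect_eq]
    \<omega>[unfolded hom2_def mem_Collect_eq]
  have h2: "Tgt C h2 = Src C p" "h2 \<in> Arr C"
    using cell_arr[of \<omega>] by simp_all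
  have "\<omega> \<odot> \<nu>1 \<in> hom2 C (k \<cdot> g) h2"
    by (simp add: hom2_def)
  moreover have "lwhisker C p \<omega> \<odot> \<eta> = lwhisker C p (\<omega> \<odot> \<nu>1) \<odot> rwhisker C \<nu>2 g"
    unfolding \<eta> using h2 by simp
  ultimately show ?thesis
    unfolding lifts_def using k by blast
qed

lemma lifts_comp:
  assumes l: "lifts p g h h' (rwhisker C \<rho> h \<odot> \<eta>)"
    and arr: "p \<in> hom1 C Z Y" "p' \<in> hom1 C Z' Y" "u \<in> hom1 C Z Z'" "g \<in> Arr C"
      "h \<in> hom1 C (Src C g) Z" "h' \<in> hom1 C (Tgt C g) Y"
    and cells: "\<rho> \<in> hom2 C (p' \<cdot> u) p" "\<eta> \<in> hom2 C (h' \<cdot> g) (p' \<cdot> (u \<cdot> h))"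
  shows "lifts p' g (u \<cdot> h) h' \<eta>"
proof -
  obtain k \<nu>1 \<nu>2 where k: "k \<in> hom1 C (Tgt C g) (Src C p)" "\<nu>1 \<in> hom2 C (k \<cdot> g) h"
    "\<nu>2 \<in> hom2 C h' (p \<cdot> k)" and \<eta>: "rwhisker C \<rho> h \<odot> \<eta> = lwhisker C p \<nu>1 \<odot> rwhisker C \<nu>2 g"
    using l unfolding lifts_def by blast
  note [simp] = arr[unfolded hom1_def mem_Collect_eq] k[unfolded hom1_def hom2_def mem_Collect_eq]
    cells[unfolded hom2_def mem_Collect_eq]
  have "rwhisker C (inv2 \<rho>) h \<odot> lwhisker C p \<nu>1 = lwhisker C (p' \<cdot> u) \<nu>1 \<odot> rwhisker C (inv2 \<rho>) (k \<cdot> g)"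
    by (rule whisker_swap) simp_all
  then have swap: "lwhisker C (p' \<cdot> u) \<nu>1 \<odot> inv2 (rwhisker C \<rho> (k \<cdot> g)) =
      inv2 (rwhisker C \<rho> h) \<odot> lwhisker C p \<nu>1"
    by simp
  have "lwhisker C p' (lwhisker C u \<nu>1) \<odot> rwhisker C (rwhisker C (inv2 \<rho>) k \<odot> \<nu>2) g =
      (lwhisker C (p' \<cdot> u) \<nu>1 \<odot> inv2 (rwhisker C \<rho> (k \<cdot> g))) \<odot> rwhisker C \<nu>2 g"
    by simp
  also have "\<dots> = inv2 (rwhisker C \<rho> h) \<odot> (lwhisker C p \<nu>1 \<odot> rwhisker C \<nu>2 g)"
    unfolding swap by simp
  also have "\<dots> = \<eta>"
    unfolding \<eta>[symmetric] by simp
  finally have "\<eta> = lwhisker C p' (lwhisker C u \<nu>1) \<odot> rwhisker C (rwhisker C (inv2 \<rho>) k \<odot> \<nu>2) g"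
    by simp
  moreover have "u \<cdot> k \<in> hom1 C (Tgt C g) (Src C p')" "lwhisker C u \<nu>1 \<in> hom2 C ((u \<cdot> k) \<cdot> g) (u \<cdot> h)"
    "rwhisker C (inv2 \<rho>) k \<odot> \<nu>2 \<in> hom2 C h' (p' \<cdot> (u \<cdot> k))"
    by (simp_all add: hom1_def hom2_def)
  ultimately show ?thesis
    unfolding lifts_def by blast
qed

text \<open>Let \<open>a\<close> be a 1-cell from an object over \<open>Y\<close> to the object with structure map \<open>p\<close>, with 2-cell \<open>\<pi>\<close>
comparing the structure maps. A lifting problem of the first object is solved if its transport
along \<open>a\<close> has a lift. The transported 2-cell \<open>\<eta>'\<close> is determined by \<open>\<eta>\<close>, as \<open>\<pi>\<close> is invertible.\<close>

definition solves :: "'m \<Rightarrow> 'c \<Rightarrow> 'm \<Rightarrow> ('m \<times> 'm \<times> 'm \<times> 'c) \<Rightarrow> bool" where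
  "solves a \<pi> p = (\<lambda>(g, h, h', \<eta>). \<exists>\<eta>' \<in> hom2 C (h' \<cdot> g) (p \<cdot> (a \<cdot> h)).
     \<eta> = rwhisker C \<pi> h \<odot> \<eta>' \<and> lifts p g (a \<cdot> h) h' \<eta>')"

text \<open>A solved problem stays solved further along the sequence. The 2-cell \<open>s\<close> accounts for the fact that
composites are only preserved up to isomorphism, and \<open>coh\<close> is the compatibility of the comparisons
of structure maps with \<open>s\<close>.\<close>

lemma solves_comp:
  assumes sol: "solves a \<pi> p2 (g, h, h', \<eta>)"
    and arr: "p1 \<in> hom1 C Z1 Y" "p2 \<in> hom1 C Z2 Y" "p3 \<in> hom1 C Z3 Y"
      "a \<in> hom1 C Z1 Z2" "b \<in> hom1 C Z2 Z3" "c \<in> hom1 C Z1 Z3"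
      "g \<in> Arr C" "h \<in> hom1 C (Src C g) Z1" "h' \<in> hom1 C (Tgt C g) Y"
    and cells: "\<pi> \<in> hom2 C (p2 \<cdot> a) p1" "\<rho> \<in> hom2 C (p3 \<cdot> b) p2" "\<tau> \<in> hom2 C (p3 \<cdot> c) p1"
      "s \<in> hom2 C (b \<cdot> a) c"
    and coh: "\<tau> \<odot> lwhisker C p3 s = \<pi> \<odot> rwhisker C \<rho> a"
  shows "solves c \<tau> p3 (g, h, h', \<eta>)"
proof -
  obtain \<eta>' where \<eta>': "\<eta>' \<in> hom2 C (h' \<cdot> g) (p2 \<cdot> (a \<cdot> h))" and \<eta>: "\<eta> = rwhisker C \<pi> h \<odot> \<eta>'"
    and l: "lifts p2 g (a \<cdot> h) h' \<eta>'"
    using sol unfolding solves_def by auto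
  note [simp] = arr[unfolded hom1_def mem_Collect_eq] cells[unfolded hom2_def mem_Collect_eq]
    \<eta>'[unfolded hom2_def mem_Collect_eq]
  define \<eta>2 where "\<eta>2 = inv2 (rwhisker C \<rho> (a \<cdot> h)) \<odot> \<eta>'"
  have \<eta>2: "\<eta>2 \<in> hom2 C (h' \<cdot> g) (p3 \<cdot> (b \<cdot> (a \<cdot> h)))" and \<eta>2': "rwhisker C \<rho> (a \<cdot> h) \<odot> \<eta>2 = \<eta>'"
    by (simp_all add: \<eta>2_def hom2_def)
  note [simp] = \<eta>2[unfolded hom2_def mem_Collect_eq]
  have ah: "a \<cdot> h \<in> hom1 C (Src C g) Z2"
    by (simp add: hom1_def)
  have "lifts p3 g (b \<cdot> (a \<cdot> h)) h' \<eta>2"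
    using l lifts_comp[OF _ arr(2,3,5,7) ah arr(9) cells(2) \<eta>2] \<eta>2' by simp
  then have "lifts p3 g (c \<cdot> h) h' (lwhisker C p3 (rwhisker C s h) \<odot> \<eta>2)"
    by (rule lifts_iso) (simp_all add: hom1_def hom2_def)
  moreover have "\<eta> = rwhisker C \<tau> h \<odot> (lwhisker C p3 (rwhisker C s h) \<odot> \<eta>2)"
  proof -
    have "rwhisker C \<tau> h \<odot> (lwhisker C p3 (rwhisker C s h) \<odot> \<eta>2) =
        rwhisker C (\<tau> \<odot> lwhisker C p3 s) h \<odot> \<eta>2"
      by simp
    also have "\<dots> = rwhisker C \<pi> h \<odot> (rwhisker C \<rho> (a \<cdot> h) \<odot> \<eta>2)"
      unfolding coh by simp
    finally show ?thesis
      unfolding \<eta>2' \<eta> by simp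
  qed
  moreover have "lwhisker C p3 (rwhisker C s h) \<odot> \<eta>2 \<in> hom2 C (h' \<cdot> g) (p3 \<cdot> (c \<cdot> h))"
    by (simp add: hom2_def)
  ultimately show ?thesis
    unfolding solves_def by blast
qed

text \<open>To solve a problem of an earlier object it suffices to solve its transport along \<open>a\<close>. This lets one
attach a cell to the current object in order to solve a problem of an earlier one.\<close>

lemma solves_precomp:
  assumes sol: "solves b \<rho> p3 (g, a \<cdot> h, h', \<eta>1)"
    and arr: "p1 \<in> hom1 C Z1 Y" "p2 \<in> hom1 C Z2 Y" "p3 \<in> hom1 C Z3 Y"
      "a \<in> hom1 C Z1 Z2" "b \<in> hom1 C Z2 Z3"
      "g \<in> Arr C" "h \<in> hom1 C (Src C g) Z1" "h' \<in> hom1 C (Tgt C g) Y"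
    and cells: "\<pi> \<in> hom2 C (p2 \<cdot> a) p1" "\<rho> \<in> hom2 C (p3 \<cdot> b) p2"
  shows "solves (b \<cdot> a) (\<pi> \<odot> rwhisker C \<rho> a) p3 (g, h, h', rwhisker C \<pi> h \<odot> \<eta>1)"
proof -
  obtain \<eta>' where \<eta>': "\<eta>' \<in> hom2 C (h' \<cdot> g) (p3 \<cdot> (b \<cdot> (a \<cdot> h)))"
    and \<eta>1: "\<eta>1 = rwhisker C \<rho> (a \<cdot> h) \<odot> \<eta>'" and l: "lifts p3 g (b \<cdot> (a \<cdot> h)) h' \<eta>'"
    using sol unfolding solves_def by auto
  note [simp] = arr[unfolded hom1_def mem_Collect_eq] cells[unfolded hom2_def mem_Collect_eq]
    \<eta>'[unfolded hom2_def mem_Collect_eq]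
  show ?thesis
    unfolding solves_def case_prod_conv
  proof (intro bexI conjI)
    show "lifts p3 g ((b \<cdot> a) \<cdot> h) h' \<eta>'"
      using l by simp
    show "rwhisker C \<pi> h \<odot> \<eta>1 = rwhisker C (\<pi> \<odot> rwhisker C \<rho> a) h \<odot> \<eta>'"
      unfolding \<eta>1 by simp
    show "\<eta>' \<in> hom2 C (h' \<cdot> g) (p3 \<cdot> ((b \<cdot> a) \<cdot> h))"
      by (simp add: hom2_def)
  qed
qed

text \<open>If the problem \<open>h2\<close> is, up to the 2-cell \<open>\<omega>\<close>, the image of a problem \<open>h\<close> of an earlier object, then a
solution of the latter is a lift of the former.\<close>

lemma lifts_of_solves:
  assumes sol: "solves a \<pi> p2 (g, h, h', rwhisker C \<pi> h \<odot> (lwhisker C p2 (inv2 \<omega>) \<odot> \<eta>))"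
    and arr: "p1 \<in> hom1 C Z1 Y" "p2 \<in> hom1 C Z2 Y" "a \<in> hom1 C Z1 Z2"
      "g \<in> Arr C" "h \<in> hom1 C (Src C g) Z1" "h' \<in> hom1 C (Tgt C g) Y" "h2 \<in> hom1 C (Src C g) Z2"
    and cells: "\<pi> \<in> hom2 C (p2 \<cdot> a) p1" "\<omega> \<in> hom2 C (a \<cdot> h) h2" "\<eta> \<in> hom2 C (h' \<cdot> g) (p2 \<cdot> h2)"
  shows "lifts p2 g h2 h' \<eta>"
proof -
  obtain \<eta>' where \<eta>': "\<eta>' \<in> hom2 C (h' \<cdot> g) (p2 \<cdot> (a \<cdot> h))"
    and eq: "rwhisker C \<pi> h \<odot> (lwhisker C p2 (inv2 \<omega>) \<odot> \<eta>) = rwhisker C \<pi> h \<odot> \<eta>'"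
    and l: "lifts p2 g (a \<cdot> h) h' \<eta>'"
    using sol unfolding solves_def by auto
  note [simp] = arr[unfolded hom1_def mem_Collect_eq] cells[unfolded hom2_def mem_Collect_eq]
    \<eta>'[unfolded hom2_def mem_Collect_eq]
  have e: "lwhisker C p2 (inv2 \<omega>) \<odot> \<eta> = \<eta>'"
    by (rule vcomp_cancel_left[OF eq]) simp_all
  have "lifts p2 g h2 h' (lwhisker C p2 \<omega> \<odot> \<eta>')"
    using l by (rule lifts_iso) (simp_all add: hom1_def hom2_def)
  moreover have "lwhisker C p2 \<omega> \<odot> \<eta>' = \<eta>"
    unfolding e[symmetric] by simp
  ultimately show ?thesis
    by simp
qed

text \<open>The two sides of the problem \<open>(h', p, \<eta>)\<close> form a cocone on the span of \<open>g\<close> and \<open>h\<close>, and the induced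
1-cell \<open>p'\<close> is the structure map of the pushout. The other leg of the pushout is the lift.\<close>

lemma pushout_solves:
  assumes arr: "g \<in> Arr C" "h \<in> hom1 C (Src C g) Z" "p \<in> hom1 C Z Y" "h' \<in> hom1 C (Tgt C g) Y"
    and \<eta>: "\<eta> \<in> hom2 C (h' \<cdot> g) (p \<cdot> h)" and K: "is_hocolim C (span_diagram C g h) K"
  shows "\<exists>p' \<psi>. leg K Foot2 \<in> hom1 C Z (apex K) \<and> p' \<in> hom1 C (apex K) Y \<and>
    \<psi> \<in> hom2 C (p' \<cdot> leg K Foot2) p \<and> solves (leg K Foot2) \<psi> p' (g, h, h', \<eta>)"
proof -
  note [simp] = arr[unfolded hom1_def mem_Collect_eq] \<eta>[unfolded hom2_def mem_Collect_eq]
  let ?L = "\<lparr>apex = Y, leg = case_span_vertex (p \<cdot> h) h' p, legcell = case_span_edge \<eta> (Id2 C (p \<cdot> h))\<rparr>"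
  have YO: "Y \<in> Obj C"
    using arr_obj(2)[of p] by simp
  have "is_cocone C (span_diagram C g h) ?L"
    using YO by (auto simp: is_cocone_def span_diagram_def hom1_def hom2_def
        split: span_edge.split span_vertex.split)
  then obtain p' \<psi> where F: "is_factorization C (span_diagram C g h) K ?L p' \<psi>"
    using hocolimD(3)[OF K] by blast
  let ?u = "leg K Foot2" and ?k = "leg K Foot1" and ?q = "leg K Peak"
    and ?l1 = "legcell K Leg1" and ?l2 = "legcell K Leg2"
  have legs: "leg K v \<in> hom1 C (dob (span_diagram C g h) v) (apex K)" for v
    using hocolimD(2)[OF K] by (simp add: is_cocone_def span_diagram_def)
  have lc: "legcell K e \<in> hom2 C (leg K (etgt (span_diagram C g h) e) \<cdot> dar (span_diagram C g h) e) ?q" for e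
    using hocolimD(2)[OF K] by (simp add: is_cocone_def span_diagram_def)
  have u [simp]: "?u \<in> Arr C" "Src C ?u = Z" "Tgt C ?u = apex K"
    and k [simp]: "?k \<in> Arr C" "Src C ?k = Tgt C g" "Tgt C ?k = apex K"
    and q [simp]: "?q \<in> Arr C" "Src C ?q = Src C g" "Tgt C ?q = apex K"
    using legs[of Foot2] legs[of Foot1] legs[of Peak] by (simp_all add: span_diagram_def hom1_def)
  have l1 [simp]: "?l1 \<in> Cell C" "Dom C ?l1 = ?k \<cdot> g" "Cod C ?l1 = ?q"
    and l2 [simp]: "?l2 \<in> Cell C" "Dom C ?l2 = ?u \<cdot> h" "Cod C ?l2 = ?q"
    using lc[of Leg1] lc[of Leg2] by (simp_all add: span_diagram_def hom2_def)
  have p' [simp]: "p' \<in> Arr C" "Src C p' = apex K" "Tgt C p' = Y"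
    using F by (simp_all add: is_factorization_def hom1_def)
  have psi: "\<psi> v \<in> hom2 C (p' \<cdot> leg K v) (leg ?L v)" for v
    using F by (simp add: is_factorization_def span_diagram_def)
  have ps [simp]: "\<psi> Foot2 \<in> Cell C" "Dom C (\<psi> Foot2) = p' \<cdot> ?u" "Cod C (\<psi> Foot2) = p"
    "\<psi> Foot1 \<in> Cell C" "Dom C (\<psi> Foot1) = p' \<cdot> ?k" "Cod C (\<psi> Foot1) = h'"
    "\<psi> Peak \<in> Cell C" "Dom C (\<psi> Peak) = p' \<cdot> ?q" "Cod C (\<psi> Peak) = p \<cdot> h"
    using psi[of Foot2] psi[of Foot1] psi[of Peak] by (simp_all add: hom2_def)
  have e: "\<psi> Peak \<odot> lwhisker C p' (legcell K e) = legcell ?L e \<odot>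
      rwhisker C (\<psi> (etgt (span_diagram C g h) e)) (dar (span_diagram C g h) e)" for e
    using F by (simp add: is_factorization_def span_diagram_def)
  have e1: "\<psi> Peak \<odot> lwhisker C p' ?l1 = \<eta> \<odot> rwhisker C (\<psi> Foot1) g"
    using e[of Leg1] by (simp add: span_diagram_def)
  have e2: "\<psi> Peak \<odot> lwhisker C p' ?l2 = rwhisker C (\<psi> Foot2) h"
    using e[of Leg2] by (simp add: span_diagram_def)
  let ?\<nu>1 = "inv2 ?l2 \<odot> ?l1" and ?\<nu>2 = "inv2 (\<psi> Foot1)"
  let ?\<eta>' = "lwhisker C p' ?\<nu>1 \<odot> rwhisker C ?\<nu>2 g"
  have "rwhisker C (\<psi> Foot2) h \<odot> ?\<eta>' =
      (\<psi> Peak \<odot> lwhisker C p' ?l1) \<odot> inv2 (rwhisker C (\<psi> Foot1) g)"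
    unfolding e2[symmetric] by simp
  also have "\<dots> = \<eta>"
    unfolding e1 by simp
  finally have eq: "\<eta> = rwhisker C (\<psi> Foot2) h \<odot> ?\<eta>'"
    by simp
  have "lifts p' g (?u \<cdot> h) h' ?\<eta>'"
    unfolding lifts_def
  proof (intro bexI)
    show "?\<nu>2 \<in> hom2 C h' (p' \<cdot> ?k)" "?\<nu>1 \<in> hom2 C (?k \<cdot> g) (?u \<cdot> h)" "?k \<in> hom1 C (Tgt C g) (Src C p')"
      by (simp_all add: hom1_def hom2_def)
  qed (rule refl)
  moreover have "?\<eta>' \<in> hom2 C (h' \<cdot> g) (p' \<cdot> (?u \<cdot> h))"
    by (simp add: hom2_def)
  ultimately have "solves ?u (\<psi> Foot2) p' (g, h, h', \<eta>)"
    unfolding solves_def case_prod_conv using eq by blast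
  then show ?thesis
    by (intro exI[of _ p'] exI[of _ "\<psi> Foot2"]) (simp add: hom1_def hom2_def)
qed

end

context cocomplete_21_category
begin

lemma small_problems:
  assumes "I \<subseteq> Arr C" "small \<kappa> I" "p \<in> Arr C"
  shows "small \<kappa> (problems I p)"
proof -
  have "problems I p \<subseteq> (SIGMA g : I. SIGMA h : hom1 C (Src C g) (Src C p).
      SIGMA h' : hom1 C (Tgt C g) (Tgt C p). hom2 C (h' \<cdot> g) (p \<cdot> h))"
    by (auto simp: problems_def)
  moreover have "small \<kappa> \<dots>"
  proof (intro small_Sigma)
    fix g h h' assume g: "g \<in> I" and h: "h \<in> hom1 C (Src C g) (Src C p)"
      and h': "h' \<in> hom1 C (Tgt C g) (Tgt C p)"
    have "h' \<cdot> g \<in> hom1 C (Src C g) (Tgt C p)" "p \<cdot> h \<in> hom1 C (Src C g) (Tgt C p)"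
      using g h h' assms by (auto simp: hom1_def)
    moreover have "Src C g \<in> Obj C" "Tgt C p \<in> Obj C"
      using g assms by auto
    ultimately show "small \<kappa> (hom2 C (h' \<cdot> g) (p \<cdot> h))"
      using locally_small unfolding locally_small_def by blast
  qed (use assms locally_small in \<open>auto simp: locally_small_def\<close>)
  ultimately show ?thesis
    by (rule small_subset[rotated])
qed

end

section \<open>Homotopy colimits of groupoids are covered by their legs\<close>

lemma is_groupoidD:
  assumes "is_groupoid G"
  shows "a \<in> garr G \<Longrightarrow> gdom G a \<in> gobj G" "a \<in> garr G \<Longrightarrow> gcod G a \<in> gobj G"
    "x \<in> gobj G \<Longrightarrow> gid G x \<in> ghom G x x"
    "a \<in> ghom G x y \<Longrightarrow> b \<in> ghom G y z \<Longrightarrow> gcomp G b a \<in> ghom G x z"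
    "a \<in> ghom G x y \<Longrightarrow> \<exists>b. b \<in> ghom G y x"
proof -
  note G = assms[unfolded is_groupoid_def]
  show "a \<in> garr G \<Longrightarrow> gdom G a \<in> gobj G" "a \<in> garr G \<Longrightarrow> gcod G a \<in> gobj G"
    "x \<in> gobj G \<Longrightarrow> gid G x \<in> ghom G x x"
    using G by simp_all
  show "a \<in> ghom G x y \<Longrightarrow> b \<in> ghom G y z \<Longrightarrow> gcomp G b a \<in> ghom G x z"
    using G[THEN conjunct2, THEN conjunct2, THEN conjunct1] by blast
  show "a \<in> ghom G x y \<Longrightarrow> \<exists>b. b \<in> ghom G y x"
    using G[THEN conjunct2, THEN conjunct2, THEN conjunct2, THEN conjunct2, THEN conjunct2] by blast
qed

text \<open>The test object is the groupoid with one object and two arrows, the identity \<open>b0\<close> and the involution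
\<open>b1\<close>. A constant functor to it has as endomorphisms the locally constant sign functions on its
domain, so that full subgroupoids can be detected by 2-cells.\<close>

locale sign_group =
  fixes a0 :: 'a and b0 b1 :: 'b
  assumes distinct: "b0 \<noteq> b1"
begin

definition sign_gpd :: "('a, 'b) groupoid" where
  "sign_gpd = \<lparr>gobj = {a0}, garr = {b0, b1}, gdom = (\<lambda>_. a0), gcod = (\<lambda>_. a0), gid = (\<lambda>_. b0),
     gcomp = (\<lambda>x y. if x = y then b0 else b1)\<rparr>"

definition const_functor :: "('a, 'b) groupoid \<Rightarrow> ('a, 'b) gfunctor" where
  "const_functor H = \<lparr>fsrc = H, ftgt = sign_gpd, fobj = (\<lambda>x \<in> gobj H. a0), farr = (\<lambda>a \<in> garr H. b0)\<rparr>"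

text \<open>For a sign function \<open>s\<close>, an endomorphism of the constant functor, natural if \<open>s\<close> is locally constant.\<close>

definition sign_trans :: "('a, 'b) groupoid \<Rightarrow> ('a \<Rightarrow> 'b) \<Rightarrow> ('a, 'b) gtrans" where
  "sign_trans H s = \<lparr>nsrc = const_functor H, ntgt = const_functor H, ncmp = (\<lambda>x \<in> gobj H. s x)\<rparr>"

lemma groupoid_B: "is_groupoid sign_gpd"
  unfolding is_groupoid_def ghom_def sign_gpd_def using distinct by auto

lemma gfunctor_cst: "is_groupoid H \<Longrightarrow> is_gfunctor (const_functor H)"
  unfolding is_gfunctor_def const_functor_def by (auto simp: sign_gpd_def ghom_def is_groupoid_def)

lemma gfcomp_cst:
  assumes F: "is_gfunctor F" "ftgt F = G"
  shows "gfcomp (const_functor G) F = const_functor (fsrc F)"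
proof -
  have "fobj F x \<in> gobj G" if "x \<in> gobj (fsrc F)" for x
    using F that by (auto simp: is_gfunctor_def)
  moreover have "farr F a \<in> garr G" if "a \<in> garr (fsrc F)" for a
    using F that by (auto simp: is_gfunctor_def)
  ultimately show ?thesis
    unfolding gfcomp_def const_functor_def by (auto intro!: restrict_ext)
qed

lemma tr_cong: "(\<And>x. x \<in> gobj H \<Longrightarrow> s x = s' x) \<Longrightarrow> sign_trans H s = sign_trans H s'"
  unfolding sign_trans_def by (auto intro!: restrict_ext)

lemma VComp_tr: "sign_trans H s \<odot>\<^bsub>Gpd \<kappa>\<^esub> sign_trans H s' = sign_trans H (\<lambda>x. if s x = s' x then b0 else b1)"
  unfolding Gpd_def sign_trans_def by (auto simp: const_functor_def sign_gpd_def intro!: restrict_ext)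

lemma rwhisker_tr:
  assumes F: "is_gfunctor F" "ftgt F = G" and s: "\<And>x. s x \<in> {b0, b1}" and G: "is_groupoid G"
  shows "rwhisker (Gpd \<kappa>) (sign_trans G s) F = sign_trans (fsrc F) (\<lambda>x. s (fobj F x))"
proof -
  have o: "fobj F x \<in> gobj G" if "x \<in> gobj (fsrc F)" for x
    using F that by (auto simp: is_gfunctor_def)
  have a: "gid G (fobj F x) \<in> garr G" if "x \<in> gobj (fsrc F)" for x
    using is_groupoidD(3)[OF G o[OF that]] by (simp add: ghom_def)
  have eq: "(if s y = b0 then b0 else b1) = s y" for y
    using s[of y] by auto
  show ?thesis
    unfolding rwhisker_def Gpd_def sign_trans_def
    using o a F gfcomp_cst[OF F] by (auto simp: eq const_functor_def sign_gpd_def intro!: restrict_ext)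
qed

lemma lwhisker_cst:
  assumes \<alpha>: "is_gtrans \<alpha>" "is_gfunctor (nsrc \<alpha>)" "is_gfunctor (ntgt \<alpha>)" and G: "ftgt (nsrc \<alpha>) = G"
  shows "lwhisker (Gpd \<kappa>) (const_functor G) \<alpha> = sign_trans (fsrc (nsrc \<alpha>)) (\<lambda>_. b0)"
proof -
  have s: "fsrc (ntgt \<alpha>) = fsrc (nsrc \<alpha>)" "ftgt (ntgt \<alpha>) = G"
    using \<alpha> G by (auto simp: is_gtrans_def)
  have o: "fobj (ntgt \<alpha>) x \<in> gobj G" if "x \<in> gobj (fsrc (nsrc \<alpha>))" for x
    using \<alpha>(3) that s unfolding is_gfunctor_def by auto
  have a: "ncmp \<alpha> x \<in> garr G" if "x \<in> gobj (fsrc (nsrc \<alpha>))" for x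
    using \<alpha>(1) that G unfolding is_gtrans_def ghom_def by auto
  show ?thesis
    unfolding lwhisker_def Gpd_def sign_trans_def
    using o a s gfcomp_cst[OF \<alpha>(2) G] gfcomp_cst[OF \<alpha>(3) s(2)]
    by (auto simp: const_functor_def sign_gpd_def intro!: restrict_ext)
qed

end

text \<open>Let \<open>E\<close> consist of the objects of the colimit that are isomorphic to an object in the image of a leg.
The sign function that is \<open>b1\<close> precisely off \<open>E\<close> is locally constant and trivial on the image of every
leg, as is the trivial sign function. By the uniqueness of 2-cells between factorizations the two
functions agree, so that \<open>E\<close> contains every object.\<close>

lemma Gpd_hocolim_covered:
  fixes D :: "('v, 'e, 't, ('a, 'b) groupoid, ('a, 'b) gfunctor, ('a, 'b) gtrans) diagram"
  assumes \<kappa>: "inaccessible \<kappa>" and two: "(b0 :: 'b) \<noteq> b1" and K: "is_hocolim (Gpd \<kappa>) D K"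
    and y: "y \<in> gobj (apex K)"
  shows "\<exists>v \<in> verts D. \<exists>w \<in> gobj (dob D v). \<exists>a. a \<in> ghom (apex K) (fobj (leg K v) w) y"
proof -
  interpret inaccessible_cardinal \<kappa>
    by unfold_locales (rule \<kappa>)
  interpret sign_group "undefined :: 'a" b0 b1
    by unfold_locales (rule two)
  let ?G = "apex K"
  have grp: "is_groupoid H \<and> small \<kappa> (gobj H) \<and> small \<kappa> (garr H) \<longleftrightarrow> H \<in> Obj (Gpd \<kappa>)" for H :: "('a, 'b) groupoid"
    by (simp add: Gpd_def small_groupoids_def)
  have arr: "is_gfunctor F \<and> fsrc F \<in> Obj (Gpd \<kappa>) \<and> ftgt F \<in> Obj (Gpd \<kappa>) \<longleftrightarrow> F \<in> Arr (Gpd \<kappa>)" for F :: "('a, 'b) gfunctor"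
    by (auto simp: Gpd_def small_gfunctors_def)
  have hom1: "F \<in> hom1 (Gpd \<kappa>) G H \<longleftrightarrow> F \<in> Arr (Gpd \<kappa>) \<and> fsrc F = G \<and> ftgt F = H"
    for F :: "('a, 'b) gfunctor" and G H
    by (auto simp: Gpd_def hom1_def)
  have hom2: "\<alpha> \<in> hom2 (Gpd \<kappa>) F F' \<longleftrightarrow> is_gtrans \<alpha> \<and> F \<in> Arr (Gpd \<kappa>) \<and> F' \<in> Arr (Gpd \<kappa>) \<and> nsrc \<alpha> = F \<and> ntgt \<alpha> = F'"
    for \<alpha> :: "('a, 'b) gtrans" and F F'
    by (auto simp: Gpd_def hom2_def)
  have comp: "F' \<cdot>\<^bsub>Gpd \<kappa>\<^esub> F = gfcomp F' F" for F F' :: "('a, 'b) gfunctor"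
    by (simp add: Gpd_def)
  have D: "is_diagram (Gpd \<kappa>) D" and KK: "is_cocone (Gpd \<kappa>) D K"
    using hocolimD(1,2)[OF K] by blast+
  have sign_gpd: "sign_gpd \<in> Obj (Gpd \<kappa>)"
    using groupoid_B by (auto simp: grp[symmetric] sign_gpd_def intro!: small_finite)
  have const_functor: "const_functor H \<in> Arr (Gpd \<kappa>)" "fsrc (const_functor H) = H" "ftgt (const_functor H) = sign_gpd" if "H \<in> Obj (Gpd \<kappa>)" for H
    using that sign_gpd gfunctor_cst[of H] by (auto simp: arr[symmetric] grp[symmetric] const_functor_def)
  have gt: "is_gtrans (sign_trans H (\<lambda>_. b0))" if "H \<in> Obj (Gpd \<kappa>)" for H
  proof -
    have "is_groupoid H"
      using that grp by blast
    then show ?thesis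
      by (auto simp: is_gtrans_def sign_trans_def const_functor_def sign_gpd_def ghom_def is_groupoid_def)
  qed
  have ends: "nsrc (sign_trans H s) = const_functor H" "ntgt (sign_trans H s) = const_functor H" for H s
    by (simp_all add: sign_trans_def)
  have tr0: "sign_trans H (\<lambda>_. b0) \<in> hom2 (Gpd \<kappa>) (const_functor H) (const_functor H)" if "H \<in> Obj (Gpd \<kappa>)" for H
    using that gt const_functor ends by (simp add: hom2)
  have obj: "dob D v \<in> Obj (Gpd \<kappa>)" if "v \<in> verts D" for v
    using D that by (simp add: is_diagram_def)
  have G: "?G \<in> Obj (Gpd \<kappa>)"
    using KK by (simp add: is_cocone_def)
  have edge: "is_gfunctor (dar D e)" "fsrc (dar D e) = dob D (esrc D e)" "ftgt (dar D e) = dob D (etgt D e)"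
      "esrc D e \<in> verts D" "etgt D e \<in> verts D" if "e \<in> edges D" for e
    using D that by (auto simp: is_diagram_def hom1 arr[symmetric])
  have leg: "is_gfunctor (leg K v)" "fsrc (leg K v) = dob D v" "ftgt (leg K v) = ?G" if "v \<in> verts D" for v
    using KK that by (auto simp: is_cocone_def hom1 arr[symmetric])
  have cell: "is_gtrans \<alpha>" "is_gfunctor (nsrc \<alpha>)" "is_gfunctor (ntgt \<alpha>)" "nsrc \<alpha> = F"
    if "\<alpha> \<in> hom2 (Gpd \<kappa>) F F'" for \<alpha> :: "('a, 'b) gtrans" and F F'
    using that by (auto simp: hom2 arr[symmetric])
  define K' :: "('v, 'e, ('a, 'b) groupoid, ('a, 'b) gfunctor, ('a, 'b) gtrans) cocone" where
    "K' = \<lparr>apex = sign_gpd, leg = (\<lambda>v. const_functor (dob D v)), legcell = (\<lambda>e. sign_trans (dob D (esrc D e)) (\<lambda>_. b0))\<rparr>"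
  have rw: "rwhisker (Gpd \<kappa>) (sign_trans (ftgt F) (\<lambda>_. b0)) F = sign_trans (fsrc F) (\<lambda>_. b0)"
    if "is_gfunctor F" "ftgt F \<in> Obj (Gpd \<kappa>)" for F
    using rwhisker_tr[OF that(1) refl, of "\<lambda>_. b0"] that grp by blast
  have K': "is_cocone (Gpd \<kappa>) D K'"
    unfolding is_cocone_def
  proof (intro conjI ballI)
    show "apex K' \<in> Obj (Gpd \<kappa>)"
      using sign_gpd by (simp add: K'_def)
    show "leg K' v \<in> hom1 (Gpd \<kappa>) (dob D v) (apex K')" if "v \<in> verts D" for v
      using const_functor obj[OF that] by (simp add: K'_def hom1)
    show "legcell K' e \<in> hom2 (Gpd \<kappa>) (leg K' (etgt D e) \<cdot>\<^bsub>Gpd \<kappa>\<^esub> dar D e) (leg K' (esrc D e))"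
      if "e \<in> edges D" for e
      using gfcomp_cst[OF edge(1,3)[OF that]] edge[OF that] tr0 obj by (simp add: K'_def comp)
    fix t assume t: "t \<in> tris D"
    then have tt: "tri1 D t \<in> edges D" "tri2 D t \<in> edges D" "tri3 D t \<in> edges D"
        "etgt D (tri1 D t) = esrc D (tri2 D t)" "esrc D (tri3 D t) = esrc D (tri1 D t)"
        "etgt D (tri3 D t) = etgt D (tri2 D t)"
        "dcell D t \<in> hom2 (Gpd \<kappa>) (gfcomp (dar D (tri2 D t)) (dar D (tri1 D t))) (dar D (tri3 D t))"
      using D by (simp_all add: is_diagram_def comp)
    note c = cell[OF tt(7)]
    have ft: "ftgt (nsrc (dcell D t)) = dob D (etgt D (tri2 D t))" "fsrc (nsrc (dcell D t)) = dob D (esrc D (tri1 D t))"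
      unfolding c(4) using edge tt by (simp_all add: gfcomp_def)
    have "lwhisker (Gpd \<kappa>) (const_functor (dob D (etgt D (tri2 D t)))) (dcell D t) = sign_trans (dob D (esrc D (tri1 D t))) (\<lambda>_. b0)"
      using lwhisker_cst[OF c(1-3) ft(1)] ft(2) by simp
    moreover have "rwhisker (Gpd \<kappa>) (sign_trans (dob D (esrc D (tri2 D t))) (\<lambda>_. b0)) (dar D (tri1 D t)) =
        sign_trans (dob D (esrc D (tri1 D t))) (\<lambda>_. b0)"
      using rw[OF edge(1)[OF tt(1)]] edge[OF tt(1)] obj tt(4) by simp
    ultimately show "legcell K' (tri3 D t) \<odot>\<^bsub>Gpd \<kappa>\<^esub> lwhisker (Gpd \<kappa>) (leg K' (etgt D (tri2 D t))) (dcell D t) =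
        legcell K' (tri1 D t) \<odot>\<^bsub>Gpd \<kappa>\<^esub> rwhisker (Gpd \<kappa>) (legcell K' (tri2 D t)) (dar D (tri1 D t))"
      using tt(5) by (simp add: K'_def)
  qed
  let ?\<psi> = "\<lambda>v. sign_trans (dob D v) (\<lambda>_. b0)"
  have F: "is_factorization (Gpd \<kappa>) D K K' (const_functor ?G) ?\<psi>"
    unfolding is_factorization_def
  proof (intro conjI ballI)
    show "const_functor ?G \<in> hom1 (Gpd \<kappa>) ?G (apex K')"
      using const_functor G by (simp add: hom1 K'_def)
    show "?\<psi> v \<in> hom2 (Gpd \<kappa>) (const_functor ?G \<cdot>\<^bsub>Gpd \<kappa>\<^esub> leg K v) (leg K' v)" if "v \<in> verts D" for v
      using gfcomp_cst[OF leg(1,3)[OF that]] leg(2)[OF that] tr0 obj that by (simp add: comp K'_def)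
    fix e assume e: "e \<in> edges D"
    have "legcell K e \<in> hom2 (Gpd \<kappa>) (gfcomp (leg K (etgt D e)) (dar D e)) (leg K (esrc D e))"
      using KK e by (simp add: is_cocone_def comp)
    note c = cell[OF this]
    have ft: "ftgt (nsrc (legcell K e)) = ?G" "fsrc (nsrc (legcell K e)) = dob D (esrc D e)"
      unfolding c(4) using edge[OF e] leg by (simp_all add: gfcomp_def)
    have "lwhisker (Gpd \<kappa>) (const_functor ?G) (legcell K e) = sign_trans (dob D (esrc D e)) (\<lambda>_. b0)"
      using lwhisker_cst[OF c(1-3) ft(1)] ft(2) by simp
    moreover have "rwhisker (Gpd \<kappa>) (sign_trans (dob D (etgt D e)) (\<lambda>_. b0)) (dar D e) = sign_trans (dob D (esrc D e)) (\<lambda>_. b0)"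
      using rw[OF edge(1)[OF e]] edge[OF e] obj by simp
    ultimately show "?\<psi> (esrc D e) \<odot>\<^bsub>Gpd \<kappa>\<^esub> lwhisker (Gpd \<kappa>) (const_functor ?G) (legcell K e) =
        legcell K' e \<odot>\<^bsub>Gpd \<kappa>\<^esub> rwhisker (Gpd \<kappa>) (?\<psi> (etgt D e)) (dar D e)"
      by (simp add: K'_def)
  qed
  define E where "E = {y. \<exists>v \<in> verts D. \<exists>w \<in> gobj (dob D v). \<exists>a. a \<in> ghom ?G (fobj (leg K v) w) y}"
  define s where "s y = (if y \<in> E then b0 else b1)" for y
  have GG: "is_groupoid ?G"
    using G grp by blast
  have E_iso: "y' \<in> E" if "y \<in> E" "a \<in> ghom ?G y y'" for y y' a
    using that is_groupoidD(4)[OF GG] unfolding E_def by blast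
  have E_iff: "y \<in> E \<longleftrightarrow> y' \<in> E" if a: "a \<in> ghom ?G y y'" for y y' a
    using E_iso a is_groupoidD(5)[OF GG a] by blast
  have E_leg: "fobj (leg K v) w \<in> E" if "v \<in> verts D" "w \<in> gobj (dob D v)" for v w
  proof -
    have "fobj (leg K v) w \<in> gobj ?G"
      using leg[OF that(1)] that(2) unfolding is_gfunctor_def by auto
    then show ?thesis
      unfolding E_def using that is_groupoidD(3)[OF GG] by blast
  qed
  have "is_gtrans (sign_trans ?G s)"
    unfolding is_gtrans_def
  proof (intro conjI allI impI)
    fix x y a assume "a \<in> ghom (fsrc (nsrc (sign_trans ?G s))) x y"
    then have a: "a \<in> ghom ?G x y"
      by (simp add: sign_trans_def const_functor_def)
    then have "x \<in> gobj ?G" "y \<in> gobj ?G" "a \<in> garr ?G"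
      using GG by (auto simp: ghom_def is_groupoid_def)
    moreover have "s x = s y"
      using E_iff[OF a] by (simp add: s_def)
    ultimately show "gcomp (ftgt (nsrc (sign_trans ?G s))) (ncmp (sign_trans ?G s) y) (farr (nsrc (sign_trans ?G s)) a) =
        gcomp (ftgt (nsrc (sign_trans ?G s))) (farr (ntgt (sign_trans ?G s)) a) (ncmp (sign_trans ?G s) x)"
      by (simp add: sign_trans_def const_functor_def sign_gpd_def)
  qed (auto simp: sign_trans_def const_functor_def sign_gpd_def ghom_def s_def)
  then have tr1: "sign_trans ?G s \<in> hom2 (Gpd \<kappa>) (const_functor ?G) (const_functor ?G)"
    using G const_functor by (simp add: hom2 ends)
  have ok: "?\<psi> v \<odot>\<^bsub>Gpd \<kappa>\<^esub> rwhisker (Gpd \<kappa>) (sign_trans ?G s') (leg K v) = ?\<psi> v"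
    if "v \<in> verts D" "\<And>x. s' x \<in> {b0, b1}" "\<And>w. w \<in> gobj (dob D v) \<Longrightarrow> s' (fobj (leg K v) w) = b0" for v s'
  proof -
    have "rwhisker (Gpd \<kappa>) (sign_trans ?G s') (leg K v) = sign_trans (fsrc (leg K v)) (\<lambda>x. s' (fobj (leg K v) x))"
      by (rule rwhisker_tr[where G = ?G and s = s']) (use leg[OF that(1)] that(2) GG in simp_all)
    also have "\<dots> = sign_trans (dob D v) (\<lambda>_. b0)"
      unfolding leg(2)[OF that(1)] by (rule tr_cong) (rule that(3))
    finally show ?thesis
      by (simp add: VComp_tr)
  qed
  have "sign_trans ?G s = sign_trans ?G (\<lambda>_. b0)"
  proof -
    have "\<forall>v \<in> verts D. ?\<psi> v \<odot>\<^bsub>Gpd \<kappa>\<^esub> rwhisker (Gpd \<kappa>) (sign_trans ?G s) (leg K v) = ?\<psi> v"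
      using E_leg by (intro ballI ok) (auto simp: s_def)
    moreover have "\<forall>v \<in> verts D. ?\<psi> v \<odot>\<^bsub>Gpd \<kappa>\<^esub> rwhisker (Gpd \<kappa>) (sign_trans ?G (\<lambda>_. b0)) (leg K v) = ?\<psi> v"
      by (intro ballI ok) auto
    ultimately show ?thesis
      using hocolimD(4)[OF K K' F F] tr1 tr0[OF G] by blast
  qed
  then have "ncmp (sign_trans ?G s) y = ncmp (sign_trans ?G (\<lambda>_. b0)) y"
    by simp
  then have "y \<in> E"
    using y distinct by (simp add: sign_trans_def s_def split: if_splits)
  then show ?thesis
    by (simp add: E_def)
qed

text \<open>For groupoids of 1-cells this says that a 1-cell from a small object to the colimit of a sequence
factors, up to a 2-cell, through some term of the sequence.\<close>

lemma small_relative_factors: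
  fixes C :: "('o, 'm, 'c) two_cat" and \<kappa> :: "'k rel"
  assumes \<kappa>: "inaccessible \<kappa>"
    and x: "card_small_relative \<kappa> C J \<mu> x"
    and r: "small \<kappa> (Field (r :: 'k rel))" "filtered_ordinal \<mu> r" "colimit_preserving_sequence C r S"
      "\<And>i j. strictly_less r i j \<Longrightarrow> sar S i j \<in> J"
    and K: "is_hocolim C (seq_diagram r (Field r) S) K"
    and u: "u \<in> hom1 C x (apex K)"
  shows "\<exists>v \<in> Field r. \<exists>w \<in> hom1 C x (sob S v). \<exists>\<omega>. \<omega> \<in> hom2 C (leg K v \<cdot>\<^bsub>C\<^esub> w) u"
proof -
  interpret inaccessible_cardinal \<kappa>
    by unfold_locales (rule \<kappa>)
  let ?D = "seq_diagram r (Field r) S"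
  let ?HD = "hom_diagram C x ?D :: ('k, 'k \<times> 'k, 'k \<times> 'k \<times> 'k, ('m + 'k, 'c + 'k) groupoid, _, _) diagram"
  let ?HK = "hom_cocone C x K :: ('k, 'k \<times> 'k, ('m + 'k, 'c + 'k) groupoid, _, _) cocone"
  have HK: "is_hocolim (Gpd \<kappa>) ?HD ?HK"
    using x r K unfolding card_small_relative_def by blast
  obtain k1 k2 :: 'k where "k1 \<noteq> k2"
    using infinite_Field by (metis finite.emptyI finite.insertI finite_subset subsetI singletonI insertCI)
  then have two: "(Inr k1 :: 'c + 'k) \<noteq> Inr k2"
    by simp
  have "Inl u \<in> gobj (apex ?HK)"
    using u by (simp add: hom_cocone_def hom_groupoid_def)
  from Gpd_hocolim_covered[OF \<kappa> two HK this]
  obtain v w a where v: "v \<in> verts ?HD" and w: "w \<in> gobj (dob ?HD v)"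
    and a: "a \<in> ghom (apex ?HK) (fobj (leg ?HK v) w) (Inl u)"
    by blast
  have v': "v \<in> Field r"
    using v by (simp add: hom_diagram_def seq_diagram_def)
  have "leg K v \<in> hom1 C (sob S v) (apex K)"
    using hocolimD(2)[OF K] v' by (simp add: is_cocone_def seq_diagram_def)
  then have src: "Src C (leg K v) = sob S v"
    by (simp add: hom1_def)
  obtain w' where w': "w = Inl w'" "w' \<in> hom1 C x (sob S v)"
    using w by (auto simp: hom_diagram_def seq_diagram_def hom_groupoid_def)
  have "\<exists>\<omega>. \<omega> \<in> hom2 C (leg K v \<cdot>\<^bsub>C\<^esub> w') u"
    using a w' src by (auto simp: hom_cocone_def hom_groupoid_def hom_functor_def ghom_def hom2_def)
  then show ?thesis
    using v' w' by blast
qed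

section \<open>The construction, one cell at a time\<close>

text \<open>The data at stage \<open>k\<close>: the object \<open>Z\<^sub>k\<close> as the apex of a cocone under the earlier stages, its
structure map \<open>p\<^sub>k\<close> to \<open>Y\<close>, and for each earlier \<open>i\<close> the 2-cell from \<open>p\<^sub>k\<close> composed with \<open>Z\<^sub>i \<rightarrow> Z\<^sub>k\<close> to \<open>p\<^sub>i\<close>.\<close>

type_synonym ('k, 'o, 'm, 'c) stage = "('k, 'k \<times> 'k, 'o, 'm, 'c) cocone \<times> 'm \<times> ('k \<Rightarrow> 'c)"

definition stage_seq :: "('k \<Rightarrow> ('k, 'o, 'm, 'c) stage) \<Rightarrow> ('k, 'o, 'm, 'c) sequence" where
  "stage_seq D = \<lparr>sob = (\<lambda>k. apex (fst (D k))), sar = (\<lambda>i k. leg (fst (D k)) i),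
     scell = (\<lambda>i j k. legcell (fst (D k)) (i, j))\<rparr>"

lemma seq_cocone_stage_seq [simp]: "seq_cocone (stage_seq D) k = fst (D k)"
  by (simp add: seq_cocone_def stage_seq_def)

lemma stage_seq_simps [simp]:
  "sob (stage_seq D) k = apex (fst (D k))" "sar (stage_seq D) i k = leg (fst (D k)) i"
  "scell (stage_seq D) i j k = legcell (fst (D k)) (i, j)"
  by (simp_all add: stage_seq_def)

context indexed_21_category
begin

lemma is_hocolim_seq_cong:
  assumes "\<And>i. i \<in> A \<Longrightarrow> sob S i = sob S' i" "\<And>i j. i \<in> A \<Longrightarrow> j \<in> A \<Longrightarrow> sar S i j = sar S' i j"
    "\<And>i j k. i \<in> A \<Longrightarrow> j \<in> A \<Longrightarrow> k \<in> A \<Longrightarrow> scell S i j k = scell S' i j k"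
  shows "is_cocone C (seq_diagram r A S) = is_cocone C (seq_diagram r A S')"
    "is_factorization C (seq_diagram r A S) = is_factorization C (seq_diagram r A S')"
    "is_hocolim C (seq_diagram r A S) = is_hocolim C (seq_diagram r A S')"
proof -
  show c: "is_cocone C (seq_diagram r A S) = is_cocone C (seq_diagram r A S')"
    unfolding fun_eq_iff is_cocone_seq_iff using assms by simp
  show f: "is_factorization C (seq_diagram r A S) = is_factorization C (seq_diagram r A S')"
    unfolding fun_eq_iff is_factorization_seq_iff using assms by simp
  have "is_diagram C (seq_diagram r A S) = is_diagram C (seq_diagram r A S')"
    using assms by (auto simp: is_diagram_def seq_diagram_def)
  then show "is_hocolim C (seq_diagram r A S) = is_hocolim C (seq_diagram r A S')"
    unfolding fun_eq_iff is_hocolim_def verts_seq c f by simp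
qed

end

text \<open>The function \<open>\<phi>\<close> is the schedule: the cell attached to stage \<open>i\<close> is to solve the problem with code \<open>a\<close>
of stage \<open>j\<close>, where \<open>\<phi> i = (j, a)\<close>, if there is such a problem and \<open>j\<close> is not later than \<open>i\<close>.\<close>

locale cell_attachment = cocomplete_21_category C \<kappa>
  for C :: "('o, 'm, 'c) two_cat" (structure) and \<kappa> :: "'k rel" +
  fixes I :: "'m set" and f :: 'm and X Y :: 'o and \<phi> :: "'k \<Rightarrow> 'k \<times> 'k"
  assumes I: "I \<subseteq> Arr C" "small \<kappa> I" and f: "f \<in> hom1 C X Y"
    and schedule: "j \<in> Field \<kappa> \<Longrightarrow> a \<in> Field \<kappa> \<Longrightarrow> \<exists>i \<in> Field \<kappa>. (j, i) \<in> \<kappa> \<and> \<phi> i = (j, a)"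
begin

text \<open>An enumeration by \<open>\<kappa>\<close> of a set containing all lifting problems of \<open>p\<close>; other values are ignored by the schedule.\<close>

definition code :: "'m \<Rightarrow> 'k \<Rightarrow> 'm \<times> 'm \<times> 'm \<times> 'c" where
  "code p = (SOME c. problems I p \<subseteq> c ` Field \<kappa>)"

lemma code_surj:
  assumes "p \<in> Arr C" "x \<in> problems I p"
  shows "\<exists>a \<in> Field \<kappa>. code p a = x"
proof -
  obtain e where e: "inj_on e (problems I p)" "e ` problems I p \<subseteq> Field \<kappa>"
    using small_inj_Field[OF small_problems[OF I assms(1)]] by blast
  have "problems I p \<subseteq> inv_into (problems I p) e ` Field \<kappa>"
  proof
    fix y assume y: "y \<in> problems I p"
    then have "inv_into (problems I p) e (e y) = y"
      using e by simp
    moreover have "e y \<in> Field \<kappa>"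
      using e y by blast
    ultimately show "y \<in> inv_into (problems I p) e ` Field \<kappa>"
      by (metis imageI)
  qed
  then have "problems I p \<subseteq> code p ` Field \<kappa>"
    unfolding code_def by (rule someI[where P = "\<lambda>c. problems I p \<subseteq> c ` Field \<kappa>"])
  then show ?thesis
    using assms by blast
qed

abbreviation structure_map :: "('k \<Rightarrow> ('k, 'o, 'm, 'c) stage) \<Rightarrow> 'k \<Rightarrow> 'm" where
  "structure_map D k \<equiv> fst (snd (D k))"

text \<open>The cocone with apex \<open>Y\<close> formed by the structure maps. Its triangle identities at a largest index \<open>k\<close>
say that the 2-cells of stage \<open>k\<close> make \<open>p\<^sub>k\<close> a factorization of the cocone below \<open>k\<close>.\<close>

definition target :: "('k \<Rightarrow> ('k, 'o, 'm, 'c) stage) \<Rightarrow> ('k, 'k \<times> 'k, 'o, 'm, 'c) cocone" where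
  "target D = \<lparr>apex = Y, leg = (\<lambda>k. structure_map D k), legcell = (\<lambda>(i, j). snd (snd (D j)) i)\<rparr>"

definition valid :: "('k \<Rightarrow> ('k, 'o, 'm, 'c) stage) \<Rightarrow> 'k \<Rightarrow> ('k, 'o, 'm, 'c) stage \<Rightarrow> bool" where
  "valid D k = (\<lambda>(K, p, \<pi>).
     is_cocone C (seq_diagram \<kappa> {i. i \<sqsubset> k} (stage_seq D)) K \<and>
     is_factorization C (seq_diagram \<kappa> {i. i \<sqsubset> k} (stage_seq D)) K (target D) p \<pi> \<and>
     (is_least \<kappa> k \<longrightarrow> apex K = X \<and> p = f) \<and>
     (limit_point \<kappa> k \<longrightarrow> is_hocolim C (seq_diagram \<kappa> {i. i \<sqsubset> k} (stage_seq D)) K) \<and>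
     (\<forall>i. successor_pair \<kappa> i k \<longrightarrow> leg K i \<in> two_pushouts C I \<and>
        (\<forall>j a. \<phi> i = (j, a) \<and> (j = i \<or> j \<sqsubset> i) \<and> code (structure_map D j) a \<in> problems I (structure_map D j) \<longrightarrow>
           solves (leg K j) (\<pi> j) p (code (structure_map D j) a))))"

lemma valid_cong:
  assumes "\<And>i. i \<sqsubset> k \<Longrightarrow> D i = D' i"
  shows "valid D k st = valid D' k st"
proof -
  let ?A = "{i. i \<sqsubset> k}"
  have c: "is_cocone C (seq_diagram \<kappa> ?A (stage_seq D)) = is_cocone C (seq_diagram \<kappa> ?A (stage_seq D'))"
    "is_hocolim C (seq_diagram \<kappa> ?A (stage_seq D)) = is_hocolim C (seq_diagram \<kappa> ?A (stage_seq D'))"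
    using assms by (intro is_hocolim_seq_cong; simp)+
  have f: "is_factorization C (seq_diagram \<kappa> ?A (stage_seq D)) K (target D) p \<pi> \<longleftrightarrow>
      is_factorization C (seq_diagram \<kappa> ?A (stage_seq D')) K (target D') p \<pi>" for K p \<pi>
    unfolding is_factorization_seq_iff using assms by (simp add: target_def)
  have s: "successor_pair \<kappa> i k \<Longrightarrow> j = i \<or> j \<sqsubset> i \<Longrightarrow> D j = D' j" for i j
    using assms less_trans unfolding successor_pair_def by blast
  show ?thesis
    unfolding valid_def c f using s by (auto split: prod.split)
qed

lemma validD:
  assumes "valid D k (D k)"
  shows "is_cocone C (seq_diagram \<kappa> {i. i \<sqsubset> k} (stage_seq D)) (fst (D k))"
    "is_factorization C (seq_diagram \<kappa> {i. i \<sqsubset> k} (stage_seq D)) (fst (D k)) (target D)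
       (structure_map D k) (snd (snd (D k)))"
    "is_least \<kappa> k \<Longrightarrow> apex (fst (D k)) = X" "is_least \<kappa> k \<Longrightarrow> structure_map D k = f"
    "limit_point \<kappa> k \<Longrightarrow> is_hocolim C (seq_diagram \<kappa> {i. i \<sqsubset> k} (stage_seq D)) (fst (D k))"
    "successor_pair \<kappa> i k \<Longrightarrow> leg (fst (D k)) i \<in> two_pushouts C I"
    "successor_pair \<kappa> i k \<Longrightarrow> \<phi> i = (j, a) \<Longrightarrow> j = i \<or> j \<sqsubset> i \<Longrightarrow>
       code (structure_map D j) a \<in> problems I (structure_map D j) \<Longrightarrow>
       solves (leg (fst (D k)) j) (snd (snd (D k)) j) (structure_map D k) (code (structure_map D j) a)"
  using assms unfolding valid_def by (simp_all add: case_prod_beta)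

lemma structure_map_hom: "valid D k (D k) \<Longrightarrow> structure_map D k \<in> hom1 C (apex (fst (D k))) Y"
  using validD(2) by (auto simp: is_factorization_def target_def)

lemma valid_sequence:
  assumes v: "\<And>k. k \<in> A \<Longrightarrow> valid D k (D k)" and A: "\<And>i k. k \<in> A \<Longrightarrow> i \<sqsubset> k \<Longrightarrow> i \<in> A"
  shows "pseudofunctor_on A (stage_seq D)"
    "is_cocone C (seq_diagram \<kappa> A (stage_seq D)) (target D)"
proof -
  show "pseudofunctor_on A (stage_seq D)"
  proof (rule pseudofunctor_on_cocones)
    fix k assume k: "k \<in> A"
    have "{i \<in> A. i \<sqsubset> k} = {i. i \<sqsubset> k}"
      using A k by blast
    then show "is_cocone C (seq_diagram \<kappa> {i \<in> A. i \<sqsubset> k} (stage_seq D)) (seq_cocone (stage_seq D) k)"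
      using validD(1)[OF v[OF k]] by simp
  qed
  show "is_cocone C (seq_diagram \<kappa> A (stage_seq D)) (target D)"
    unfolding is_cocone_seq_iff
  proof (intro conjI ballI impI)
    show "apex (target D) \<in> Obj C"
      using f src_tgt by (auto simp: target_def hom1_def)
    show "leg (target D) i \<in> hom1 C (sob (stage_seq D) i) (apex (target D))" if "i \<in> A" for i
      using structure_map_hom[OF v[OF that]] by (simp add: target_def)
    show "legcell (target D) (i, j) \<in> hom2 C (leg (target D) j \<cdot> sar (stage_seq D) i j) (leg (target D) i)"
      if "i \<in> A" "j \<in> A" "i \<sqsubset> j" for i j
      using is_factorization_seqD(2)[OF validD(2)[OF v[OF that(2)]], of i] that(3) by (simp add: target_def)
    show "legcell (target D) (i, k) \<odot> lwhisker C (leg (target D) k) (scell (stage_seq D) i j k) =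
        legcell (target D) (i, j) \<odot> rwhisker C (legcell (target D) (j, k)) (sar (stage_seq D) i j)"
      if "i \<in> A" "j \<in> A" "k \<in> A" "i \<sqsubset> j \<and> j \<sqsubset> k" for i j k
      using is_factorization_seqD(3)[OF validD(2)[OF v[OF that(3)]], of i j] that(4) less_trans[of i j k]
      by (simp add: target_def)
  qed
qed

text \<open>The problem of stage \<open>i\<close> to be solved by the next cell is the scheduled one, transported from stage \<open>j\<close>
by inverting the comparison of structure maps. If the schedule does not name a problem of an
available stage, any problem of stage \<open>i\<close> will do; this is where \<open>problems I (structure_map D i) \<noteq> {}\<close> is used,
as each successor step has to attach some cell.\<close>

lemma scheduled_problem:
  assumes v: "\<And>k. k = i \<or> k \<sqsubset> i \<Longrightarrow> valid D k (D k)" and ne: "problems I (structure_map D i) \<noteq> {}"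
  shows "\<exists>x \<in> problems I (structure_map D i). \<forall>j a u \<psi> p Z. \<phi> i = (j, a) \<longrightarrow> j = i \<or> j \<sqsubset> i \<longrightarrow>
    code (structure_map D j) a \<in> problems I (structure_map D j) \<longrightarrow>
    p \<in> hom1 C Z Y \<longrightarrow> u \<in> hom1 C (apex (fst (D i))) Z \<longrightarrow> \<psi> \<in> hom2 C (p \<cdot> u) (structure_map D i) \<longrightarrow>
    solves u \<psi> p x \<longrightarrow>
    solves (if j = i then u else u \<cdot> leg (fst (D i)) j)
      (if j = i then \<psi> else snd (snd (D i)) j \<odot> rwhisker C \<psi> (leg (fst (D i)) j)) p (code (structure_map D j) a)"
proof -
  obtain j a where ja: "\<phi> i = (j, a)"
    by fastforce
  show ?thesis
  proof (cases "j \<sqsubset> i \<and> code (structure_map D j) a \<in> problems I (structure_map D j)")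
    case False
    show ?thesis
    proof (cases "j = i \<and> code (structure_map D j) a \<in> problems I (structure_map D j)")
      case True
      then show ?thesis
        using ja by (intro bexI[of _ "code (structure_map D i) a"]) auto
    next
      case False
      with \<open>\<not> (j \<sqsubset> i \<and> code (structure_map D j) a \<in> problems I (structure_map D j))\<close> ja ne show ?thesis
        by auto
    qed
  next
    case True
    then have ji: "j \<sqsubset> i" and cp: "code (structure_map D j) a \<in> problems I (structure_map D j)"
      by blast+
    obtain g h h' \<eta> where x: "code (structure_map D j) a = (g, h, h', \<eta>)"
      by (metis prod_cases4)
    have pi: "structure_map D i \<in> hom1 C (apex (fst (D i))) Y" and pj: "structure_map D j \<in> hom1 C (apex (fst (D j))) Y"
      using structure_map_hom v ji by blast+
    have a1: "leg (fst (D i)) j \<in> hom1 C (apex (fst (D j))) (apex (fst (D i)))"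
      using is_cocone_seqD(2)[OF validD(1)[OF v[of i]], of j] ji by simp
    have c1: "snd (snd (D i)) j \<in> hom2 C (structure_map D i \<cdot> leg (fst (D i)) j) (structure_map D j)"
      using is_factorization_seqD(2)[OF validD(2)[OF v[of i]], of j] ji by (simp add: target_def)
    note [simp] = pi[unfolded hom1_def mem_Collect_eq] pj[unfolded hom1_def mem_Collect_eq]
      a1[unfolded hom1_def mem_Collect_eq] c1[unfolded hom2_def mem_Collect_eq]
    have ghe: "g \<in> I" "h \<in> hom1 C (Src C g) (apex (fst (D j)))" "h' \<in> hom1 C (Tgt C g) Y"
      "\<eta> \<in> hom2 C (h' \<cdot> g) (structure_map D j \<cdot> h)"
      using cp unfolding x by (simp_all add: problems_def)
    have g: "g \<in> Arr C"
      using ghe(1) I by blast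
    note [simp] = g ghe(2,3)[unfolded hom1_def mem_Collect_eq] ghe(4)[unfolded hom2_def mem_Collect_eq]
    let ?\<eta> = "inv2 (rwhisker C (snd (snd (D i)) j) h) \<odot> \<eta>"
    have "(g, leg (fst (D i)) j \<cdot> h, h', ?\<eta>) \<in> problems I (structure_map D i)"
      using ghe(1) by (simp add: problems_def hom1_def hom2_def)
    moreover have "solves (u \<cdot> leg (fst (D i)) j) (snd (snd (D i)) j \<odot> rwhisker C \<psi> (leg (fst (D i)) j))
        p (g, h, h', \<eta>)"
      if p: "p \<in> hom1 C Z Y" and u: "u \<in> hom1 C (apex (fst (D i))) Z" and \<psi>: "\<psi> \<in> hom2 C (p \<cdot> u) (structure_map D i)"
        and sol: "solves u \<psi> p (g, leg (fst (D i)) j \<cdot> h, h', ?\<eta>)" for u \<psi> p Z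
      using solves_precomp[OF sol pj pi p a1 u g ghe(2,3) c1 \<psi>] by simp
    moreover have "j \<noteq> i"
      using ji by auto
    ultimately show ?thesis
      using ja x by (intro bexI[of _ "(g, leg (fst (D i)) j \<cdot> h, h', ?\<eta>)"]) auto
  qed
qed

text \<open>At a successor of \<open>i\<close>, the earlier indices have \<open>i\<close> as their last element, so their canonical cocone at \<open>i\<close>
can be postcomposed with the leg of the pushout. At a limit, a homotopy colimit is chosen, and the
structure map is induced by the cocone of the earlier ones.\<close>

lemma next_stage:
  assumes k: "k \<in> Field \<kappa>" and v: "\<And>i. i \<sqsubset> k \<Longrightarrow> valid D i (D i)"
    and ne: "\<And>i. i \<sqsubset> k \<Longrightarrow> problems I (structure_map D i) \<noteq> {}"
  shows "\<exists>st. valid D k st"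
proof -
  let ?A = "{i. i \<sqsubset> k}" and ?S = "stage_seq D"
  have down: "i \<in> ?A" if "j \<in> ?A" "i \<sqsubset> j" for i j
    using that less_trans by blast
  have S: "pseudofunctor_on ?A ?S" and T: "is_cocone C (seq_diagram \<kappa> ?A ?S) (target D)"
    using valid_sequence[of ?A D] v down by auto
  consider "\<And>i. \<not> i \<sqsubset> k" | i where "successor_pair \<kappa> i k" | "limit_point \<kappa> k"
    using k unfolding limit_point_def by blast
  then show ?thesis
  proof cases
    case 1
    then have "?A = {}" "\<not> limit_point \<kappa> k" "\<not> successor_pair \<kappa> i k" for i
      by (auto simp: limit_point_def successor_pair_def)
    moreover have "X \<in> Obj C" "f \<in> hom1 C X Y"
      using f src_tgt by (auto simp: hom1_def)
    ultimately have "valid D k (\<lparr>apex = X, leg = undefined, legcell = undefined\<rparr>, f, undefined)"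
      by (simp add: valid_def is_cocone_seq_iff is_factorization_seq_iff target_def)
    then show ?thesis
      by blast
  next
    case (2 i)
    then have ik: "i \<sqsubset> k"
      by (simp add: successor_pair_def)
    have top: "j \<sqsubset> i" if "j \<sqsubset> k" "j \<noteq> i" for j
      using 2 that less_linear[of j i] less_Field unfolding successor_pair_def by blast
    have iF: "j = i" if "successor_pair \<kappa> j k" for j
      using 2 that top[of j] unfolding successor_pair_def by blast
    have notleast: "\<not> is_least \<kappa> k"
    proof
      assume "is_least \<kappa> k"
      then have "(k, i) \<in> \<kappa>"
        using less_Field(1)[OF ik] by (simp add: is_least_def)
      then show False
        using ik rel_iff[OF k, of i] less_asym[OF ik] by auto
    qed
    have notlimit: "\<not> limit_point \<kappa> k"
      using 2 by (auto simp: limit_point_def)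
    have vi: "valid D j (D j)" if "j = i \<or> j \<sqsubset> i" for j
      using v that ik less_trans by blast
    obtain x where xp: "x \<in> problems I (structure_map D i)"
      and sched: "\<And>j a u \<psi> p Z. \<phi> i = (j, a) \<Longrightarrow> j = i \<or> j \<sqsubset> i \<Longrightarrow>
        code (structure_map D j) a \<in> problems I (structure_map D j) \<Longrightarrow> p \<in> hom1 C Z Y \<Longrightarrow>
        u \<in> hom1 C (apex (fst (D i))) Z \<Longrightarrow> \<psi> \<in> hom2 C (p \<cdot> u) (structure_map D i) \<Longrightarrow> solves u \<psi> p x \<Longrightarrow>
        solves (if j = i then u else u \<cdot> leg (fst (D i)) j)
          (if j = i then \<psi> else snd (snd (D i)) j \<odot> rwhisker C \<psi> (leg (fst (D i)) j)) p (code (structure_map D j) a)"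
      using scheduled_problem[of i D, OF vi ne[OF ik]] by meson
    obtain g h h' \<eta> where x: "x = (g, h, h', \<eta>)"
      by (metis prod_cases4)
    have pi: "structure_map D i \<in> hom1 C (apex (fst (D i))) Y"
      using structure_map_hom vi by blast
    have ghe: "g \<in> I" "h \<in> hom1 C (Src C g) (apex (fst (D i)))" "h' \<in> hom1 C (Tgt C g) Y"
      "\<eta> \<in> hom2 C (h' \<cdot> g) (structure_map D i \<cdot> h)"
      using xp pi unfolding x by (simp_all add: problems_def hom1_def)
    have g: "g \<in> Arr C"
      using ghe(1) I by blast
    have h: "h \<in> Arr C" "Src C h = Src C g"
      using ghe(2) by (simp_all add: hom1_def)
    obtain K0 where K0: "is_hocolim C (span_diagram C g h) K0"
      using pushout_exists[OF g h] by blast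
    let ?u = "leg K0 Foot2"
    obtain p \<psi> where u: "?u \<in> hom1 C (apex (fst (D i))) (apex K0)" and p: "p \<in> hom1 C (apex K0) Y"
      and \<psi>: "\<psi> \<in> hom2 C (p \<cdot> ?u) (structure_map D i)" and sol: "solves ?u \<psi> p x"
      using pushout_solves[OF g ghe(2) pi ghe(3,4) K0] unfolding x by blast
    note [simp] = u[unfolded hom1_def mem_Collect_eq] p[unfolded hom1_def mem_Collect_eq]
      \<psi>[unfolded hom2_def mem_Collect_eq] pi[unfolded hom1_def mem_Collect_eq]
    have iA: "i \<in> ?A" and topA: "\<And>j. j \<in> ?A \<Longrightarrow> j \<noteq> i \<Longrightarrow> j \<sqsubset> i"
      using ik top by auto
    have dia: "is_diagram C (seq_diagram \<kappa> ?A ?S)"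
      by (rule is_diagram_seq[OF S])
    have tc: "is_cocone C (seq_diagram \<kappa> ?A ?S) (top_cocone ?S i)"
      by (rule is_cocone_top[OF S iA topA])
    have tf: "is_factorization C (seq_diagram \<kappa> ?A ?S) (top_cocone ?S i) (target D) (leg (target D) i)
        (top_factorization i (target D))"
      by (rule is_factorization_top[OF S iA topA T])
    let ?K = "postcompose ?u (top_cocone ?S i)"
    let ?\<pi> = "\<lambda>v. top_factorization i (target D) v \<odot> rwhisker C \<psi> (leg (top_cocone ?S i) v)"
    have u': "?u \<in> hom1 C (apex (top_cocone ?S i)) (apex K0)"
      using u by (simp add: top_cocone_def)
    have 1: "is_cocone C (seq_diagram \<kappa> ?A ?S) ?K"
      by (rule is_cocone_postcompose[OF dia tc u'])
    have 2: "is_factorization C (seq_diagram \<kappa> ?A ?S) ?K (target D) p ?\<pi>"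
      using p \<psi> by (intro is_factorization_postcompose[OF dia tc T tf u']) (simp_all add: target_def)
    have 3: "leg ?K i = ?u" "?\<pi> i = \<psi>"
      by (simp_all add: postcompose_def top_cocone_def top_factorization_def target_def)
    have 4: "leg ?K j = ?u \<cdot> leg (fst (D i)) j"
      "?\<pi> j = snd (snd (D i)) j \<odot> rwhisker C \<psi> (leg (fst (D i)) j)" if "j \<sqsubset> i" for j
      using that less_irrefl[of i]
      by (auto simp: postcompose_def top_cocone_def top_factorization_def target_def)
    have push: "?u \<in> two_pushouts C I"
      unfolding two_pushouts_def using ghe(1) h K0 by blast
    have solved: "solves (leg ?K j) (?\<pi> j) p (code (structure_map D j) a)"
      if "\<phi> i = (j, a)" "j = i \<or> j \<sqsubset> i" "code (structure_map D j) a \<in> problems I (structure_map D j)" for j a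
    proof (cases "j = i")
      case True
      then show ?thesis
        using sched[OF that p u \<psi> sol] 3 by simp
    next
      case False
      then have "j \<sqsubset> i"
        using that(2) by blast
      then show ?thesis
        using sched[OF that p u \<psi> sol] False by (simp only: 4 if_False)
    qed
    have "valid D k (?K, p, ?\<pi>)"
      unfolding valid_def case_prod_conv
    proof (intro conjI allI impI)
      show "leg ?K j \<in> two_pushouts C I" if "successor_pair \<kappa> j k" for j
        using iF[OF that] push 3 by simp
      show "solves (leg ?K j) (?\<pi> j) p (code (structure_map D j) a)"
        if "successor_pair \<kappa> i' k"
          "\<phi> i' = (j, a) \<and> (j = i' \<or> j \<sqsubset> i') \<and> code (structure_map D j) a \<in> problems I (structure_map D j)" for i' j a
        using iF[OF that(1)] that(2) solved by blast
    qed (use 1 2 notleast notlimit in blast)+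
    then show ?thesis
      by blast
  next
    case 3
    obtain K where K: "is_hocolim C (seq_diagram \<kappa> ?A ?S) K"
      using seq_hocolim_exists[OF S small_below] by blast
    obtain p \<pi> where F: "is_factorization C (seq_diagram \<kappa> ?A ?S) K (target D) p \<pi>"
      using hocolimD(3)[OF K T] by blast
    have notleast: "\<not> is_least \<kappa> k"
    proof
      assume least: "is_least \<kappa> k"
      obtain i where ik: "i \<sqsubset> k"
        using 3 by (auto simp: limit_point_def)
      then have "(k, i) \<in> \<kappa>"
        using least less_Field(1)[OF ik] by (simp add: is_least_def)
      then show False
        using ik rel_iff[OF k, of i] less_asym[OF ik] by auto
    qed
    have "valid D k (K, p, \<pi>)"
      unfolding valid_def case_prod_conv
      using 3 notleast F K hocolimD(2)[OF K] by (auto simp: limit_point_def)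
    then show ?thesis
      by blast
  qed
qed

text \<open>The recursion makes no claim about stages later than one without lifting problems, since the
next successor step might have no cell to attach.\<close>

lemma stages_exist:
  "\<exists>D. \<forall>k \<in> Field \<kappa>. (\<forall>i. i \<sqsubset> k \<longrightarrow> problems I (structure_map D i) \<noteq> {}) \<longrightarrow> valid D k (D k)"
proof -
  define P where "P D k st \<longleftrightarrow>
    (k \<in> Field \<kappa> \<longrightarrow> (\<forall>i. i \<sqsubset> k \<longrightarrow> problems I (structure_map D i) \<noteq> {}) \<longrightarrow> valid D k st)" for D k st
  have "\<exists>D. \<forall>k. P D k (D k)"
  proof (rule dependent_wf_choice[OF wf_less])
    show "P D k st \<longleftrightarrow> P D' k st" if "\<And>z. (z, k) \<in> {(i, j). i \<sqsubset> j} \<Longrightarrow> D z = D' z" for D D' k st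
      using that valid_cong[of k D D' st] by (simp add: P_def)
    show "\<exists>st. P D k st" if IH: "\<And>y. (y, k) \<in> {(i, j). i \<sqsubset> j} \<Longrightarrow> P D y (D y)" for D k
    proof (cases "k \<in> Field \<kappa> \<and> (\<forall>i. i \<sqsubset> k \<longrightarrow> problems I (structure_map D i) \<noteq> {})")
      case True
      have "valid D i (D i)" if i: "i \<sqsubset> k" for i
        using IH[of i] i True less_Field(1)[OF i] less_trans[OF _ i] by (simp add: P_def)
      then show ?thesis
        using next_stage[of k D] True by (auto simp: P_def)
    next
      case False
      then show ?thesis
        by (auto simp: P_def)
    qed
  qed
  then show ?thesis
    unfolding P_def by blast
qed

end

section \<open>The factorization\<close>

context cell_attachment
begin

lemma cellular_stages:
  assumes v: "\<And>k. k \<in> A \<Longrightarrow> valid D k (D k)" and A: "\<And>i k. k \<in> A \<Longrightarrow> i \<sqsubset> k \<Longrightarrow> i \<in> A"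
  shows "cellular_on I A (stage_seq D)"
  unfolding cellular_on_def
proof (intro conjI ballI impI allI)
  show "pseudofunctor_on A (stage_seq D)"
    by (rule valid_sequence(1)[OF v A])
  show "is_hocolim C (seq_diagram \<kappa> {i. i \<sqsubset> b} (stage_seq D)) (seq_cocone (stage_seq D) b)"
    if "b \<in> A" "limit_point \<kappa> b" for b
    using validD(5)[OF v[OF that(1)] that(2)] by simp
  show "sar (stage_seq D) i b \<in> two_pushouts C I" if "b \<in> A" "successor_pair \<kappa> i b" for b i
    using validD(6)[OF v[OF that(1)] that(2)] by simp
qed

text \<open>This is applied to the first stage without lifting problems or, if there is none, to \<open>\<delta>\<close>.\<close>

lemma factorization_at_stage:
  assumes A: "A \<subseteq> Field \<kappa>" "\<And>i k. k \<in> A \<Longrightarrow> i \<sqsubset> k \<Longrightarrow> i \<in> A"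
    and v: "\<And>k. k \<in> A \<Longrightarrow> valid D k (D k)"
    and k: "k \<in> A" and inj: "structure_map D k \<in> I_inj C I"
  shows "\<exists>Z \<in> Obj C. \<exists>f' \<in> hom1 C X Z. \<exists>f'' \<in> hom1 C Z Y.
           f' \<in> I_cell \<kappa> C I \<and> f'' \<in> I_inj C I \<and> isomorphic1 C (f'' \<cdot> f') f"
proof -
  obtain z where z: "is_least \<kappa> z"
    using least_exists by blast
  have zF: "z \<in> Field \<kappa>"
    using z by (simp add: is_least_def)
  have zk: "z = k \<or> z \<sqsubset> k"
    using z k A rel_iff[OF zF, of k] by (auto simp: is_least_def)
  have zA: "z \<in> A"
    using zk k A(2) by blast
  let ?S = "stage_seq D"
  let ?f' = "if z = k then Id1 C (sob ?S k) else sar ?S z k"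
  have p: "structure_map D k \<in> hom1 C (sob ?S k) Y"
    using structure_map_hom[OF v[OF k]] by simp
  have X: "sob ?S z = X" and fz: "structure_map D z = f"
    using validD(3,4)[OF v[OF zA] z] by simp_all
  have pf: "pseudofunctor_on A ?S"
    by (rule valid_sequence(1)[OF v A(2)])
  have obk: "sob ?S k \<in> Obj C"
    by (rule pseudofunctor_onD(1)[OF pf k])
  have f': "?f' \<in> hom1 C X (sob ?S k)"
    using pseudofunctor_onD(2)[OF pf zA k] zk X id1_in[OF obk] by (cases "z = k") auto
  have cell: "?f' \<in> I_cell \<kappa> C I"
    by (rule segment_I_cell[OF cellular_stages[OF v A(2)] A k zk])
  have "\<exists>\<alpha>. \<alpha> \<in> hom2 C (structure_map D k \<cdot> ?f') f"
  proof (cases "z = k")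
    case True
    then show ?thesis
      using p fz id2_in[of f] f by (auto simp: hom1_def)
  next
    case False
    then have "z \<sqsubset> k"
      using zk by blast
    then show ?thesis
      using is_factorization_seqD(2)[OF validD(2)[OF v[OF k]], of z] fz False
      by (auto simp: target_def)
  qed
  then have "isomorphic1 C (structure_map D k \<cdot> ?f') f"
    using isomorphic1I by blast
  then show ?thesis
    using obk f' p cell inj by blast
qed

lemma problem_solved_later:
  assumes v: "\<And>k. k \<in> Field \<kappa> \<Longrightarrow> valid D k (D k)"
    and j: "j \<in> Field \<kappa>" and x: "x \<in> problems I (structure_map D j)"
  shows "\<exists>k. j \<sqsubset> k \<and> solves (leg (fst (D k)) j) (snd (snd (D k)) j) (structure_map D k) x"
proof -
  have "structure_map D j \<in> Arr C"
    using structure_map_hom[OF v[OF j]] by (simp add: hom1_def)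
  then obtain a where a: "a \<in> Field \<kappa>" "code (structure_map D j) a = x"
    using code_surj x by blast
  obtain i where i: "i \<in> Field \<kappa>" "(j, i) \<in> \<kappa>" "\<phi> i = (j, a)"
    using schedule[OF j a(1)] by blast
  obtain k where k: "k \<in> Field \<kappa>" "successor_pair \<kappa> i k"
    using successor_exists[OF i(1)] by blast
  have ji: "j = i \<or> j \<sqsubset> i"
    using rel_iff[OF j] i(2) by blast
  then have "j \<sqsubset> k"
    using k(2) less_trans[of j i k] by (auto simp: successor_pair_def)
  moreover have "solves (leg (fst (D k)) j) (snd (snd (D k)) j) (structure_map D k) x"
    using validD(7)[OF v[OF k(1)] k(2) i(3) ji] a x by simp
  ultimately show ?thesis
    by blast
qed

text \<open>Each problem of stage \<open>j\<close> is solved at some later stage, and there is only a small set of problems.\<close>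

lemma closure_bound:
  assumes v: "\<And>k. k \<in> Field \<kappa> \<Longrightarrow> valid D k (D k)" and j: "j \<in> Field \<kappa>"
  shows "\<exists>t \<in> Field \<kappa>. \<forall>x \<in> problems I (structure_map D j). \<exists>k. j \<sqsubset> k \<and> k \<sqsubset> t \<and>
    solves (leg (fst (D k)) j) (snd (snd (D k)) j) (structure_map D k) x"
proof -
  have "\<forall>x \<in> problems I (structure_map D j). \<exists>k. j \<sqsubset> k \<and> solves (leg (fst (D k)) j) (snd (snd (D k)) j) (structure_map D k) x"
    using problem_solved_later[OF v j] by blast
  then obtain s where s: "\<forall>x \<in> problems I (structure_map D j). j \<sqsubset> s x \<and>
      solves (leg (fst (D (s x))) j) (snd (snd (D (s x))) j) (structure_map D (s x)) x"
    by metis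
  have "structure_map D j \<in> Arr C"
    using structure_map_hom[OF v[OF j]] by (simp add: hom1_def)
  then have "small \<kappa> (s ` problems I (structure_map D j))"
    by (intro small_image small_problems I)
  moreover have "s ` problems I (structure_map D j) \<subseteq> Field \<kappa>"
    using s less_Field(2) by blast
  ultimately obtain t where "t \<in> Field \<kappa>" "\<forall>k \<in> s ` problems I (structure_map D j). k \<sqsubset> t"
    using small_bounded by blast
  then show ?thesis
    using s by blast
qed

text \<open>The assumption \<open>filtered\<close> makes the domains of \<open>I\<close> small with respect to the sequence below \<open>\<delta>\<close>, whose
1-cells are in \<open>I\<close>-cell by \<open>segment_I_cell\<close>. So a lifting problem of stage \<open>\<delta>\<close> comes from a problem \<open>?x\<close>
of a stage \<open>j\<close> below \<open>\<delta>\<close>, and \<open>closed\<close> provides a solution at a stage \<open>k\<close> still below \<open>\<delta>\<close>.\<close>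

lemma stage_injective:
  assumes v: "\<And>k. k \<in> Field \<kappa> \<Longrightarrow> valid D k (D k)"
    and \<delta>: "limit_point \<kappa> \<delta>"
    and closed: "\<And>j x. j \<sqsubset> \<delta> \<Longrightarrow> x \<in> problems I (structure_map D j) \<Longrightarrow> \<exists>k. j \<sqsubset> k \<and> k \<sqsubset> \<delta> \<and>
      solves (leg (fst (D k)) j) (snd (snd (D k)) j) (structure_map D k) x"
    and \<mu>: "\<And>g. g \<in> I \<Longrightarrow> card_small_relative \<kappa> C (I_cell \<kappa> C I) (\<mu> g) (Src C g)"
    and filtered: "\<And>g. g \<in> I \<Longrightarrow> filtered_ordinal (\<mu> g) (Restr \<kappa> {i. i \<sqsubset> \<delta>})"
  shows "structure_map D \<delta> \<in> I_inj C I"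
  unfolding I_inj_iff
proof (safe)
  let ?S = "stage_seq D" and ?A = "{i. i \<sqsubset> \<delta>}"
  let ?r = "Restr \<kappa> ?A"
  have \<delta>F: "\<delta> \<in> Field \<kappa>"
    using \<delta> by (simp add: limit_point_def)
  have pd: "structure_map D \<delta> \<in> hom1 C (apex (fst (D \<delta>))) Y"
    by (rule structure_map_hom[OF v[OF \<delta>F]])
  then show "structure_map D \<delta> \<in> Arr C"
    by (simp add: hom1_def)
  have AF: "?A \<subseteq> Field \<kappa>"
    using less_Field(1) by blast
  have F: "Field ?r = ?A"
    by (rule Field_Restr[OF AF])
  have cell: "cellular_on I (Field \<kappa>) ?S"
    by (rule cellular_stages[OF v]) (auto dest: less_Field)
  have down: "i \<in> ?A" if "k \<in> ?A" "i \<sqsubset> k" for i k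
    using that less_trans by blast
  have cellA: "cellular_on I ?A ?S"
    by (rule cellular_stages[OF v]) (auto dest: less_Field less_trans)
  obtain z where z: "is_least \<kappa> z"
    using least_exists by blast
  have zF: "z \<in> Field \<kappa>"
    using z by (simp add: is_least_def)
  have zi: "z = i \<or> z \<sqsubset> i" if "i \<in> Field \<kappa>" for i
    using z that rel_iff[OF zF, of i] by (auto simp: is_least_def)
  obtain i1 where "i1 \<sqsubset> \<delta>"
    using \<delta> by (auto simp: limit_point_def)
  then have zA: "z \<in> ?A"
    using zi[OF \<delta>F] zi[of i1] less_Field(1)[of i1 \<delta>] less_trans[of z i1 \<delta>] by auto
  \<comment> \<open>The indices below \<open>\<delta>\<close> are the segment starting at the least index.\<close>
  have Aeq: "?A = {k \<in> ?A. k = z \<or> z \<sqsubset> k}"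
    using zi AF by blast
  have cp: "colimit_preserving_sequence C ?r ?S"
    by (rule segment_colimit_preserving[OF cellA AF down zA Aeq])
  have arrows: "sar ?S i j \<in> I_cell \<kappa> C I" if "strictly_less ?r i j" for i j
  proof -
    have ij: "i \<sqsubset> j"
      using that by simp
    then have "(if i = j then Id1 C (sob ?S j) else sar ?S i j) \<in> I_cell \<kappa> C I"
      using less_Field by (intro segment_I_cell[OF cell]) auto
    moreover have "i \<noteq> j"
      using ij by auto
    ultimately show ?thesis
      by simp
  qed
  have hc: "is_hocolim C (seq_diagram ?r (Field ?r) ?S) (fst (D \<delta>))"
    unfolding F seq_diagram_Restr[OF order_refl] by (rule validD(5)[OF v[OF \<delta>F] \<delta>])
  fix g h h' \<eta> assume pr: "(g, h, h', \<eta>) \<in> problems I (structure_map D \<delta>)"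
  then have prD: "g \<in> I" "h \<in> hom1 C (Src C g) (apex (fst (D \<delta>)))" "h' \<in> hom1 C (Tgt C g) Y"
      "\<eta> \<in> hom2 C (h' \<cdot> g) (structure_map D \<delta> \<cdot> h)"
    using pd by (simp_all add: problems_def hom1_def)
  have g: "g \<in> Arr C"
    using prD(1) I by blast
  have sm: "small \<kappa> (Field ?r)"
    unfolding F by (rule small_below)
  obtain j w \<omega> where "j \<in> Field ?r" and w: "w \<in> hom1 C (Src C g) (sob ?S j)"
    and \<omega>: "\<omega> \<in> hom2 C (leg (fst (D \<delta>)) j \<cdot> w) h"
    using small_relative_factors[OF inaccessible \<mu>[OF prD(1)] sm filtered[OF prD(1)] cp arrows hc prD(2)]
    by blast
  then have j: "j \<sqsubset> \<delta>"
    using F by auto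
  have jF: "j \<in> Field \<kappa>"
    using less_Field(1)[OF j] .
  have pj: "structure_map D j \<in> hom1 C (apex (fst (D j))) Y"
    by (rule structure_map_hom[OF v[OF jF]])
  have w': "w \<in> hom1 C (Src C g) (apex (fst (D j)))"
    using w by simp
  note co = is_cocone_seqD[OF validD(1)[OF v[OF \<delta>F]], unfolded stage_seq_simps]
  note fa = is_factorization_seqD[OF validD(2)[OF v[OF \<delta>F]], unfolded stage_seq_simps]
  have c: "leg (fst (D \<delta>)) j \<in> hom1 C (apex (fst (D j))) (apex (fst (D \<delta>)))"
    using co(2)[of j] j by simp
  have \<tau>: "snd (snd (D \<delta>)) j \<in> hom2 C (structure_map D \<delta> \<cdot> leg (fst (D \<delta>)) j) (structure_map D j)"
    using fa(2)[of j] j by (simp add: target_def)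
  let ?x = "(g, w, h', rwhisker C (snd (snd (D \<delta>)) j) w \<odot> (lwhisker C (structure_map D \<delta>) (inv2 \<omega>) \<odot> \<eta>))"
  have "?x \<in> problems I (structure_map D j)"
  proof -
    note [simp] = pj[unfolded hom1_def mem_Collect_eq] pd[unfolded hom1_def mem_Collect_eq]
      w'[unfolded hom1_def mem_Collect_eq] c[unfolded hom1_def mem_Collect_eq] g
      prD(2,3)[unfolded hom1_def mem_Collect_eq] prD(4)[unfolded hom2_def mem_Collect_eq]
      \<tau>[unfolded hom2_def mem_Collect_eq] \<omega>[unfolded hom2_def mem_Collect_eq]
    show ?thesis
      using prD(1) by (simp add: problems_def hom1_def hom2_def)
  qed
  then obtain k where k: "j \<sqsubset> k" "k \<sqsubset> \<delta>"
    and sol: "solves (leg (fst (D k)) j) (snd (snd (D k)) j) (structure_map D k) ?x"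
    using closed[OF j] by blast
  have kF: "k \<in> Field \<kappa>"
    using less_Field(1)[OF k(2)] .
  have pk: "structure_map D k \<in> hom1 C (apex (fst (D k))) Y"
    by (rule structure_map_hom[OF v[OF kF]])
  have a: "leg (fst (D k)) j \<in> hom1 C (apex (fst (D j))) (apex (fst (D k)))"
    using is_cocone_seqD(2)[OF validD(1)[OF v[OF kF]], of j] k by simp
  have b: "leg (fst (D \<delta>)) k \<in> hom1 C (apex (fst (D k))) (apex (fst (D \<delta>)))"
    using co(2)[of k] k by simp
  have \<pi>: "snd (snd (D k)) j \<in> hom2 C (structure_map D k \<cdot> leg (fst (D k)) j) (structure_map D j)"
    using is_factorization_seqD(2)[OF validD(2)[OF v[OF kF]], of j] k by (simp add: target_def)
  have \<rho>: "snd (snd (D \<delta>)) k \<in> hom2 C (structure_map D \<delta> \<cdot> leg (fst (D \<delta>)) k) (structure_map D k)"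
    using fa(2)[of k] k by (simp add: target_def)
  have s: "legcell (fst (D \<delta>)) (j, k) \<in> hom2 C (leg (fst (D \<delta>)) k \<cdot> leg (fst (D k)) j) (leg (fst (D \<delta>)) j)"
    using co(3)[of j k] j k by simp
  have coh: "snd (snd (D \<delta>)) j \<odot> lwhisker C (structure_map D \<delta>) (legcell (fst (D \<delta>)) (j, k)) =
      snd (snd (D k)) j \<odot> rwhisker C (snd (snd (D \<delta>)) k) (leg (fst (D k)) j)"
    using fa(3)[of j k] j k by (simp add: target_def)
  have "solves (leg (fst (D \<delta>)) j) (snd (snd (D \<delta>)) j) (structure_map D \<delta>) ?x"
    by (rule solves_comp[OF sol pj pk pd a b c g w' prD(3) \<pi> \<rho> \<tau> s coh])
  then show "lifts (structure_map D \<delta>) g h h' \<eta>"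
    by (rule lifts_of_solves[OF _ pj pd c g w' prD(3,2) \<tau> \<omega> prD(4)])
qed

lemma factorization:
  assumes small: "\<And>g. g \<in> I \<Longrightarrow> small_relative \<kappa> C (I_cell \<kappa> C I) (Src C g)"
  shows "\<exists>Z \<in> Obj C. \<exists>f' \<in> hom1 C X Z. \<exists>f'' \<in> hom1 C Z Y.
           f' \<in> I_cell \<kappa> C I \<and> f'' \<in> I_inj C I \<and> isomorphic1 C (f'' \<cdot> f') f"
proof -
  obtain D where D: "\<And>k. k \<in> Field \<kappa> \<Longrightarrow> (\<And>i. i \<sqsubset> k \<Longrightarrow> problems I (structure_map D i) \<noteq> {}) \<Longrightarrow> valid D k (D k)"
    using stages_exist by blast
  show ?thesis
  proof (cases "\<exists>k \<in> Field \<kappa>. problems I (structure_map D k) = {}")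
    case True
    then obtain b where b: "b \<in> {k \<in> Field \<kappa>. problems I (structure_map D k) = {}}"
      by blast
    obtain k where k: "k \<in> {k \<in> Field \<kappa>. problems I (structure_map D k) = {}}"
      and min: "\<And>y. (y, k) \<in> {(i, j). i \<sqsubset> j} \<Longrightarrow> y \<notin> {k \<in> Field \<kappa>. problems I (structure_map D k) = {}}"
      using b by (rule wfE_min[OF wf_less]) blast
    let ?A = "{i. i = k \<or> i \<sqsubset> k}"
    have AF: "?A \<subseteq> Field \<kappa>"
      using k less_Field(1) by blast
    have down: "i \<in> ?A" if "j \<in> ?A" "i \<sqsubset> j" for i j
      using that less_trans by blast
    have ne: "problems I (structure_map D i) \<noteq> {}" if "i \<sqsubset> k" for i
      using min[of i] that less_Field(1)[OF that] by blast
    have v: "valid D j (D j)" if "j \<in> ?A" for j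
    proof (rule D)
      show "j \<in> Field \<kappa>"
        using that AF by blast
      show "problems I (structure_map D i) \<noteq> {}" if "i \<sqsubset> j" for i
        using ne[of i] that \<open>j \<in> ?A\<close> less_trans[of i j k] by blast
    qed
    have "structure_map D k \<in> Arr C"
      using structure_map_hom[OF v] by (simp add: hom1_def)
    then have inj: "structure_map D k \<in> I_inj C I"
      using k by (simp add: I_inj_iff)
    show ?thesis
    proof (rule factorization_at_stage[where D = D and k = k, OF AF])
      show "i \<in> ?A" if "j \<in> ?A" "i \<sqsubset> j" for i j
        by (rule down[OF that])
    qed (use v inj in auto)
  next
    case False
    have v: "valid D k (D k)" if "k \<in> Field \<kappa>" for k
      using D[OF that] False less_Field(1) by blast
    have "\<forall>j. \<exists>t. j \<in> Field \<kappa> \<longrightarrow> t \<in> Field \<kappa> \<and> (\<forall>x \<in> problems I (structure_map D j). \<exists>k. j \<sqsubset> k \<and> k \<sqsubset> t \<and>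
        solves (leg (fst (D k)) j) (snd (snd (D k)) j) (structure_map D k) x)"
      using closure_bound[OF v] by blast
    then obtain T where T: "\<And>j. j \<in> Field \<kappa> \<Longrightarrow> T j \<in> Field \<kappa>"
      "\<And>j x. j \<in> Field \<kappa> \<Longrightarrow> x \<in> problems I (structure_map D j) \<Longrightarrow> \<exists>k. j \<sqsubset> k \<and> k \<sqsubset> T j \<and>
        solves (leg (fst (D k)) j) (snd (snd (D k)) j) (structure_map D k) x"
      by metis
    have "\<forall>g. \<exists>\<mu> :: 'k rel. g \<in> I \<longrightarrow> Card_order \<mu> \<and> \<mu> <o \<kappa> \<and>
        card_small_relative \<kappa> C (I_cell \<kappa> C I) \<mu> (Src C g)"
      using small unfolding small_relative_def by blast
    then obtain \<mu> :: "'m \<Rightarrow> 'k rel" where \<mu>: "\<And>g. g \<in> I \<Longrightarrow> Card_order (\<mu> g)" "\<And>g. g \<in> I \<Longrightarrow> \<mu> g <o \<kappa>"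
      "\<And>g. g \<in> I \<Longrightarrow> card_small_relative \<kappa> C (I_cell \<kappa> C I) (\<mu> g) (Src C g)"
      by metis
    \<comment> \<open>A single small set that is at least as large as each smallness cardinal.\<close>
    define M where "M = (\<Union>g \<in> I. Field (\<mu> g))"
    have "small \<kappa> M"
      unfolding M_def
    proof (rule small_UNION[OF I(2)])
      fix g assume "g \<in> I"
      then show "small \<kappa> (Field (\<mu> g))"
        unfolding small_def using card_of_Field_ordIso[OF \<mu>(1)] \<mu>(2) ordIso_ordLess_trans by blast
    qed
    then obtain \<delta> where \<delta>: "limit_point \<kappa> \<delta>" "\<And>j. j \<sqsubset> \<delta> \<Longrightarrow> T j \<sqsubset> \<delta>"
      and large: "\<And>A. A \<subseteq> {i. i \<sqsubset> \<delta>} \<Longrightarrow> |A| \<le>o |M| \<Longrightarrow> \<exists>b. b \<sqsubset> \<delta> \<and> (\<forall>a \<in> A. a \<sqsubset> b)"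
      using exists_closed_limit_point[of M T] T(1) by blast
    have inj: "structure_map D \<delta> \<in> I_inj C I"
    proof (rule stage_injective[OF v \<delta>(1) _ \<mu>(3)])
      show "\<exists>k. j \<sqsubset> k \<and> k \<sqsubset> \<delta> \<and> solves (leg (fst (D k)) j) (snd (snd (D k)) j) (structure_map D k) x"
        if "j \<sqsubset> \<delta>" "x \<in> problems I (structure_map D j)" for j x
        using T(2)[OF less_Field(1)[OF that(1)] that(2)] \<delta>(2)[OF that(1)] less_trans by blast
      show "filtered_ordinal (\<mu> g) (Restr \<kappa> {i. i \<sqsubset> \<delta>})" if g: "g \<in> I" for g
        unfolding filtered_ordinal_def
      proof (intro allI impI)
        have "{i. i \<sqsubset> \<delta>} \<subseteq> Field \<kappa>"
          using less_Field(1) by blast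
        then have F: "Field (Restr \<kappa> {i. i \<sqsubset> \<delta>}) = {i. i \<sqsubset> \<delta>}"
          by (rule Field_Restr)
        fix A assume A: "A \<subseteq> Field (Restr \<kappa> {i. i \<sqsubset> \<delta>})" "|A| <o \<mu> g"
        have "\<mu> g =o |Field (\<mu> g)|"
          using card_of_Field_ordIso[OF \<mu>(1)[OF g]] ordIso_symmetric by blast
        moreover have "|Field (\<mu> g)| \<le>o |M|"
          unfolding M_def using g by (intro card_of_mono1) blast
        ultimately have "|A| \<le>o |M|"
          using A(2) ordLess_ordIso_trans ordLess_ordLeq_trans ordLess_imp_ordLeq by metis
        then obtain b where b: "b \<sqsubset> \<delta>" "\<forall>a \<in> A. a \<sqsubset> b"
          using large[of A] A(1) unfolding F by blast
        have "(a, b) \<in> Restr \<kappa> {i. i \<sqsubset> \<delta>}" if "a \<in> A" for a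
          using b that A(1) unfolding F by (auto simp: strictly_less_def)
        then show "\<exists>b \<in> Field (Restr \<kappa> {i. i \<sqsubset> \<delta>}). \<forall>a \<in> A. (a, b) \<in> Restr \<kappa> {i. i \<sqsubset> \<delta>}"
          using b(1) unfolding F by blast
      qed
    qed
    have "\<delta> \<in> Field \<kappa>"
      using \<delta>(1) by (simp add: limit_point_def)
    then show ?thesis
      using v inj less_Field(1)
      by (intro factorization_at_stage[where D = D and k = \<delta>, OF order_refl]) simp_all
  qed
qed

end

theorem theorem6p8:
  fixes C :: "('o, 'm, 'c) two_cat" and \<kappa> :: "'k rel" and I :: "'m set"
    and f :: 'm and X Y :: 'o
  assumes "inaccessible \<kappa>"
    and "strict_21_category C"
    and "locally_small \<kappa> C"
    and "two_cocomplete \<kappa> C"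
    and "I \<subseteq> Arr C"
    and "small \<kappa> I"
    and "\<forall>g \<in> I. small_relative \<kappa> C (I_cell \<kappa> C I) (Src C g)"
    and "f \<in> hom1 C X Y"
  shows "\<exists>Z \<in> Obj C. \<exists>f' \<in> hom1 C X Z. \<exists>f'' \<in> hom1 C Z Y.
           f' \<in> I_cell \<kappa> C I \<and> f'' \<in> I_inj C I \<and> isomorphic1 C (f'' \<cdot>\<^bsub>C\<^esub> f') f"
proof -
  interpret inaccessible_cardinal \<kappa>
    by unfold_locales (rule assms(1))
  interpret strict_21_category C
    by (rule assms(2))
  interpret cocomplete_21_category C \<kappa>
    by unfold_locales (rule assms)+
  obtain \<phi> :: "'k \<Rightarrow> 'k \<times> 'k" where
    \<phi>: "\<forall>j \<in> Field \<kappa>. \<forall>a \<in> Field \<kappa>. \<exists>i \<in> Field \<kappa>. (j, i) \<in> \<kappa> \<and> \<phi> i = (j, a)"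
    using bookkeeping by blast
  interpret cell_attachment C \<kappa> I f X Y \<phi>
    by unfold_locales (use assms \<phi> in auto)
  show ?thesis
    using assms(7) by (intro factorization) blast
qed

end
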